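(* Let $d\ge 5$ be an integer and $\sigma_d=\frac{2d+1}{6}$. There exist constants $C_d,c_d,T_d>0$ (depending only on $d$) such that $$|G_d(x,t)|\le C_d(1+|t|)^{-\sigma_d}\qquad\text{for all }(x,t)\in\mathbb Z^d\times\mathbb R,$$ and $$\sup_{x\in\mathbb Z^d}|G_d(x,t)|\ge c_d(1+|t|)^{-\sigma_d}\qquad\text{for all }t\in\mathbb R\text{ with }|t|\ge T_d.$$
   Context: $G_d$ is the fundamental solution of the discrete wave equation $\partial_t^2u-\Delta u=0$ on the lattice $\mathbb Z^d$, where $\Delta f(x)=\sum_{j=1}^d(f(x+e_j)+f(x-e_j)-2f(x))$. Explicitly, for $(x,t)\in\mathbb Z^d\times\mathbb R$, $$G_d(x,t)=\frac1{(2\pi)^d}\int_{\mathbb T^d}e^{ix\cdot\xi}\,\frac{\sin(t\omega(\xi))}{\omega(\xi)}\,d\xi,\qquad \omega(\xi)=\Big(\sum_{j=1}^d(2-2\cos\xi_j)\Big)^{1/2},$$ where $\mathbb T^d$ is the cube $[-\pi,\pi]^d$ with opposite sides identified, with Lebesgue measure. *)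

theory Defs
  imports "HOL-Analysis.Analysis"
begin

text \<open>
  The dimension \<open>d\<close> is \<open>CARD('n)\<close> for a finite index type \<open>'n\<close>: the lattice is \<open>int ^ 'n\<close>, and
  frequencies are points of \<open>real ^ 'n\<close>.
\<close>

text \<open>The torus is represented by its fundamental cube; identifying opposite sides does not
  affect integrals.\<close>

definition torus :: "(real ^ 'n) set" where
  "torus = cbox (\<chi> j. - pi) (\<chi> j. pi)"

definition \<omega> :: "real ^ 'n \<Rightarrow> real" where
  "\<omega> \<xi> = sqrt (\<Sum>j\<in>UNIV. 2 - 2 * cos (\<xi> $ j))"

definition phase :: "int ^ 'n \<Rightarrow> real ^ 'n \<Rightarrow> real" where
  "phase x \<xi> = (\<Sum>j\<in>UNIV. of_int (x $ j) * \<xi> $ j)"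

text \<open>The symbol \<open>sin (t \<omega>) / \<omega>\<close> is undefined only where \<open>\<omega> \<xi> = 0\<close>, which within the cube is the
  single point \<open>\<xi> = 0\<close>; the value 0 given there by HOL division does not affect the integral.\<close>

definition G :: "int ^ 'n \<Rightarrow> real \<Rightarrow> complex" where
  "G x t = complex_of_real (1 / (2 * pi) ^ CARD('n)) *
     (LINT \<xi>:torus|lborel. exp (\<i> * of_real (phase x \<xi>)) * of_real (sin (t * \<omega> \<xi>) / \<omega> \<xi>))"

definition \<sigma> :: "nat \<Rightarrow> real" where
  "\<sigma> d = (2 * real d + 1) / 6"

end

theory Submission
  imports Defs "HOL-Probability.Distributions"
begin

text \<open>The damping cannot be sent to 0 in the estimate itself: collecting the powers of s
  leaves a factor s^(-1/2-(d-1)/3) that is not integrable at 0, and the constant gained from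
  exp(-a/(4s)) is unbounded as a tends to 0. So a stays fixed at 1 and 2, and the undamped symbol is
  rebuilt algebraically from these two. The decay exponent is 1/2 - (d-1)/3 - 1 in the upper bound:
  the first term comes from dividing by c(z), the second from the d-th power of the kernel bound
  once an integrable profile in T is set aside, the third from ds = dT / (2t). In the lower bound it
  is the exponent of the volume of the box, (d-1)/3 + 1/2. The difficulty of the lower bound is that
  the linearization errors on a box of the natural size have the same order as the main term.
  Shrinking the box by a fixed amount, measured by a constant K, gives the errors an extra factor
  1/K relative to the volume, so a large K, fixed before t, makes them harmless. Duality replaces
  asymptotic analysis: one integral against a multiplier bounds the supremum over the lattice, and
  no maximizing x has to be found.\<close>

text \<open>
  Upper bound. For \<open>z = a - i t\<close> with \<open>a > 0\<close> the substitution \<open>y = \<mu> \<surd>s - 1 / (2 \<surd>s)\<close> turns a Gaussian integral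
  into \<open>c(z) e\<^sup>-\<^sup>z\<^sup>\<mu> / \<mu> = \<integral> s\<^sup>-\<^sup>1\<^sup>/\<^sup>2 exp (- z (\<mu>\<^sup>2 s + 1 / (4 s))) ds\<close> over \<open>s > 0\<close>, where \<open>c(z)\<^sup>2 = \<pi> / z\<close>. For
  \<open>\<mu> = \<omega>(\<xi>)\<close> the exponent \<open>\<mu>\<^sup>2\<close> is a sum over the coordinates, so the Fourier transform in \<open>\<xi>\<close> is a
  product of \<open>d\<close> damped Bessel functions. By van der Corput's lemma these are bounded by
  \<open>T\<^sup>-\<^sup>1\<^sup>/\<^sup>4 (|T \<plusminus> n| + T\<^sup>1\<^sup>/\<^sup>3)\<^sup>-\<^sup>1\<^sup>/\<^sup>4\<close> with \<open>T = 2 t s\<close>, and integrating their \<open>d\<close>-th powers in \<open>s\<close> gives the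
  decay rate, the factor \<open>exp (- a / (4 s))\<close> taking care of small \<open>s\<close>. The damping \<open>e\<^sup>-\<^sup>a\<^sup>\<omega>\<close> is removed by
  \<open>1 = 2 cosh u e\<^sup>-\<^sup>u - e\<^sup>-\<^sup>2\<^sup>u\<close>: the function \<open>cosh \<omega>\<close> is entire in the trigonometric polynomial \<open>\<omega>\<^sup>2\<close> and hence a
  bounded multiplier for the supremum norm.

  Lower bound. At \<open>(\<pi>/2, \<dots>, \<pi>/2)\<close> the Hessian of \<open>\<omega>\<close> has rank one, its range being spanned by
  \<open>(1, \<dots>, 1)\<close>. Hence \<open>t \<omega>\<close> is close to an affine function on a box around this point of side about
  \<open>t\<^sup>-\<^sup>1\<^sup>/\<^sup>3\<close>, thinned to \<open>t\<^sup>-\<^sup>1\<^sup>/\<^sup>2\<close> in the direction \<open>(1, \<dots>, 1)\<close>. Testing with the sine of that affine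
  function times a nonnegative trigonometric polynomial of Wiener norm at most 1 concentrated on
  the box bounds the supremum from below by a multiple of the volume of the box.
\<close>

section \<open>Fourier multipliers on the torus\<close>

text \<open>A density rather than \<open>restrict_space\<close>, so that the measurable sets remain those of \<open>borel\<close>.\<close>

definition rst :: "'a::euclidean_space set \<Rightarrow> 'a measure" where
  "rst A = density lborel (\<lambda>x. ennreal (indicator A x))"

lemma sets_rst [simp, measurable_cong]: "sets (rst A) = sets borel"
  and space_rst [simp]: "space (rst A) = UNIV"
  by (simp_all add: rst_def)

lemma integral_rst:
  fixes f :: "'a::euclidean_space \<Rightarrow> 'b::{banach, second_countable_topology}"
  assumes [measurable]: "A \<in> sets borel" "f \<in> borel_measurable borel"
  shows "integral\<^sup>L (rst A) f = (LINT x:A|lborel. f x)"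
  unfolding rst_def set_lebesgue_integral_def by (subst integral_density) auto

lemma integrable_rst:
  fixes f :: "'a::euclidean_space \<Rightarrow> 'b::{banach, second_countable_topology}"
  assumes [measurable]: "A \<in> sets borel" "f \<in> borel_measurable borel"
  shows "integrable (rst A) f \<longleftrightarrow> set_integrable lborel A f"
  unfolding rst_def set_integrable_def by (subst integrable_density) auto

lemma AE_rst:
  assumes [measurable]: "A \<in> sets borel"
  shows "(AE x in rst A. P x) \<longleftrightarrow> (AE x in lborel. x \<in> A \<longrightarrow> P x)"
  unfolding rst_def by (subst AE_density) (auto simp: indicator_def)

lemma AE_rstI:
  assumes [measurable]: "A \<in> sets borel" and "\<And>x. x \<in> A \<Longrightarrow> P x"
  shows "AE x in rst A. P x"
  using assms by (simp add: AE_rst)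

lemma emeasure_rst:
  assumes [measurable]: "A \<in> sets borel" "B \<in> sets borel"
  shows "emeasure (rst A) B = emeasure lborel (A \<inter> B)"
  unfolding rst_def
  by (subst emeasure_density) (auto simp: ennreal_indicator indicator_inter_arith [symmetric])

lemma sigma_finite_rst:
  assumes [measurable]: "A \<in> sets borel"
  shows "sigma_finite_measure (rst A)"
proof -
  have "sigma_finite_measure (density lborel (\<lambda>x. ennreal (indicator A x)))"
    by (subst sigma_finite_measure.sigma_finite_iff_density_finite [OF sigma_finite_lborel]) (auto intro!: AE_I2)
  then show ?thesis by (simp add: rst_def)
qed

lemma finite_measure_rst:
  assumes "compact A" shows "finite_measure (rst A)"
proof
  have [measurable]: "A \<in> sets borel" using assms by (simp add: borel_compact)
  have "emeasure (rst A) UNIV = emeasure lborel (A \<inter> UNIV)"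
    by (rule emeasure_rst) auto
  then show "emeasure (rst A) (space (rst A)) \<noteq> \<infinity>"
    using emeasure_compact_finite [OF assms] by auto
qed

lemma integrable_rst_bounded:
  fixes f :: "'a::euclidean_space \<Rightarrow> 'b::{banach, second_countable_topology}"
  assumes "compact A" "f \<in> borel_measurable borel" "\<And>x. x \<in> A \<Longrightarrow> norm (f x) \<le> B"
  shows "integrable (rst A) f"
proof -
  interpret finite_measure "rst A" by (rule finite_measure_rst [OF assms(1)])
  show ?thesis
    using assms by (intro integrable_const_bound [where B = B] AE_rstI) (auto simp: borel_compact)
qed

lemma integral_rst_mono:
  fixes f g :: "'a::euclidean_space \<Rightarrow> real"
  assumes "A \<in> sets borel" "integrable (rst A) f" "integrable (rst A) g"
    and "\<And>x. x \<in> A \<Longrightarrow> f x \<le> g x"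
  shows "integral\<^sup>L (rst A) f \<le> integral\<^sup>L (rst A) g"
  using assms by (intro integral_mono_AE AE_rstI) auto

lemma integrable_rst_boundE:
  fixes f :: "'a::euclidean_space \<Rightarrow> 'b::{banach, second_countable_topology}"
    and g :: "'a \<Rightarrow> 'c::{banach, second_countable_topology}"
  assumes "A \<in> sets borel" "integrable (rst A) g" "f \<in> borel_measurable borel"
    and "\<And>x. x \<in> A \<Longrightarrow> norm (f x) \<le> norm (g x)"
  shows "integrable (rst A) f"
  using assms by (intro Bochner_Integration.integrable_bound [OF assms(2)] AE_rstI) auto

section \<open>Product integrals over Euclidean space and over the cube\<close>

lemma Basis_vec_axis: "(Basis :: (real ^ 'n) set) = range (\<lambda>j. axis j 1)"
  by (auto simp: Basis_vec_def)

lemma inj_axis_1: "inj (\<lambda>j. axis j (1 :: real))"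
  by (auto simp: inj_on_def axis_eq_axis)

lemma sum_Basis_nth: "(\<Sum>b\<in>Basis. f b *\<^sub>R b) $ j = f (axis j 1 :: real ^ 'n)"
proof -
  have "(\<Sum>b\<in>Basis. f b *\<^sub>R b) $ j = (\<Sum>i\<in>UNIV. f (axis i 1) * (axis i 1 $ j))"
    unfolding Basis_vec_axis by (subst sum.reindex [OF inj_axis_1]) simp
  also have "\<dots> = (\<Sum>i\<in>UNIV. if i = j then f (axis i 1) else 0)"
    by (intro sum.cong) (auto simp: axis_def)
  finally show ?thesis by simp
qed

lemma
  fixes f :: "'n::finite \<Rightarrow> real \<Rightarrow> 'a::{real_normed_field, banach, second_countable_topology}"
  assumes f: "\<And>j. integrable lborel (f j)"
  shows integrable_prod_lborel: "integrable lborel (\<lambda>x :: real ^ 'n. \<Prod>j\<in>UNIV. f j (x $ j))"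
    and integral_prod_lborel:
      "(\<integral>x. (\<Prod>j\<in>UNIV. f j ((x :: real ^ 'n) $ j)) \<partial>lborel) = (\<Prod>j\<in>UNIV. integral\<^sup>L lborel (f j))"
proof -
  interpret product_sigma_finite "\<lambda>_ :: real ^ 'n. lborel :: real measure" ..
  \<comment> \<open>The product measure behind \<open>lborel\<close> is indexed by basis vectors;
    \<open>ix\<close> recovers the coordinate of a basis vector, so that products over
    \<open>Basis\<close> and over \<open>UNIV\<close> can be exchanged.\<close>
  define ix where "ix = (inv (\<lambda>j. axis j (1 :: real)) :: real ^ 'n \<Rightarrow> 'n)"
  have ix [simp]: "ix (axis j 1) = j" for j
    unfolding ix_def by (rule inv_f_f [OF inj_axis_1])
  have [measurable]: "f j \<in> borel_measurable borel" for j
    using borel_measurable_integrable [OF f [of j]] by simp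
  have reidx: "(\<Prod>b\<in>Basis. g (ix b) b) = (\<Prod>j\<in>UNIV. g j (axis j 1))" for g :: "'n \<Rightarrow> real ^ 'n \<Rightarrow> 'a"
    unfolding Basis_vec_axis by (subst prod.reindex [OF inj_axis_1]) simp
  let ?T = "\<lambda>h :: real ^ 'n \<Rightarrow> real. \<Sum>b\<in>Basis. h b *\<^sub>R b"
  have eq: "(\<Prod>j\<in>UNIV. f j (?T h $ j)) = (\<Prod>b\<in>Basis. f (ix b) (h b))" for h
    unfolding sum_Basis_nth reidx [of "\<lambda>j b. f j (h b)"] ..
  have T [measurable]: "?T \<in> measurable (\<Pi>\<^sub>M b\<in>Basis. lborel) borel" by measurable
  have "integrable (\<Pi>\<^sub>M b\<in>(Basis :: (real ^ 'n) set). lborel) (\<lambda>h. \<Prod>b\<in>Basis. f (ix b) (h b))"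
    by (rule product_integrable_prod) (auto intro: f)
  then show "integrable lborel (\<lambda>x :: real ^ 'n. \<Prod>j\<in>UNIV. f j (x $ j))"
    by (subst lborel_eq, subst integrable_distr_eq) (simp_all add: eq del: sum_component)
  have "(\<integral>x. (\<Prod>j\<in>UNIV. f j ((x :: real ^ 'n) $ j)) \<partial>lborel)
      = (\<integral>h. (\<Prod>b\<in>Basis. f (ix b) (h b)) \<partial>(\<Pi>\<^sub>M b\<in>(Basis :: (real ^ 'n) set). lborel))"
    by (subst lborel_eq, subst integral_distr) (simp_all add: eq del: sum_component)
  also have "\<dots> = (\<Prod>b\<in>(Basis :: (real ^ 'n) set). integral\<^sup>L lborel (f (ix b)))"
    by (rule product_integral_prod) (auto intro: f)
  also have "\<dots> = (\<Prod>j\<in>UNIV. integral\<^sup>L lborel (f j))"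
    by (rule reidx)
  finally show "(\<integral>x. (\<Prod>j\<in>UNIV. f j ((x :: real ^ 'n) $ j)) \<partial>lborel) = (\<Prod>j\<in>UNIV. integral\<^sup>L lborel (f j))" .
qed

lemma mem_torus: "\<xi> \<in> torus \<longleftrightarrow> (\<forall>j. \<xi> $ j \<in> {-pi..pi})"
  by (auto simp: torus_def mem_box_cart)

lemma compact_torus [simp]: "compact torus"
  by (simp add: torus_def)

lemma torus_borel [measurable, simp]: "torus \<in> sets borel"
  by (simp add: torus_def)

lemma indicator_torus:
  "indicator torus \<xi> = (\<Prod>j\<in>UNIV. indicator {-pi..pi} (\<xi> $ j) :: 'a::comm_semiring_1)"
proof (cases "\<xi> \<in> torus")
  case False
  then obtain j where "\<xi> $ j \<notin> {-pi..pi}" by (auto simp: mem_torus)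
  then have "(\<Prod>j\<in>UNIV. indicator {-pi..pi} (\<xi> $ j) :: 'a) = 0"
    by (intro prod_zero) (auto intro!: exI [of _ j])
  with False show ?thesis by simp
qed (simp add: mem_torus)

lemma
  fixes f :: "'n::finite \<Rightarrow> real \<Rightarrow> 'a::{real_normed_field, banach, second_countable_topology}"
  assumes f: "\<And>j. integrable (rst {-pi..pi}) (f j)"
  shows integrable_prod_torus: "integrable (rst torus) (\<lambda>x :: real ^ 'n. \<Prod>j\<in>UNIV. f j (x $ j))"
    and integral_prod_torus:
      "(\<integral>x. (\<Prod>j\<in>UNIV. f j ((x :: real ^ 'n) $ j)) \<partial>rst torus) = (\<Prod>j\<in>UNIV. integral\<^sup>L (rst {-pi..pi}) (f j))"
proof -
  have [measurable]: "f j \<in> borel_measurable borel" for j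
    using borel_measurable_integrable [OF f [of j]] by (simp cong: measurable_cong_sets)
  let ?g = "\<lambda>j x. indicator {-pi..pi} x *\<^sub>R f j x"
  have g: "integrable lborel (?g j)" for j
    using f [of j] by (simp add: integrable_rst set_integrable_def)
  have eq: "indicator torus x *\<^sub>R (\<Prod>j\<in>UNIV. f j (x $ j)) = (\<Prod>j\<in>UNIV. ?g j (x $ j))" for x :: "real ^ 'n"
    by (simp add: indicator_torus scaleR_conv_of_real prod.distrib)
  show "integrable (rst torus) (\<lambda>x :: real ^ 'n. \<Prod>j\<in>UNIV. f j (x $ j))"
    using integrable_prod_lborel [of ?g, OF g]
    by (subst integrable_rst) (auto simp: set_integrable_def eq)
  show "(\<integral>x. (\<Prod>j\<in>UNIV. f j ((x :: real ^ 'n) $ j)) \<partial>rst torus) = (\<Prod>j\<in>UNIV. integral\<^sup>L (rst {-pi..pi}) (f j))"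
    using integral_prod_lborel [of ?g, OF g]
    by (subst integral_rst) (auto simp: set_lebesgue_integral_def eq integral_rst)
qed

section \<open>The unnormalized Fourier transform and its multipliers\<close>

definition FT :: "(real ^ 'n \<Rightarrow> complex) \<Rightarrow> int ^ 'n \<Rightarrow> complex" where
  "FT f x = (\<integral>\<xi>. exp (\<i> * of_real (phase x \<xi>)) * f \<xi> \<partial>rst torus)"

lemma phase_measurable [measurable]: "phase x \<in> borel_measurable borel"
  unfolding phase_def [abs_def] by measurable

lemma omega_measurable [measurable]: "\<omega> \<in> borel_measurable borel"
  unfolding \<omega>_def [abs_def] by measurable

lemma norm_exp_i_phase [simp]: "norm (exp (\<i> * of_real (phase x \<xi>))) = 1"
  by (rule norm_exp_i_times)

lemma phase_add: "phase (x + y) \<xi> = phase x \<xi> + phase y \<xi>"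
  by (simp add: phase_def sum.distrib algebra_simps)

lemma phase_uminus: "phase (- x) \<xi> = - phase x \<xi>"
  by (simp add: phase_def sum_negf)

text \<open>A weak form of the bound \<open>B\<close> on the norm of \<open>m\<close> in the Wiener algebra.\<close>

definition wiener :: "real \<Rightarrow> (real ^ 'n \<Rightarrow> complex) \<Rightarrow> bool" where
  "wiener B m \<longleftrightarrow> m \<in> borel_measurable borel \<and> (\<exists>b. \<forall>\<xi>\<in>torus. norm (m \<xi>) \<le> b) \<and>
     (\<forall>f D. integrable (rst torus) f \<longrightarrow> (\<forall>x. norm (FT f x) \<le> D) \<longrightarrow>
        (\<forall>x. norm (FT (\<lambda>\<xi>. m \<xi> * f \<xi>) x) \<le> B * D))"

lemma wiener_integrable:
  assumes m: "wiener B m" and f: "integrable (rst torus) f"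
  shows "integrable (rst torus) (\<lambda>\<xi>. m \<xi> * f \<xi>)"
proof -
  have [measurable]: "m \<in> borel_measurable borel" using m by (simp add: wiener_def)
  from m obtain b where b: "\<forall>\<xi>\<in>torus. norm (m \<xi>) \<le> b"
    unfolding wiener_def by blast
  have [measurable]: "f \<in> borel_measurable borel"
    using borel_measurable_integrable [OF f] by (simp cong: measurable_cong_sets)
  show ?thesis
  proof (rule integrable_rst_boundE [where g = "\<lambda>\<xi>. of_real b * f \<xi>"])
    fix \<xi> :: "real ^ 'a" assume "\<xi> \<in> torus"
    then have "norm (m \<xi>) \<le> \<bar>b\<bar>" using b by fastforce
    then show "norm (m \<xi> * f \<xi>) \<le> norm (of_real b * f \<xi>)"
      by (simp add: norm_mult mult_right_mono)
  qed (use f in auto)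
qed

lemma integrable_FT:
  assumes f: "integrable (rst torus) f"
  shows "integrable (rst torus) (\<lambda>\<xi>. exp (\<i> * of_real (phase x \<xi>)) * f \<xi>)"
proof -
  have [measurable]: "f \<in> borel_measurable borel"
    using borel_measurable_integrable [OF f] by (simp cong: measurable_cong_sets)
  show ?thesis
    by (rule integrable_rst_boundE [OF _ f]) (auto simp: norm_mult)
qed

lemma wienerD:
  assumes "wiener B m" "integrable (rst torus) f" "\<And>x. norm (FT f x) \<le> D"
  shows "norm (FT (\<lambda>\<xi>. m \<xi> * f \<xi>) x) \<le> B * D"
  using assms unfolding wiener_def by blast

lemma wiener_mono:
  assumes "wiener B m" "B \<le> B'"
  shows "wiener B' m"
  unfolding wiener_def
proof (intro conjI allI impI)
  fix f :: "real ^ 'a \<Rightarrow> complex" and D x assume *: "integrable (rst torus) f" "\<forall>x. norm (FT f x) \<le> D"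
  then have "norm (FT (\<lambda>\<xi>. m \<xi> * f \<xi>) x) \<le> B * D" using assms(1) wienerD by blast
  moreover have "0 \<le> D" using * by (meson norm_ge_zero order_trans)
  ultimately show "norm (FT (\<lambda>\<xi>. m \<xi> * f \<xi>) x) \<le> B' * D"
    using assms(2) by (meson mult_right_mono order_trans)
qed (use assms in \<open>auto simp: wiener_def\<close>)

text \<open>Multiplying by a character translates the transform on the lattice, which leaves its
  supremum unchanged. All other multipliers are built from this one by algebra and limits.\<close>

lemma wiener_char: "wiener (norm c) (\<lambda>\<xi>. c * exp (\<i> * of_real (phase y \<xi>)))"
  unfolding wiener_def
proof (intro conjI allI impI)
  show "\<exists>b. \<forall>\<xi>\<in>torus. norm (c * exp (\<i> * of_real (phase y \<xi>))) \<le> b"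
    by (intro exI [of _ "norm c"]) (auto simp: norm_mult)
  fix f :: "real ^ 'a \<Rightarrow> complex" and D x
  assume "integrable (rst torus) f" and D: "\<forall>x. norm (FT f x) \<le> D"
  have "FT (\<lambda>\<xi>. c * exp (\<i> * of_real (phase y \<xi>)) * f \<xi>) x = c * FT f (x + y)"
    unfolding FT_def by (subst integral_mult_right_zero [symmetric], intro Bochner_Integration.integral_cong)
      (auto simp: phase_add exp_add ring_distribs)
  then show "norm (FT (\<lambda>\<xi>. c * exp (\<i> * of_real (phase y \<xi>)) * f \<xi>) x) \<le> norm c * D"
    using D by (simp add: norm_mult mult_left_mono)
qed auto

lemma wiener_const: "wiener (norm c) (\<lambda>\<xi>. c)"
  using wiener_char [of c 0] by (simp add: phase_def)

lemma wiener_add: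
  assumes "wiener A m" "wiener B k"
  shows "wiener (A + B) (\<lambda>\<xi>. m \<xi> + k \<xi>)"
  unfolding wiener_def
proof (intro conjI allI impI)
  show "(\<lambda>\<xi>. m \<xi> + k \<xi>) \<in> borel_measurable borel" using assms by (auto simp: wiener_def)
  from assms obtain a b where "\<forall>\<xi>\<in>torus. norm (m \<xi>) \<le> a" "\<forall>\<xi>\<in>torus. norm (k \<xi>) \<le> b"
    unfolding wiener_def by blast
  then show "\<exists>b. \<forall>\<xi>\<in>torus. norm (m \<xi> + k \<xi>) \<le> b"
    by (intro exI [of _ "a + b"]) (meson add_mono norm_triangle_le order_trans)
  fix f :: "real ^ 'a \<Rightarrow> complex" and D x
  assume f: "integrable (rst torus) f" and D: "\<forall>x. norm (FT f x) \<le> D"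
  note int = integrable_FT [OF wiener_integrable [OF _ f], of _ _ x]
  have "FT (\<lambda>\<xi>. (m \<xi> + k \<xi>) * f \<xi>) x = FT (\<lambda>\<xi>. m \<xi> * f \<xi>) x + FT (\<lambda>\<xi>. k \<xi> * f \<xi>) x"
    unfolding FT_def Bochner_Integration.integral_add [OF int [OF assms(1)] int [OF assms(2)], symmetric]
    by (simp add: algebra_simps)
  then show "norm (FT (\<lambda>\<xi>. (m \<xi> + k \<xi>) * f \<xi>) x) \<le> (A + B) * D"
    using wienerD [OF assms(1) f] wienerD [OF assms(2) f] D
    by (simp add: ring_distribs) (meson add_mono norm_triangle_le order_trans)
qed

text \<open>The bound for \<open>m\<close> is applied to the function
  \<open>k \<xi> * f \<xi>\<close>, whose transform is already bounded by
  \<open>B * D\<close>.\<close>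

lemma wiener_mult:
  assumes m: "wiener A m" and k: "wiener B k"
  shows "wiener (A * B) (\<lambda>\<xi>. m \<xi> * k \<xi>)"
  unfolding wiener_def
proof (intro conjI allI impI)
  show "(\<lambda>\<xi>. m \<xi> * k \<xi>) \<in> borel_measurable borel" using assms by (auto simp: wiener_def)
  from assms obtain a b where "\<forall>\<xi>\<in>torus. norm (m \<xi>) \<le> a" "\<forall>\<xi>\<in>torus. norm (k \<xi>) \<le> b"
    unfolding wiener_def by blast
  then show "\<exists>b. \<forall>\<xi>\<in>torus. norm (m \<xi> * k \<xi>) \<le> b"
    by (intro exI [of _ "a * b"])
      (auto simp: norm_mult intro!: mult_mono intro: order_trans [OF norm_ge_zero])
  fix f :: "real ^ 'a \<Rightarrow> complex" and D x
  assume f: "integrable (rst torus) f" and D: "\<forall>x. norm (FT f x) \<le> D"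
  have "norm (FT (\<lambda>\<xi>. m \<xi> * (k \<xi> * f \<xi>)) x) \<le> A * (B * D)"
    by (intro wienerD [OF m] wiener_integrable [OF k f] wienerD [OF k f]) (use D in auto)
  then show "norm (FT (\<lambda>\<xi>. m \<xi> * k \<xi> * f \<xi>) x) \<le> A * B * D"
    by (simp add: mult.assoc)
qed

lemma wiener_power: "wiener A m \<Longrightarrow> wiener (A ^ k) (\<lambda>\<xi>. m \<xi> ^ k)"
  by (induction k) (auto intro: wiener_mult wiener_mono [OF wiener_const])

lemma wiener_sum:
  assumes "finite I" "\<And>i. i \<in> I \<Longrightarrow> wiener (A i) (m i)"
  shows "wiener (\<Sum>i\<in>I. A i) (\<lambda>\<xi>. \<Sum>i\<in>I. m i \<xi>)"
  using assms by (induction I) (auto intro: wiener_add wiener_mono [OF wiener_const])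

lemma wiener_prod:
  assumes "finite I" "\<And>i. i \<in> I \<Longrightarrow> wiener (A i) (m i)"
  shows "wiener (\<Prod>i\<in>I. A i) (\<lambda>\<xi>. \<Prod>i\<in>I. m i \<xi>)"
  using assms by (induction I) (auto intro: wiener_mult wiener_mono [OF wiener_const])

text \<open>Each single value of the transform converges by dominated convergence, with majorant
  \<open>b\<close> times the norm of \<open>f\<close>, so the bound survives. This admits power
  series in a multiplier.\<close>

lemma wiener_limit:
  assumes w: "\<And>k. wiener B (m k)"
    and lim: "\<And>\<xi>. \<xi> \<in> torus \<Longrightarrow> (\<lambda>k. m k \<xi>) \<longlonglongrightarrow> l \<xi>"
    and b: "\<And>k \<xi>. \<xi> \<in> torus \<Longrightarrow> norm (m k \<xi>) \<le> b"
    and l [measurable]: "l \<in> borel_measurable borel"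
  shows "wiener B l"
  unfolding wiener_def
proof (intro conjI allI impI)
  show "l \<in> borel_measurable borel" by (rule l)
  show "\<exists>b. \<forall>\<xi>\<in>torus. norm (l \<xi>) \<le> b"
  proof (intro exI ballI)
    fix \<xi> :: "real ^ 'a" assume x: "\<xi> \<in> torus"
    show "norm (l \<xi>) \<le> b"
      by (rule LIMSEQ_le_const2 [OF tendsto_norm [OF lim [OF x]]]) (use b x in auto)
  qed
  fix f :: "real ^ 'a \<Rightarrow> complex" and D x
  assume f: "integrable (rst torus) f" and D: "\<forall>x. norm (FT f x) \<le> D"
  have [measurable]: "f \<in> borel_measurable borel"
    using borel_measurable_integrable [OF f] by (simp cong: measurable_cong_sets)
  have [measurable]: "m k \<in> borel_measurable borel" for k using w [of k] by (simp add: wiener_def)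
  have "(\<lambda>k. FT (\<lambda>\<xi>. m k \<xi> * f \<xi>) x) \<longlonglongrightarrow> FT (\<lambda>\<xi>. l \<xi> * f \<xi>) x"
    unfolding FT_def
  proof (rule integral_dominated_convergence [where w = "\<lambda>\<xi>. \<bar>b\<bar> * norm (f \<xi>)"])
    show "AE \<xi> in rst torus. (\<lambda>k. exp (\<i> * of_real (phase x \<xi>)) * (m k \<xi> * f \<xi>))
        \<longlonglongrightarrow> exp (\<i> * of_real (phase x \<xi>)) * (l \<xi> * f \<xi>)"
      by (rule AE_rstI) (auto intro!: tendsto_intros lim)
    show "AE \<xi> in rst torus. norm (exp (\<i> * of_real (phase x \<xi>)) * (m k \<xi> * f \<xi>)) \<le> \<bar>b\<bar> * norm (f \<xi>)" for k
      by (rule AE_rstI) (auto simp: norm_mult intro!: mult_right_mono intro: order_trans [OF b])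
  qed (use f in auto)
  then show "norm (FT (\<lambda>\<xi>. l \<xi> * f \<xi>) x) \<le> B * D"
    by (rule LIMSEQ_le_const2 [OF tendsto_norm]) (use wienerD [OF w f] D in auto)
qed

section \<open>Van der Corput bounds\<close>

lemma cos_ge_quadratic: "1 - x\<^sup>2 / 2 \<le> cos (x :: real)"
proof -
  have "(sin (x / 2))\<^sup>2 \<le> (x / 2)\<^sup>2"
    using abs_sin_x_le_abs_x [of "x / 2"] by (metis abs_le_square_iff)
  then show ?thesis using cos_double_sin [of "x / 2"] by (simp add: power2_eq_square)
qed

lemma sin_ge_cubic:
  assumes "0 \<le> (x :: real)" shows "x - x ^ 3 / 6 \<le> sin x"
proof -
  have "sin 0 - 0 + 0 ^ 3 / 6 \<le> sin x - x + x ^ 3 / 6"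
  proof (rule DERIV_nonneg_imp_nondecreasing [OF assms])
    fix y :: real
    show "\<exists>z. ((\<lambda>x. sin x - x + x ^ 3 / 6) has_real_derivative z) (at y) \<and> 0 \<le> z"
      by (rule exI [of _ "cos y - 1 + y\<^sup>2 / 2"])
        (use cos_ge_quadratic [of y] in \<open>auto intro!: derivative_eq_intros simp: power2_eq_square\<close>)
  qed
  then show ?thesis by simp
qed

lemma abs_sin_minus_self_le: "\<bar>x - sin x\<bar> \<le> \<bar>x :: real\<bar> ^ 3 / 6"
proof -
  have *: "\<bar>x - sin x\<bar> \<le> x ^ 3 / 6" if "0 \<le> x" for x :: real
    using sin_ge_cubic [OF that] sin_x_le_x [OF that] by linarith
  show ?thesis using * [of x] * [of "- x"] by (cases "0 \<le> x") (auto simp: power3_eq_cube)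
qed

lemma sin_ge_half:
  assumes "0 \<le> (x :: real)" "x \<le> pi / 2" shows "x / 2 \<le> sin x"
proof -
  \<comment> \<open>The cubic term \<open>x ^ 3 / 6\<close> is at most \<open>x / 2\<close> as soon
    as the square of x is at most 3, and 8/5 squared is 2.56.\<close>
  have "x < 8 / 5" using assms pi_approx by simp
  then have "x * x \<le> (8/5) * (8/5)" using assms by (intro mult_mono) auto
  then have "x * (x * x) \<le> x * 3" using assms by (intro mult_left_mono) auto
  then show ?thesis using sin_ge_cubic [OF assms(1)] by (simp add: power3_eq_cube)
qed

section \<open>Oscillatory integrals: first and second derivative tests\<close>

lemma second_mean_value_bound:
  fixes f g :: "real \<Rightarrow> real"
  assumes f: "f integrable_on {a..b}"
    and g: "\<And>x y. \<lbrakk>a \<le> x; x \<le> y; y \<le> b\<rbrakk> \<Longrightarrow> g x \<le> g y"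
    and B: "\<And>x. \<lbrakk>a \<le> x; x \<le> b\<rbrakk> \<Longrightarrow> \<bar>g x\<bar> \<le> B"
    and V: "\<And>x y. \<lbrakk>a \<le> x; x \<le> y; y \<le> b\<rbrakk> \<Longrightarrow> \<bar>integral {x..y} f\<bar> \<le> V"
    and ab: "a \<le> b"
  shows "\<bar>integral {a..b} (\<lambda>x. g x * f x)\<bar> \<le> 2 * B * V"
proof -
  obtain c where c: "c \<in> {a..b}"
    and eq: "integral {a..b} (\<lambda>x. g x * f x) = g a * integral {a..c} f + g b * integral {c..b} f"
    by (rule second_mean_value_theorem [OF f ab, of g]) (use g in auto)
  have "0 \<le> V" using V [of a a] ab by simp
  moreover have "0 \<le> B" using B [of a] ab by simp
  ultimately have "\<bar>g a * integral {a..c} f\<bar> \<le> B * V" "\<bar>g b * integral {c..b} f\<bar> \<le> B * V"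
    using c ab by (auto simp: abs_mult intro!: mult_mono B V)
  then show ?thesis unfolding eq by linarith
qed

text \<open>Write the integrand as \<open>1 / h\<close> times \<open>h * cos \<psi>\<close>. The
  second factor is the derivative of \<open>sin \<psi>\<close>, so its integrals are at most 2;
  since \<open>h\<close> decreases and keeps its sign, \<open>1 / h\<close> is monotone and the
  second mean value theorem replaces integration by parts.\<close>

lemma van_der_corput_1:
  fixes h \<psi> :: "real \<Rightarrow> real"
  assumes ab: "a \<le> b"
    and \<psi>: "\<And>x. (\<psi> has_real_derivative h x) (at x)" and h: "continuous_on UNIV h"
    and anti: "\<And>x y. \<lbrakk>a \<le> x; x \<le> y; y \<le> b\<rbrakk> \<Longrightarrow> h y \<le> h x"
    and l: "0 < l" "(\<forall>x\<in>{a..b}. l \<le> h x) \<or> (\<forall>x\<in>{a..b}. h x \<le> - l)"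
  shows "\<bar>integral {a..b} (\<lambda>x. cos (\<psi> x))\<bar> \<le> 4 / l"
proof -
  have abs: "l \<le> \<bar>h x\<bar>" if "a \<le> x" "x \<le> b" for x
    using l(2)
  proof
    assume "\<forall>x\<in>{a..b}. l \<le> h x"
    then show ?thesis using that by (auto intro: order_trans [OF _ abs_ge_self])
  next
    assume "\<forall>x\<in>{a..b}. h x \<le> - l"
    then have "h x \<le> - l" using that by auto
    then show ?thesis using l(1) by linarith
  qed
  have c\<psi>: "continuous_on S \<psi>" for S
    using \<psi> by (meson DERIV_isCont continuous_at_imp_continuous_on)
  have ch: "continuous_on S h" for S using h continuous_on_subset by blast
  have int: "((\<lambda>x. h x * cos (\<psi> x)) has_integral sin (\<psi> y) - sin (\<psi> x)) {x..y}" if "x \<le> y" for x y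
    using that
  proof (rule fundamental_theorem_of_calculus)
    fix u
    have "((\<lambda>x. sin (\<psi> x)) has_real_derivative cos (\<psi> u) * h u) (at u)"
      by (rule DERIV_chain2 [OF DERIV_sin \<psi>])
    then show "((\<lambda>x. sin (\<psi> x)) has_vector_derivative h u * cos (\<psi> u)) (at u within {x..y})"
      by (auto simp: mult.commute has_real_derivative_iff_has_vector_derivative intro: has_vector_derivative_at_within)
  qed
  have V: "\<bar>integral {x..y} (\<lambda>x. h x * cos (\<psi> x))\<bar> \<le> 2" if "x \<le> y" for x y
    unfolding integral_unique [OF int [OF that]]
    using abs_sin_le_one [of "\<psi> x"] abs_sin_le_one [of "\<psi> y"] by linarith
  have "\<bar>integral {a..b} (\<lambda>x. (1 / h x) * (h x * cos (\<psi> x)))\<bar> \<le> 2 * (1 / l) * 2"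
  proof (rule second_mean_value_bound [OF _ _ _ _ ab])
    show "(\<lambda>x. h x * cos (\<psi> x)) integrable_on {a..b}" by (rule has_integral_integrable [OF int [OF ab]])
    show "1 / h x \<le> 1 / h y" if "a \<le> x" "x \<le> y" "y \<le> b" for x y
    proof -
      have le: "h y \<le> h x" by (rule anti [OF that])
      have "x \<in> {a..b}" "y \<in> {a..b}" using that by auto
      with l(2) have "l \<le> h x \<and> l \<le> h y \<or> h x \<le> - l \<and> h y \<le> - l" by blast
      then show ?thesis
      proof
        assume "l \<le> h x \<and> l \<le> h y"
        then show ?thesis using le l(1) by (intro divide_left_mono) auto
      next
        assume "h x \<le> - l \<and> h y \<le> - l"
        then have "1 / (- h y) \<le> 1 / (- h x)"
          using le l(1) by (intro divide_left_mono) (auto simp: mult_neg_neg)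
        then show ?thesis by simp
      qed
    qed
    show "\<bar>1 / h x\<bar> \<le> 1 / l" if "a \<le> x" "x \<le> b" for x
      using abs [OF that] l(1) by (simp add: frac_le)
  qed (use V in auto)
  also have "integral {a..b} (\<lambda>x. (1 / h x) * (h x * cos (\<psi> x))) = integral {a..b} (\<lambda>x. cos (\<psi> x))"
    proof (rule integral_cong)
    fix x assume "x \<in> {a..b}"
    then have "h x \<noteq> 0" using abs [of x] l(1) by auto
    then show "1 / h x * (h x * cos (\<psi> x)) = cos (\<psi> x)" by simp
  qed
  finally show ?thesis by simp
qed

text \<open>Outside a window of half-width \<open>1 / sqrt r\<close> around the point where
  \<open>h\<close> changes sign, the decrease of \<open>h\<close> forces its modulus to be at least
  \<open>sqrt r\<close>, and the first derivative test gives \<open>4 / sqrt r\<close> on each side.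
  The window contributes at most its length.\<close>

lemma van_der_corput_2:
  fixes h \<psi> :: "real \<Rightarrow> real"
  assumes ab: "a \<le> b"
    and \<psi>: "\<And>x. (\<psi> has_real_derivative h x) (at x)" and h: "continuous_on UNIV h"
    and anti: "\<And>x y. \<lbrakk>a \<le> x; x \<le> y; y \<le> b\<rbrakk> \<Longrightarrow> r * (y - x) \<le> h x - h y"
    and r: "0 < r"
  shows "\<bar>integral {a..b} (\<lambda>x. cos (\<psi> x))\<bar> \<le> 10 / sqrt r"
proof -
  define e where "e = 1 / sqrt r"
  have e: "0 < e" and re: "r * e = sqrt r"
    using r by (auto simp: e_def field_simps)
  have c\<psi>: "continuous_on S \<psi>" for S
    using \<psi> by (meson DERIV_isCont continuous_at_imp_continuous_on)
  have ch: "continuous_on S h" for S using h continuous_on_subset by blast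
  have i: "(\<lambda>x. cos (\<psi> x)) integrable_on {x..y}" for x y
    by (intro integrable_continuous_real continuous_intros c\<psi>)
  have mono: "h y \<le> h x" if "a \<le> x" "x \<le> y" "y \<le> b" for x y
    using anti [OF that] r that by (smt (verit) mult_nonneg_nonneg)
  \<comment> \<open>If \<open>h\<close> has no zero in the interval, \<open>c\<close> is the
    endpoint nearest to a sign change; the two disjunctions let one argument serve all
    cases.\<close>
  obtain c where c: "a \<le> c" "c \<le> b" "c = a \<or> 0 \<le> h c" "c = b \<or> h c \<le> 0"
  proof (cases "h b \<ge> 0 \<or> h a \<le> 0")
    case True then show ?thesis using that ab by blast
  next
    case False
    then have "\<exists>x\<ge>a. x \<le> b \<and> h x = 0"
      using ab by (intro IVT2' [of h b 0 a]) (auto intro: ch)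
    then show ?thesis using that by auto
  qed
  define u v where "u = max a (c - e)" and "v = min b (c + e)"
  have uv: "a \<le> u" "u \<le> v" "v \<le> b" "v - u \<le> 2 * e" using c e by (auto simp: u_def v_def)
  have split: "integral {a..b} (\<lambda>x. cos (\<psi> x)) = integral {a..u} (\<lambda>x. cos (\<psi> x))
      + integral {u..v} (\<lambda>x. cos (\<psi> x)) + integral {v..b} (\<lambda>x. cos (\<psi> x))"
    using uv i
    by (simp add: Henstock_Kurzweil_Integration.integral_combine)
  have 1: "\<bar>integral {a..u} (\<lambda>x. cos (\<psi> x))\<bar> \<le> 4 / sqrt r"
  proof (cases "c - e \<le> a")
    case True then show ?thesis using r by (simp add: u_def)
  next
    case False
    have "sqrt r \<le> h x" if "x \<in> {a..u}" for x
    proof -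
      have "r * e \<le> r * (c - x)" using that False r by (intro mult_left_mono) (auto simp: u_def)
      then show ?thesis using anti [of x c] that c False e re by (auto simp: u_def)
    qed
    then show ?thesis using uv r
      by (intro van_der_corput_1 [OF _ \<psi> h]) (auto intro: mono)
  qed
  have 2: "\<bar>integral {v..b} (\<lambda>x. cos (\<psi> x))\<bar> \<le> 4 / sqrt r"
  proof (cases "b \<le> c + e")
    case True then show ?thesis using r by (simp add: v_def)
  next
    case False
    have "h x \<le> - sqrt r" if "x \<in> {v..b}" for x
    proof -
      have "r * e \<le> r * (x - c)" using that False r by (intro mult_left_mono) (auto simp: v_def)
      then show ?thesis using anti [of c x] that c False e re by (auto simp: v_def)
    qed
    then show ?thesis using uv r
      by (intro van_der_corput_1 [OF _ \<psi> h]) (auto intro: mono)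
  qed
  have "norm (integral {u..v} (\<lambda>x. cos (\<psi> x))) \<le> 1 * (v - u)"
    using uv by (intro integral_bound) (auto intro!: continuous_intros c\<psi>)
  then have 3: "\<bar>integral {u..v} (\<lambda>x. cos (\<psi> x))\<bar> \<le> 2 / sqrt r"
    using uv by (simp add: e_def)
  show ?thesis using 1 2 3 unfolding split by (simp add: field_simps)
qed

text \<open>A uniform majorant for Bessel functions of order \<open>\<nu>\<close> up to sign:
  T^(-1/3) in the transition zone where \<open>T + \<nu>\<close> is of order T^(1/3), and the
  stationary phase size T^(-1/2) when \<open>T + \<nu>\<close> is of order T.\<close>

definition \<beta> :: "real \<Rightarrow> real \<Rightarrow> real" where
  "\<beta> \<nu> T = T powr (- 1/4) * (\<bar>T + \<nu>\<bar> + T powr (1/3)) powr (- 1/4)"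

context
  fixes c \<nu> T :: real
  assumes T: "0 < T"
begin

private definition I :: "real \<Rightarrow> real \<Rightarrow> real"
  where "I x y = integral {x..y} (\<lambda>\<theta>. cos (c + \<nu> * \<theta> + T * sin \<theta>))"

private lemma deriv: "((\<lambda>\<theta>. c + \<nu> * \<theta> + T * sin \<theta>) has_real_derivative \<nu> + T * cos x) (at x)"
  by (auto intro!: derivative_eq_intros)

private lemma conth: "continuous_on UNIV (\<lambda>\<theta>. \<nu> + T * cos \<theta>)"
  by (intro continuous_intros)

private lemma combine: "x \<le> y \<Longrightarrow> y \<le> z \<Longrightarrow> I x z = I x y + I y z"
  unfolding I_def
  by (rule Henstock_Kurzweil_Integration.integral_combine [symmetric])
    (auto intro!: integrable_continuous_real continuous_intros)

private lemma anti: "0 \<le> x \<Longrightarrow> x \<le> y \<Longrightarrow> y \<le> pi / 2 \<Longrightarrow> \<nu> + T * cos y \<le> \<nu> + T * cos x"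
  using T by (intro add_left_mono mult_left_mono cos_monotone_0_pi_le) auto

text \<open>To the right of \<open>\<delta>\<close> the phase derivative decreases at rate at least
  \<open>T * \<delta> / 2\<close>, because \<open>sin z\<close> is at least \<open>z / 2\<close>.
  The resulting factor \<open>sqrt 2\<close> is rounded up to 2.\<close>

private lemma second:
  assumes "0 < \<delta>" "\<delta> \<le> x" "x \<le> y" "y \<le> pi / 2"
  shows "\<bar>I x y\<bar> \<le> 20 / sqrt (T * \<delta>)"
proof -
  have *: "T * \<delta> / 2 * (v - u) \<le> \<nu> + T * cos u - (\<nu> + T * cos v)" if "x \<le> u" "u \<le> v" "v \<le> y" for u v
  proof -
    have "cos v + \<delta> / 2 * v \<le> cos u + \<delta> / 2 * u"
    proof (rule DERIV_nonpos_imp_nonincreasing [OF that(2)])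
      fix z assume z: "u \<le> z" "z \<le> v"
      have "z / 2 \<le> sin z" using z that assms by (intro sin_ge_half) auto
      moreover have "\<delta> / 2 \<le> z / 2" using z that assms by auto
      ultimately have "\<delta> / 2 \<le> sin z" by linarith
      then show "\<exists>w. ((\<lambda>z. cos z + \<delta> / 2 * z) has_real_derivative w) (at z) \<and> w \<le> 0"
        by (intro exI [of _ "- sin z + \<delta> / 2"]) (auto intro!: derivative_eq_intros)
    qed
    then have "T * (\<delta> / 2 * (v - u)) \<le> T * (cos u - cos v)"
      using T unfolding right_diff_distrib [of "\<delta> / 2"] by (intro mult_left_mono) linarith+
    then show ?thesis by (simp add: algebra_simps)
  qed
  have "\<bar>I x y\<bar> \<le> 10 / sqrt (T * \<delta> / 2)"
    unfolding I_def using T assms by (intro van_der_corput_2 [OF _ deriv conth *]) auto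
  also have "\<dots> \<le> 10 / (sqrt (T * \<delta>) / 2)"
    using T assms real_sqrt_le_mono [of "T * \<delta> / 4" "T * \<delta> / 2"]
    by (intro divide_left_mono) (auto simp: real_sqrt_divide)
  finally show ?thesis by simp
qed

private lemma trivial: "x \<le> y \<Longrightarrow> \<bar>I x y\<bar> \<le> y - x"
proof -
  assume "x \<le> y"
  then have "norm (I x y) \<le> 1 * (y - x)"
    unfolding I_def by (intro integral_bound) (auto intro!: continuous_intros)
  then show ?thesis by simp
qed

text \<open>The interval is cut at \<open>\<delta>\<close>: near the degenerate point 0 of the
  second derivative some other bound \<open>V\<close> is used, beyond it
  \<open>second\<close>.\<close>

private lemma split_at:
  assumes "0 \<le> x" "x \<le> y" "y \<le> pi / 2" "0 < \<delta>"
    and "\<And>x y. 0 \<le> x \<Longrightarrow> x \<le> y \<Longrightarrow> y \<le> pi / 2 \<Longrightarrow> y \<le> \<delta> \<Longrightarrow> \<bar>I x y\<bar> \<le> V"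
    and "0 \<le> V"
  shows "\<bar>I x y\<bar> \<le> V + 20 / sqrt (T * \<delta>)"
proof -
  consider "y \<le> \<delta>" | "\<delta> \<le> x" | "x \<le> \<delta>" "\<delta> \<le> y" using assms by linarith
  then show ?thesis
  proof cases
    case 1 then show ?thesis using assms(5) [of x y] assms T by (auto intro: add_increasing2)
  next
    case 2 then show ?thesis using second [of \<delta> x y] assms by linarith
  next
    case 3 then show ?thesis using second [of \<delta> \<delta> y] assms(5) [of x \<delta>] combine [of x \<delta> y] assms by force
  qed
qed

private lemma airy:
  assumes "0 \<le> x" "x \<le> y" "y \<le> pi / 2"
  shows "\<bar>I x y\<bar> \<le> 21 * T powr (- 1/3)"
proof -
  \<comment> \<open>This \<open>\<delta>\<close> balances the trivial bound \<open>\<delta>\<close>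
    against the second derivative bound of order (T \<delta>)^(-1/2).\<close>
  define \<delta> where "\<delta> = T powr (- 1/3)"
  have \<delta>: "0 < \<delta>" using T by (simp add: \<delta>_def)
  have "T * \<delta> = T powr (2/3)"
    using T powr_add [of T 1 "- 1/3"] by (simp add: \<delta>_def)
  then have s: "sqrt (T * \<delta>) = T powr (1/3)"
    using T by (simp add: powr_half_sqrt [symmetric] powr_powr)
  have "\<bar>I x y\<bar> \<le> \<delta> + 20 / sqrt (T * \<delta>)"
    proof (rule split_at [OF assms \<delta>])
    fix x y assume "0 \<le> x" "x \<le> y" "y \<le> \<delta>"
    then show "\<bar>I x y\<bar> \<le> \<delta>" using trivial [of x y] by linarith
  qed (use \<delta> in simp)
  also have "20 / sqrt (T * \<delta>) = 20 * \<delta>"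
    unfolding s using powr_minus_divide [of T "1/3"] by (simp add: \<delta>_def)
  finally show ?thesis by (simp add: \<delta>_def)
qed

text \<open>If \<open>T + \<nu>\<close> is positive, the phase derivative keeps at least half of its
  value \<open>m\<close> at 0 up to \<open>\<delta> = sqrt (m / T)\<close>, since the cosine loses
  at most \<open>\<delta>\<^sup>2 / 2\<close> there. If it is negative, the derivative stays below
  \<open>- m\<close> and there is no stationary point at all.\<close>

private lemma away:
  assumes "0 \<le> x" "x \<le> y" "y \<le> pi / 2" and m: "m = \<bar>T + \<nu>\<bar>" "0 < m"
  shows "\<bar>I x y\<bar> \<le> 8 / m + 20 * (m * T) powr (- 1/4)"
proof (cases "0 \<le> T + \<nu>")
  case True
  define \<delta> where "\<delta> = sqrt (m / T)"
  have \<delta>: "0 < \<delta>" "T * \<delta>\<^sup>2 = m" using T m by (simp_all add: \<delta>_def)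
  have "T * \<delta> = sqrt (m * T)"
    using T m by (simp add: \<delta>_def real_sqrt_divide real_sqrt_mult field_simps)
  then have s: "sqrt (T * \<delta>) = (m * T) powr (1/4)"
    using T m by (simp add: powr_half_sqrt [symmetric] powr_powr)
  have "\<bar>I x y\<bar> \<le> 8 / m + 20 / sqrt (T * \<delta>)"
  proof (rule split_at [OF assms(1-3)])
    fix x y assume xy: "0 \<le> x" "x \<le> y" "y \<le> pi / 2" "y \<le> \<delta>"
    have "m / 2 \<le> \<nu> + T * cos z" if "x \<le> z" "z \<le> y" for z
    proof -
      have "z\<^sup>2 \<le> \<delta>\<^sup>2" using that xy by (intro power_mono) auto
      then have "T * (1 - \<delta>\<^sup>2 / 2) \<le> T * cos z"
        using T cos_ge_quadratic [of z] by (intro mult_left_mono) auto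
      moreover have "T * (1 - \<delta>\<^sup>2 / 2) = T - m / 2" using \<delta> by (simp add: right_diff_distrib)
      ultimately show ?thesis using True m by linarith
    qed
    then have "\<bar>I x y\<bar> \<le> 4 / (m / 2)"
      unfolding I_def using xy m by (intro van_der_corput_1 [OF _ deriv conth anti]) auto
    then show "\<bar>I x y\<bar> \<le> 8 / m" by simp
  qed (use \<delta> m in auto)
  also have "20 / sqrt (T * \<delta>) = 20 * (m * T) powr (- 1/4)"
    unfolding s using powr_minus_divide [of "m * T" "1/4"] by simp
  finally show ?thesis .
next
  case False
  have "\<nu> + T * cos z \<le> - m" if "x \<le> z" "z \<le> y" for z
    using mult_left_mono [OF cos_le_one, of T z] T m False by simp
  then have "\<bar>I x y\<bar> \<le> 4 / m"
    unfolding I_def using assms by (intro van_der_corput_1 [OF _ deriv conth anti]) auto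
  moreover have "4 / m \<le> 8 / m" using m by (intro divide_right_mono) auto
  ultimately show ?thesis using powr_ge_zero [of "m * T" "- 1/4"] by linarith
qed

text \<open>\<open>airy\<close> covers \<open>m\<close> at most T^(1/3) and \<open>away\<close> the
  rest. In the second case T is at most the cube of \<open>m\<close>, so \<open>1 / m\<close> is
  dominated by \<open>(m * T) powr (- 1/4)\<close>. The constant is 56 = 2 * (8 + 20).\<close>

private lemma I_le:
  assumes "0 \<le> x" "x \<le> y" "y \<le> pi / 2"
  shows "\<bar>I x y\<bar> \<le> 56 * \<beta> \<nu> T"
proof -
  define m where "m = \<bar>T + \<nu>\<bar>"
  \<comment> \<open>Replacing a sum of two terms by twice the larger one costs a factor 2^(-1/4),
    absorbed here by 2.\<close>
  have two: "1 / 2 \<le> (2 :: real) powr (- 1/4)"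
    using powr_mono [of "-1" "- 1/4" "2 :: real"] by (simp add: powr_minus)
  have p: "0 < T powr (1/3)" using T by simp
  show ?thesis
  proof (cases "m \<le> T powr (1/3)")
    case True
    have "T powr (- 1/3) = T powr (- 1/4) * (T powr (1/3)) powr (- 1/4)"
      using T by (simp add: powr_powr flip: powr_add)
    also have "(T powr (1/3)) powr (- 1/4) * (1 / 2) \<le> (T powr (1/3)) powr (- 1/4) * 2 powr (- 1/4)"
      using two by (intro mult_left_mono) auto
    then have "T powr (- 1/4) * (T powr (1/3)) powr (- 1/4)
        \<le> T powr (- 1/4) * (2 * (2 * T powr (1/3)) powr (- 1/4))"
      using p by (intro mult_left_mono) (auto simp: powr_mult)
    also have "(2 * T powr (1/3)) powr (- 1/4) \<le> (m + T powr (1/3)) powr (- 1/4)"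
      using True p abs_ge_zero [of "T + \<nu>"] unfolding m_def by (intro powr_mono2') linarith+
    then have "T powr (- 1/4) * (2 * (2 * T powr (1/3)) powr (- 1/4)) \<le> 2 * \<beta> \<nu> T"
      unfolding \<beta>_def m_def by (simp add: mult_left_mono)
    finally show ?thesis using airy [OF assms] by (simp add: \<beta>_def)
  next
    case False
    then have m: "T powr (1/3) < m" "0 < m" using p by linarith+
    have "T = (T powr (1/3)) powr 3" using T by (simp add: powr_powr)
    also have "\<dots> \<le> m powr 3" using m by (intro powr_mono2) auto
    finally have "T \<le> m powr 3" .
    then have "m * T \<le> m * m powr 3" using m(2) by (intro mult_left_mono) simp_all
    also have "\<dots> = m powr (1 + 3)" using m(2) by (simp only: powr_add powr_one)
    also have "\<dots> = m powr 4" by simp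
    finally have "(m powr 4) powr (- 1/4) \<le> (m * T) powr (- 1/4)"
      using m T by (intro powr_mono2') auto
    then have 1: "1 / m \<le> (m * T) powr (- 1/4)"
      using m powr_minus_divide [of m 1] unfolding powr_powr by simp
    have "(2 * m) powr (- 1/4) \<le> (m + T powr (1/3)) powr (- 1/4)"
      using m p by (intro powr_mono2') linarith+
    moreover have "m powr (- 1/4) * (1 / 2) \<le> m powr (- 1/4) * 2 powr (- 1/4)"
      using two by (intro mult_left_mono) auto
    moreover have "m powr (- 1/4) * 2 powr (- 1/4) = (2 * m) powr (- 1/4)"
      using m by (simp add: powr_mult mult.commute)
    ultimately have "m powr (- 1/4) \<le> 2 * (m + T powr (1/3)) powr (- 1/4)"
      by linarith
    then have "T powr (- 1/4) * m powr (- 1/4) \<le> T powr (- 1/4) * (2 * (m + T powr (1/3)) powr (- 1/4))"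
      by (intro mult_left_mono) auto
    then have 2: "(m * T) powr (- 1/4) \<le> 2 * \<beta> \<nu> T"
      using m T by (simp add: \<beta>_def m_def powr_mult mult.commute)
    have "\<bar>I x y\<bar> \<le> 8 * (1 / m) + 20 * (m * T) powr (- 1/4)"
      using away [OF assms m_def m(2)] by simp
    then show ?thesis using 1 2 by linarith
  qed
qed

text \<open>A bounded monotone amplitude costs only a factor 2 by the second mean value theorem,
  whatever its derivative. The free shift \<open>c\<close> lets the cosine stand for the sine too,
  hence for imaginary parts.\<close>

lemma oscillatory_bound_mono:
  assumes A: "\<And>x y. 0 \<le> x \<Longrightarrow> x \<le> y \<Longrightarrow> y \<le> pi / 2 \<Longrightarrow> A x \<le> A y"
    and A1: "\<And>x. 0 \<le> x \<Longrightarrow> x \<le> pi / 2 \<Longrightarrow> \<bar>A x\<bar> \<le> 1"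
  shows "\<bar>integral {0..pi/2} (\<lambda>\<theta>. A \<theta> * cos (c + \<nu> * \<theta> + T * sin \<theta>))\<bar> \<le> 112 * \<beta> \<nu> T"
proof -
  have "\<bar>integral {0..pi/2} (\<lambda>\<theta>. A \<theta> * cos (c + \<nu> * \<theta> + T * sin \<theta>))\<bar> \<le> 2 * 1 * (56 * \<beta> \<nu> T)"
    using A A1 I_le [unfolded I_def]
    by (intro second_mean_value_bound) (auto intro!: integrable_continuous_real continuous_intros)
  then show ?thesis by simp
qed

end

section \<open>Gaussian subordination\<close>

text \<open>The derivatives of the squared partial integral \<open>E R ^ 2\<close> and of
  \<open>K R / z\<close> cancel, so \<open>H\<close> is constant. At R = 0 only \<open>K 0\<close>,
  the integral of 1 / (1 + s^2) over [0,1], is left, and \<open>K\<close> vanishes at infinity. This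
  works for complex \<open>z\<close> without rotating a contour.\<close>

lemma gaussian_half_line_limit:
  fixes z :: complex
  assumes z: "0 < Re z"
    and lim: "((\<lambda>R. integral {0..R} (\<lambda>x. exp (- z * of_real (x\<^sup>2)))) \<longlongrightarrow> L) at_top"
  shows "L\<^sup>2 = of_real pi / (4 * z)"
proof -
  have z0: "z \<noteq> 0" using z by auto
  have s0: "1 + (of_real s)\<^sup>2 \<noteq> (0 :: complex)" for s :: real
  proof -
    have "1 + (of_real s)\<^sup>2 = (of_real (1 + s\<^sup>2) :: complex)" by simp
    moreover have "1 + s\<^sup>2 \<noteq> 0" by (smt (verit) zero_le_power2)
    ultimately show ?thesis by (metis of_real_eq_0_iff)
  qed
  define e where "e = (\<lambda>x :: real. exp (- z * of_real (x\<^sup>2)))"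
  define E where "E = (\<lambda>R. integral {0..R} e)"
  \<comment> \<open>The parameter R is complex because the derivative under the integral is complex
    valued, as a field derivative requires; it is restricted to real R afterwards.\<close>
  define k :: "complex \<Rightarrow> real \<Rightarrow> complex"
    where "k = (\<lambda>R s. exp (- z * R ^ 2 * (1 + of_real s ^ 2)) / (1 + of_real s ^ 2))"
  define K where "K = (\<lambda>R :: complex. integral {0..1::real} (k R))"
  define H where "H = (\<lambda>R :: real. E R ^ 2 + K (of_real R) / z)"
  have conte: "continuous_on S e" for S unfolding e_def by (intro continuous_intros)
  have dE: "(E has_vector_derivative e R) (at R within {0..B})" if "R \<in> {0..B}" for R B
    unfolding E_def using that by (intro integral_has_vector_derivative conte) auto
  have dK: "(K has_field_derivative integral {0..1} (\<lambda>s. - 2 * z * R * exp (- z * R ^ 2 * (1 + of_real s ^ 2)))) (at R)" for R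
  proof -
    have "((\<lambda>R. integral (cbox 0 1) (k R)) has_field_derivative
        integral (cbox 0 1) (\<lambda>s :: real. - 2 * z * R * exp (- z * R ^ 2 * (1 + of_real s ^ 2)))) (at R within UNIV)"
    proof (rule leibniz_rule_field_derivative)
      fix R and s :: real
      let ?w = "1 + of_real s ^ 2 :: complex"
      have "((\<lambda>R. exp (- z * R ^ 2 * ?w) / ?w) has_field_derivative
          (exp (- z * R ^ 2 * ?w) * (- z * (2 * R) * ?w)) / ?w) (at R within UNIV)"
        by (auto intro!: derivative_eq_intros)
      also have "(exp (- z * R ^ 2 * ?w) * (- z * (2 * R) * ?w)) / ?w = - 2 * z * R * exp (- z * R ^ 2 * ?w)"
        using s0 [of s] by simp
      finally show "((\<lambda>R. k R s) has_field_derivative - 2 * z * R * exp (- z * R ^ 2 * ?w)) (at R within UNIV)"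
        unfolding k_def .
    next
      show "k R integrable_on cbox 0 1" for R
        unfolding k_def by (intro integrable_continuous continuous_intros ballI s0)
    qed (auto intro!: continuous_intros simp: case_prod_beta)
    then show ?thesis unfolding K_def by simp
  qed
  \<comment> \<open>The substitution x = R s identifies the integral in the derivative of
    \<open>K\<close> with \<open>E R\<close>, which produces the cancellation in
    \<open>H\<close>.\<close>
  have inner: "of_real R * integral {0..1} (\<lambda>s. e (R * s)) = E R" if "0 \<le> R" for R
  proof (cases "R = 0")
    case False
    with that have R: "R > 0" by simp
    have "(e has_integral E R) (cbox 0 R)"
      unfolding E_def by (simp add: integrable_integral integrable_continuous_real conte)
    from has_integral_affinity' [OF this R, of 0]
    have "((\<lambda>s. e (R * s)) has_integral (E R /\<^sub>R R)) {0..1}"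
      using R by simp
    then show ?thesis using R by (simp add: integral_unique scaleR_conv_of_real)
  qed (simp add: E_def)
  have dH: "(H has_vector_derivative 0) (at R within {0..B})" if R: "R \<in> {0..B}" for R B
  proof -
    have "integral {0..1} (\<lambda>s. - 2 * z * of_real R * exp (- z * of_real R ^ 2 * (1 + of_real s ^ 2)))
      = integral {0..1} (\<lambda>s. (- 2 * z * of_real R * e R) * e (R * s))"
      by (simp add: e_def algebra_simps mult_exp_exp power_mult_distrib)
    also have "\<dots> = - 2 * z * e R * E R"
      using R by (subst inner [symmetric]) auto
    finally have eq: "integral {0..1} (\<lambda>s. - 2 * z * of_real R * exp (- z * of_real R ^ 2 * (1 + of_real s ^ 2)))
      = - 2 * z * e R * E R" .
    have *: "(K has_field_derivative - 2 * z * e R * E R) (at (of_real R))"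
      using dK [of "of_real R"] unfolding eq .
    have "((\<lambda>R. K (of_real R)) has_vector_derivative (1 * (- 2 * z * e R * E R))) (at R within {0..B})"
      by (rule field_vector_diff_chain_within [unfolded o_def, where f = of_real and g = K])
        (auto intro!: derivative_eq_intros has_field_derivative_at_within [OF * [simplified]] simp: has_vector_derivative_of_real)
    from has_vector_derivative_add [OF has_vector_derivative_mult [OF dE [OF R] dE [OF R]]
        has_vector_derivative_divide [OF this, of z]]
    show ?thesis unfolding H_def using z0 by (simp add: power2_eq_square mult.commute)
  qed
  have H0: "H R = of_real pi / (4 * z)" if "0 \<le> R" for R
  proof -
    have "H R = H 0"
      using has_vector_derivative_zero_constant [of "{0..R}" H] dH that by fastforce
    moreover have "((\<lambda>s :: real. 1 / (1 + s\<^sup>2)) has_integral arctan 1 - arctan 0) {0..1}"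
      by (intro fundamental_theorem_of_calculus)
        (auto intro!: derivative_eq_intros simp: divide_inverse simp flip: has_real_derivative_iff_has_vector_derivative)
    from has_integral_linear [OF this bounded_linear_of_real [where 'a = complex]]
    have "K 0 = of_real (arctan 1 - arctan 0)"
      unfolding K_def k_def by (intro integral_unique) (simp add: o_def)
    ultimately show ?thesis by (simp add: H_def E_def arctan_one)
  qed
  have K0: "((\<lambda>R :: real. K (of_real R)) \<longlongrightarrow> 0) at_top"
  proof (rule Lim_null_comparison)
    show "\<forall>\<^sub>F R :: real in at_top. norm (K (of_real R)) \<le> exp (- Re z * R ^ 2)"
    proof (rule always_eventually, rule allI)
      fix R :: real
      have "norm (K (of_real R)) \<le> exp (- Re z * R ^ 2) * (1 - 0)"
        unfolding K_def
      proof (rule integral_bound)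
        show "continuous_on {0..1} (k (of_real R))"
          unfolding k_def by (intro continuous_intros ballI s0)
        fix s :: real
        have "(1 + of_real s ^ 2 :: complex) = of_real (1 + s ^ 2)" by simp
        then have n: "norm (1 + of_real s ^ 2 :: complex) = 1 + s ^ 2"
          by (metis abs_of_nonneg add_nonneg_nonneg norm_of_real zero_le_one zero_le_power2)
        have "Re (- z * of_real R ^ 2 * (1 + of_real s ^ 2)) = - Re z * R ^ 2 * (1 + s ^ 2)"
          by (simp flip: of_real_power of_real_add add: algebra_simps)
        moreover have "\<dots> \<le> - Re z * R ^ 2"
          using z by (simp add: algebra_simps)
        ultimately have "exp (Re (- z * of_real R ^ 2 * (1 + of_real s ^ 2))) / (1 + s ^ 2) \<le> exp (- Re z * R ^ 2) / 1"
          by (intro frac_le) auto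
        then show "norm (k (of_real R) s) \<le> exp (- Re z * R ^ 2)"
          unfolding k_def norm_divide n norm_exp_eq_Re by simp
      qed auto
      then show "norm (K (of_real R)) \<le> exp (- Re z * R ^ 2)" by simp
    qed
    have "((\<lambda>R. exp (- Re z * R ^ 2)) \<longlongrightarrow> 0) at_top"
      using z by (intro filterlim_compose [OF exp_at_bot] filterlim_tendsto_neg_mult_at_bot [OF tendsto_const]
          filterlim_pow_at_top filterlim_ident) auto
    then show "((\<lambda>R. exp (- Re z * R ^ 2)) \<longlongrightarrow> 0) at_top" .
  qed
  have "((\<lambda>R. H R) \<longlongrightarrow> L ^ 2 + 0 / z) at_top"
    unfolding H_def E_def e_def using z0 by (intro tendsto_intros lim K0)
  moreover have "((\<lambda>R. H R) \<longlongrightarrow> of_real pi / (4 * z)) at_top"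
    by (rule tendsto_eventually) (use H0 in \<open>auto intro: eventually_mono [OF eventually_ge_at_top [of 0]]\<close>)
  ultimately show ?thesis
    using tendsto_unique trivial_limit_at_top_linorder by fastforce
qed

definition gauss :: "complex \<Rightarrow> complex" where
  "gauss z = (\<integral>x. exp (- z * of_real (x\<^sup>2)) \<partial>lborel)"

lemma integrable_real_gauss:
  assumes "0 < (a :: real)"
  shows "integrable lborel (\<lambda>x. exp (- a * x\<^sup>2))"
proof -
  have "integrable lborel (\<lambda>x :: real. exp (- x\<^sup>2))"
  proof -
    have "integrable lborel (\<lambda>x. indicator {0..} x *\<^sub>R exp (- x\<^sup>2) :: real)"
      using gaussian_moment_0 by (rule integrable.intros)
    from has_bochner_integral_even_function [OF gaussian_moment_0] show ?thesis
      by (simp add: has_bochner_integral_iff)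
  qed
  then have "integrable lborel (\<lambda>x :: real. exp (- (0 + sqrt a * x)\<^sup>2))"
    using assms by (intro lborel_integrable_real_affine) auto
  then show ?thesis using assms by (simp add: power_mult_distrib)
qed

lemma integrable_gauss:
  assumes "0 < Re z" shows "integrable lborel (\<lambda>x :: real. exp (- z * of_real (x\<^sup>2)))"
  by (rule Bochner_Integration.integrable_bound [OF integrable_real_gauss [OF assms]]) auto

text \<open>Only the square is identified: \<open>gauss z\<close> matters later through its modulus,
  so no branch of the square root has to be chosen.\<close>

lemma gauss_square:
  assumes z: "0 < Re z" shows "(gauss z)\<^sup>2 = of_real pi / z"
proof -
  let ?e = "\<lambda>x :: real. exp (- z * of_real (x\<^sup>2))"
  define L where "L = (\<integral>x. indicator {0..} x *\<^sub>R ?e x \<partial>lborel)"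
  have int: "integrable lborel (\<lambda>x. indicator {0..} x *\<^sub>R ?e x)"
    by (rule integrable_mult_indicator [OF _ integrable_gauss [OF z]]) simp
  have "has_bochner_integral lborel ?e (2 *\<^sub>R L)"
    by (rule has_bochner_integral_even_function) (use int in \<open>auto simp: has_bochner_integral_iff L_def\<close>)
  then have g: "gauss z = 2 * L"
    by (simp add: gauss_def has_bochner_integral_integral_eq scaleR_conv_of_real)
  have "((\<lambda>R. \<integral>x. indicator {..R} x *\<^sub>R (indicator {0..} x *\<^sub>R ?e x) \<partial>lborel) \<longlongrightarrow> L) at_top"
    unfolding L_def by (rule tendsto_integral_at_top) (use int in auto)
  moreover have "(\<integral>x. indicator {..R} x *\<^sub>R (indicator {0..} x *\<^sub>R ?e x) \<partial>lborel) = integral {0..R} ?e" for R :: real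
  proof -
    have "(\<integral>x. indicator {..R} x *\<^sub>R (indicator {0..} x *\<^sub>R ?e x) \<partial>lborel) = (LINT x:{0..R}|lborel. ?e x)"
      unfolding set_lebesgue_integral_def by (intro Bochner_Integration.integral_cong) (auto simp: indicator_def)
    also have "\<dots> = integral {0..R} ?e"
      by (intro set_borel_integral_eq_integral borel_integrable_atLeastAtMost') (intro continuous_intros)
    finally show ?thesis .
  qed
  ultimately have "L\<^sup>2 = of_real pi / (4 * z)"
    by (intro gaussian_half_line_limit z) simp
  then show ?thesis unfolding g by (simp add: power_mult_distrib)
qed


lemma abs_set_integrable_lborel:
  fixes f :: "real \<Rightarrow> complex"
  assumes [measurable]: "A \<in> sets borel" "f \<in> borel_measurable borel"
  shows "f absolutely_integrable_on A \<longleftrightarrow> integrable (rst A) f"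
  unfolding integrable_rst [OF assms] set_integrable_def
  by (rule integrable_completion) simp

lemma subordination:
  fixes \<mu> :: real and z :: complex
  assumes \<mu>: "0 < \<mu>" and z: "0 < Re z"
  defines "f \<equiv> \<lambda>s. of_real (s powr (- 1/2)) * exp (- z * of_real (\<mu>\<^sup>2 * s + 1 / (4 * s)))"
  shows "integrable (rst {0<..}) f" (is ?int)
    and "integral\<^sup>L (rst {0<..}) f = gauss z * exp (- z * of_real \<mu>) / of_real \<mu>" (is ?eq)
proof -
  \<comment> \<open>\<open>v y\<close> is the positive root of \<mu> v^2 - y v - 1/2 = 0, that is
    \<open>sqrt s\<close> solved from y = \<mu> sqrt s - 1 / (2 sqrt s).\<close>
  define w where "w = (\<lambda>y. sqrt (y\<^sup>2 + 2 * \<mu>))"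
  define v where "v = (\<lambda>y. (y + w y) / (2 * \<mu>))"
  have pos: "0 < y\<^sup>2 + 2 * \<mu>" for y using \<mu> by (smt (verit) zero_le_power2)
  have w: "0 < w y" "w y * w y = y\<^sup>2 + 2 * \<mu>" "\<bar>y\<bar> < w y" for y
    using pos [of y] \<mu> by (auto simp: w_def intro!: real_less_rsqrt)
  have v: "0 < v y" for y using w(3) [of y] \<mu> by (auto simp: v_def)
  have inv_v: "1 / v y = w y - y" for y
  proof -
    have "(w y - y) * (w y + y) = 2 * \<mu>"
      using w(2) [of y] by (simp add: algebra_simps power2_eq_square)
    then show ?thesis using v [of y] \<mu> unfolding v_def by (simp add: field_simps)
  qed
  have left_inv: "\<mu> * v y - 1 / v y / 2 = y" for y
    unfolding inv_v using \<mu> by (simp add: v_def field_simps)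
  have dv: "(v has_real_derivative v y / w y) (at y)" for y
  proof -
    have "(w has_real_derivative inverse (sqrt (y\<^sup>2 + 2 * \<mu>)) / 2 * (2 * y)) (at y)"
      unfolding w_def by (rule DERIV_chain2 [where f = sqrt and g = "\<lambda>y. y\<^sup>2 + 2 * \<mu>", OF DERIV_real_sqrt [OF pos]]) (auto intro!: derivative_eq_intros)
    then have "(v has_real_derivative (1 + inverse (w y) / 2 * (2 * y)) / (2 * \<mu>)) (at y)"
      unfolding v_def by (intro DERIV_cdivide DERIV_add DERIV_ident) (simp add: w_def)
    moreover have "(1 + inverse (w y) / 2 * (2 * y)) / (2 * \<mu>) = v y / w y"
      unfolding v_def using w(1) [of y] \<mu> by (simp add: field_simps)
    ultimately show ?thesis by simp
  qed
  let ?g = "\<lambda>y. (v y)\<^sup>2" and ?h = "\<lambda>y. 2 * (v y)\<^sup>2 / w y"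
  have dg: "(?g has_real_derivative ?h y) (at y within UNIV)" for y
    using dv [of y] by (auto intro!: derivative_eq_intros simp: power2_eq_square)
  have inj: "inj ?g"
  proof (rule injI)
    fix x y assume "?g x = ?g y"
    then have "v x = v y" using v [of x] v [of y] by (simp add: power2_eq_iff_nonneg)
    then show "x = y" using left_inv by metis
  qed
  have img: "range ?g = {0<..}"
  proof safe
    fix y show "0 < (v y)\<^sup>2" using v [of y] by simp
  next
    fix s :: real assume s: "0 < s"
    define y where "y = \<mu> * sqrt s - 1 / (2 * sqrt s)"
    have "y\<^sup>2 + 2 * \<mu> = (\<mu> * sqrt s + 1 / (2 * sqrt s))\<^sup>2"
      using s by (simp add: y_def power2_eq_square field_simps)
    then have "w y = \<mu> * sqrt s + 1 / (2 * sqrt s)"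
      using s \<mu> by (simp add: w_def)
    then have "v y = sqrt s" using \<mu> by (simp add: v_def y_def)
    then show "s \<in> range ?g" using s by (metis less_imp_le rangeI real_sqrt_pow2)
  qed
  \<comment> \<open>The exponent becomes \<open>y\<^sup>2 + \<mu>\<close>. The transformed weight
    splits into the even part \<open>1 / \<mu>\<close> and an odd part proportional to
    \<open>y / w y\<close>, which integrates to 0 against the Gaussian.\<close>
  define F where "F = (\<lambda>y. of_real ((1 + y / w y) / \<mu>) * (exp (- z * of_real \<mu>) * exp (- z * of_real (y\<^sup>2))))"
  have eqF: "\<bar>?h y\<bar> *\<^sub>R f (?g y) = F y" for y
  proof -
    have "\<mu>\<^sup>2 * (v y)\<^sup>2 + 1 / (4 * (v y)\<^sup>2) = (\<mu> * v y - 1 / v y / 2)\<^sup>2 + \<mu>"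
      using v [of y] by (simp add: power2_eq_square field_simps)
    then have e: "\<mu>\<^sup>2 * (v y)\<^sup>2 + 1 / (4 * (v y)\<^sup>2) = y\<^sup>2 + \<mu>" by (simp only: left_inv)
    have p: "(v y)\<^sup>2 powr (- 1/2) = 1 / v y"
      using v [of y] by (simp add: powr_minus_divide powr_half_sqrt)
    have "?h y * (1 / v y) = 2 * v y / w y"
      using v [of y] by (simp add: power2_eq_square)
    also have "2 * v y = (y + w y) / \<mu>" using \<mu> by (simp add: v_def field_simps)
    also have "(y + w y) / \<mu> / w y = (1 + y / w y) / \<mu>"
      using w(1) [of y] \<mu> by (simp add: field_simps)
    finally have c: "?h y * (1 / v y) = (1 + y / w y) / \<mu>" .
    have h0: "\<bar>?h y\<bar> = ?h y" using w(1) [of y] by simp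
    have "\<bar>?h y\<bar> *\<^sub>R f (?g y) = of_real (?h y * (1 / v y)) * exp (- z * of_real (y\<^sup>2 + \<mu>))"
      unfolding f_def p e h0 by (simp add: scaleR_conv_of_real)
    then show ?thesis unfolding c F_def by (simp add: exp_add [symmetric] algebra_simps)
  qed
  have [measurable]: "w \<in> borel_measurable borel" unfolding w_def by measurable
  have [measurable]: "f \<in> borel_measurable borel" unfolding f_def by measurable
  have yw: "\<bar>y / w y\<bar> \<le> 1" for y using w [of y] by (simp add: abs_divide)
  let ?o = "\<lambda>y. of_real (y / w y) * exp (- z * of_real (y\<^sup>2))"
  have into: "integrable lborel ?o"
    by (rule Bochner_Integration.integrable_bound [OF integrable_gauss [OF z]])
      (use yw in \<open>auto simp only: norm_mult norm_of_real intro!: mult_left_le_one_le AE_I2\<close>, measurable)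
  have "integral\<^sup>L lborel ?o = (\<integral>y. ?o (0 + (-1) * y) \<partial>lborel)"
    using lborel_integral_real_affine [of "-1" ?o 0] by simp
  also have "\<dots> = - integral\<^sup>L lborel ?o"
    by (subst Bochner_Integration.integral_minus [symmetric]) (auto simp: w_def intro!: Bochner_Integration.integral_cong)
  finally have zero: "integral\<^sup>L lborel ?o = 0"
    by (simp add: eq_neg_iff_add_eq_0 flip: mult_2)
  have F': "F = (\<lambda>y. (exp (- z * of_real \<mu>) / of_real \<mu>) * (exp (- z * of_real (y\<^sup>2)) + ?o y))"
    unfolding F_def using \<mu> by (auto simp: field_simps)
  have intF: "integrable lborel F" and "integral\<^sup>L lborel F = gauss z * exp (- z * of_real \<mu>) / of_real \<mu>"
    unfolding F' using into integrable_gauss [OF z] zero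
    by (auto simp: Bochner_Integration.integral_add gauss_def)
  moreover have "set_integrable lborel UNIV F" using intF by (simp add: set_integrable_def)
  then have "integral UNIV F = integral\<^sup>L lborel F"
    by (simp add: set_borel_integral_eq_integral(2) [symmetric] set_lebesgue_integral_def)
  moreover have "F absolutely_integrable_on UNIV"
    using intF borel_measurable_integrable [OF intF]
    unfolding set_integrable_def by (subst integrable_completion) auto
  ultimately have "(\<lambda>y. \<bar>?h y\<bar> *\<^sub>R f (?g y)) absolutely_integrable_on UNIV \<and>
      integral UNIV (\<lambda>y. \<bar>?h y\<bar> *\<^sub>R f (?g y)) = gauss z * exp (- z * of_real \<mu>) / of_real \<mu>"
    unfolding eqF by simp
  moreover have U: "UNIV \<in> sets (lebesgue :: real measure)" by simp
  ultimately have "f absolutely_integrable_on range ?g \<and> integral (range ?g) f = gauss z * exp (- z * of_real \<mu>) / of_real \<mu>"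
    using has_absolute_integral_change_of_variables_real [OF U dg inj, of f] by blast
  then have *: "f absolutely_integrable_on {0<..}" "integral {0<..} f = gauss z * exp (- z * of_real \<mu>) / of_real \<mu>"
    unfolding img by auto
  from *(1) show ?int by (subst (asm) abs_set_integrable_lborel) auto
  then have "set_integrable lborel {0<..} f" by (subst (asm) integrable_rst) auto
  then show ?eq using *(2) by (subst integral_rst) (auto simp: set_borel_integral_eq_integral(2))
qed

section \<open>One-dimensional kernels\<close>

text \<open>Both quarter periods are moved to start at \<pi>/2, where the second derivative of the
  phase vanishes. On the right the amplitude decreases, whence the sign; on the left the reflected
  phase changes sign as a whole, which the cosine ignores, so both quarters see the same
  \<open>\<nu>\<close>.\<close>

lemma oscillatory_bound_half_period:
  fixes \<kappa> \<nu> T q :: real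
  assumes T: "0 < T" and q: "0 \<le> q"
  shows "\<bar>integral {0..pi} (\<lambda>\<xi>. exp (- q * (1 - cos \<xi>)) * cos (\<kappa> + \<nu> * \<xi> - T * cos \<xi>))\<bar> \<le> 224 * \<beta> \<nu> T"
proof -
  let ?f = "\<lambda>\<xi>. exp (- q * (1 - cos \<xi>)) * cos (\<kappa> + \<nu> * \<xi> - T * cos \<xi>)"
  have mono: "sin x \<le> sin y" if "0 \<le> x" "x \<le> y" "y \<le> pi / 2" for x y :: real
    using that by (intro sin_monotone_2pi_le) auto
  have "integral {pi/2..pi} ?f = integral {0..pi/2} (?f \<circ> (+) (pi/2))"
    using integral_shift_Icc_real [of 0 "pi/2" ?f "pi/2"] by simp
  also have "\<dots> = integral {0..pi/2} (\<lambda>\<theta>. - ((- exp (- q * (1 + sin \<theta>))) * cos (\<kappa> + \<nu> * (pi/2) + \<nu> * \<theta> + T * sin \<theta>)))"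
  proof (intro integral_cong)
    fix \<theta> :: real
    have eqs: "1 - cos (pi/2 + \<theta>) = 1 + sin \<theta>"
      "\<kappa> + \<nu> * (pi/2 + \<theta>) - T * cos (pi/2 + \<theta>) = \<kappa> + \<nu> * (pi/2) + \<nu> * \<theta> + T * sin \<theta>"
      by (simp_all add: cos_add algebra_simps)
    show "(?f \<circ> (+) (pi/2)) \<theta> = - ((- exp (- q * (1 + sin \<theta>))) * cos (\<kappa> + \<nu> * (pi/2) + \<nu> * \<theta> + T * sin \<theta>))"
      by (simp only: o_def mult_minus_left minus_minus eqs flip: minus_mult_left)
  qed
  finally have 1: "integral {pi/2..pi} ?f = - integral {0..pi/2}
      (\<lambda>\<theta>. (- exp (- q * (1 + sin \<theta>))) * cos (\<kappa> + \<nu> * (pi/2) + \<nu> * \<theta> + T * sin \<theta>))"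
    by (simp only: Henstock_Kurzweil_Integration.integral_neg)
  have b1: "\<bar>integral {pi/2..pi} ?f\<bar> \<le> 112 * \<beta> \<nu> T"
    unfolding 1 abs_minus_cancel
  proof (rule oscillatory_bound_mono [OF T])
    fix x y :: real assume xy: "0 \<le> x" "x \<le> y" "y \<le> pi / 2"
    show "- exp (- q * (1 + sin x)) \<le> - exp (- q * (1 + sin y))"
      using q mono [OF xy] by (simp add: mult_left_mono)
  next
    fix x :: real assume x: "0 \<le> x" "x \<le> pi / 2"
    show "\<bar>- exp (- q * (1 + sin x))\<bar> \<le> 1"
      using q mono [of 0 x] x by simp
  qed
  have "integral {0..pi/2} ?f = integral {-(pi/2)..0} (\<lambda>\<xi>. ?f (- \<xi>))"
    using Henstock_Kurzweil_Integration.integral_reflect_real [of "pi/2" 0 ?f] by simp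
  also have "\<dots> = integral {0..pi/2} ((\<lambda>\<xi>. ?f (- \<xi>)) \<circ> (+) (- (pi/2)))"
    using integral_shift_Icc_real [of 0 "pi/2" "\<lambda>\<xi>. ?f (- \<xi>)" "- (pi/2)"] by simp
  also have "\<dots> = integral {0..pi/2} (\<lambda>\<theta>. exp (- q * (1 - sin \<theta>)) * cos (- \<kappa> - \<nu> * (pi/2) + \<nu> * \<theta> + T * sin \<theta>))"
  proof (intro integral_cong)
    fix \<theta> :: real
    have "cos (- \<kappa> - \<nu> * (pi/2) + \<nu> * \<theta> + T * sin \<theta>) = cos (- (- \<kappa> - \<nu> * (pi/2) + \<nu> * \<theta> + T * sin \<theta>))"
      by (rule cos_minus [symmetric])
    moreover have "1 - cos (- (- (pi/2) + \<theta>)) = 1 - sin \<theta>"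
      "\<kappa> + \<nu> * (- (- (pi/2) + \<theta>)) - T * cos (- (- (pi/2) + \<theta>)) = - (- \<kappa> - \<nu> * (pi/2) + \<nu> * \<theta> + T * sin \<theta>)"
      by (simp_all add: cos_diff algebra_simps)
    ultimately show "((\<lambda>\<xi>. ?f (- \<xi>)) \<circ> (+) (- (pi/2))) \<theta>
      = exp (- q * (1 - sin \<theta>)) * cos (- \<kappa> - \<nu> * (pi/2) + \<nu> * \<theta> + T * sin \<theta>)"
      unfolding o_def by metis
  qed
  finally have 2: "integral {0..pi/2} ?f = integral {0..pi/2}
      (\<lambda>\<theta>. exp (- q * (1 - sin \<theta>)) * cos (- \<kappa> - \<nu> * (pi/2) + \<nu> * \<theta> + T * sin \<theta>))" .
  have b2: "\<bar>integral {0..pi/2} ?f\<bar> \<le> 112 * \<beta> \<nu> T"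
    unfolding 2
  proof (rule oscillatory_bound_mono [OF T])
    fix x y :: real assume xy: "0 \<le> x" "x \<le> y" "y \<le> pi / 2"
    show "exp (- q * (1 - sin x)) \<le> exp (- q * (1 - sin y))"
      using q mono [OF xy] by (simp add: mult_left_mono)
  next
    fix x :: real
    show "\<bar>exp (- q * (1 - sin x))\<bar> \<le> 1" using q by simp
  qed
  have "integral {0..pi} ?f = integral {0..pi/2} ?f + integral {pi/2..pi} ?f"
    by (rule Henstock_Kurzweil_Integration.integral_combine [symmetric])
      (auto intro!: integrable_continuous_real continuous_intros)
  then show ?thesis using b1 b2 by linarith
qed

text \<open>Reflecting the negative half replaces \<open>\<nu>\<close> by \<open>- \<nu>\<close>, so
  both transition points T = \<nu> and T = - \<nu> enter.\<close>

lemma oscillatory_bound_period: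
  fixes \<kappa> \<nu> T q :: real
  assumes T: "0 < T" and q: "0 \<le> q"
  shows "\<bar>integral {-pi..pi} (\<lambda>\<xi>. exp (- q * (1 - cos \<xi>)) * cos (\<kappa> + \<nu> * \<xi> - T * cos \<xi>))\<bar>
    \<le> 224 * (\<beta> \<nu> T + \<beta> (- \<nu>) T)"
proof -
  let ?f = "\<lambda>\<xi>. exp (- q * (1 - cos \<xi>)) * cos (\<kappa> + \<nu> * \<xi> - T * cos \<xi>)"
  have "integral {-pi..pi} ?f = integral {-pi..0} ?f + integral {0..pi} ?f"
    by (rule Henstock_Kurzweil_Integration.integral_combine [symmetric])
      (auto intro!: integrable_continuous_real continuous_intros)
  also have "integral {-pi..0} ?f = integral {0..pi} (\<lambda>\<xi>. exp (- q * (1 - cos \<xi>)) * cos (\<kappa> + (- \<nu>) * \<xi> - T * cos \<xi>))"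
    using Henstock_Kurzweil_Integration.integral_reflect_real [of 0 "-pi" ?f] by simp
  finally show ?thesis
    using add_mono [OF oscillatory_bound_half_period [OF T q, of \<kappa> "- \<nu>"] oscillatory_bound_half_period [OF T q, of \<kappa> \<nu>]]
    by (simp only: distrib_left add.commute [of "224 * \<beta> \<nu> T"])
qed

text \<open>This is 2 \<pi> exp(-2 z s) I_n(2 z s), with I_n the modified Bessel function of the
  first kind.\<close>

definition kernel :: "complex \<Rightarrow> int \<Rightarrow> real \<Rightarrow> complex" where
  "kernel z n s = (\<integral>\<xi>. exp (\<i> * of_int n * of_real \<xi>) * exp (- z * of_real (s * (2 - 2 * cos \<xi>))) \<partial>rst {-pi..pi})"

text \<open>The damping appears as the amplitude \<open>exp (- q * (1 - cos \<xi>))\<close>,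
  monotone on each half period, so it does not worsen the undamped bound. The imaginary part is the
  same integral with the phase shifted by \<open>pi / 2\<close>.\<close>

lemma kernel_bound:
  assumes a: "0 \<le> a" and t: "0 < t" and s: "0 < s"
  shows "norm (kernel (Complex a (- t)) n s) \<le> 448 * (\<beta> (of_int n) (2 * t * s) + \<beta> (- of_int n) (2 * t * s))"
proof -
  define T where "T = 2 * t * s"
  define q where "q = 2 * a * s"
  have T: "0 < T" and q: "0 \<le> q" using a t s by (auto simp: T_def q_def)
  let ?F = "\<lambda>\<xi>. exp (\<i> * of_int n * of_real \<xi>) * exp (- Complex a (- t) * of_real (s * (2 - 2 * cos \<xi>)))"
  have F: "?F \<xi> = of_real (exp (- q * (1 - cos \<xi>))) * cis (T + n * \<xi> - T * cos \<xi>)" for \<xi> :: real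
  proof -
    have "\<i> * of_int n * of_real \<xi> + (- Complex a (- t) * of_real (s * (2 - 2 * cos \<xi>)))
      = of_real (- q * (1 - cos \<xi>)) + \<i> * of_real (T + n * \<xi> - T * cos \<xi>)"
      by (simp add: complex_eq_iff T_def q_def algebra_simps)
    then show ?thesis by (simp only: exp_add [symmetric] exp_of_real [symmetric] cis_conv_exp)
  qed
  have cont: "continuous_on S ?F" for S by (intro continuous_intros)
  have int: "set_integrable lborel {-pi..pi} ?F"
    by (rule borel_integrable_atLeastAtMost' [OF cont])
  have "kernel (Complex a (- t)) n s = integral {-pi..pi} ?F"
    unfolding kernel_def by (subst integral_rst) (simp_all only: set_borel_integral_eq_integral(2) [OF int], simp_all)
  moreover have i: "(?F has_integral integral {-pi..pi} ?F) {-pi..pi}"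
    by (intro integrable_integral integrable_continuous_real cont)
  ultimately have K: "(?F has_integral kernel (Complex a (- t)) n s) {-pi..pi}" by simp
  have "Re (kernel (Complex a (- t)) n s) = integral {-pi..pi} (\<lambda>\<xi>. exp (- q * (1 - cos \<xi>)) * cos (T + n * \<xi> - T * cos \<xi>))"
    using has_integral_Re [OF K] unfolding F by (simp add: integral_unique)
  moreover have "Im (kernel (Complex a (- t)) n s)
      = integral {-pi..pi} (\<lambda>\<xi>. exp (- q * (1 - cos \<xi>)) * cos (T - pi / 2 + n * \<xi> - T * cos \<xi>))"
  proof -
    have "sin (T + n * \<xi> - T * cos \<xi>) = cos (T - pi / 2 + n * \<xi> - T * cos \<xi>)" for \<xi> :: real
      using sin_cos_eq [of "T + n * \<xi> - T * cos \<xi>"] cos_minus [of "T - pi / 2 + n * \<xi> - T * cos \<xi>"]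
      by (simp add: algebra_simps)
    then show ?thesis
      using has_integral_Im [OF K] unfolding F by (simp add: integral_unique)
  qed
  ultimately show ?thesis
    using oscillatory_bound_period [OF T q, of T n] oscillatory_bound_period [OF T q, of "T - pi/2" n]
      cmod_le [of "kernel (Complex a (- t)) n s"] unfolding T_def by linarith
qed

text \<open>\<open>\<phi> \<nu> T = T\<^sup>4\<^sup>/\<^sup>3 (\<beta> \<nu> T)\<^sup>5\<close>. The exponent \<open>5/4 > 1\<close> makes its integral bounded uniformly in \<open>\<nu>\<close>; with
  fourth powers the integral would grow logarithmically, which is why \<open>d \<ge> 5\<close> is needed.\<close>

definition \<phi> :: "real \<Rightarrow> real \<Rightarrow> real" where
  "\<phi> \<nu> T = T powr (1/12) * (\<bar>T + \<nu>\<bar> + T powr (1/3)) powr (- 5/4)"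

lemma \<phi>_nonneg [simp]: "0 \<le> \<phi> \<nu> T"
  by (simp add: \<phi>_def)

lemma \<phi>_measurable [measurable]: "\<phi> \<nu> \<in> borel_measurable borel"
  unfolding \<phi>_def [abs_def] by measurable

lemma nn_integral_powr_shift:
  fixes b :: real
  assumes b: "0 < b"
  shows "(\<integral>\<^sup>+u. ennreal ((\<bar>u - c\<bar> + b) powr (- 5/4)) \<partial>lborel) \<le> ennreal (8 * b powr (- 1/4))"
proof -
  have half: "(\<integral>\<^sup>+u. ennreal ((u + b) powr (- 5/4)) * indicator {0..} u \<partial>lborel) = ennreal (4 * b powr (- 1/4))"
  proof -
    have "(\<integral>\<^sup>+u. ennreal ((u + b) powr (- 5/4)) * indicator {0..} u \<partial>lborel)
        = ennreal (0 - (- 4 * (0 + b) powr (- 1/4)))"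
    proof (rule nn_integral_FTC_atLeast)
      show "((\<lambda>u. - 4 * (u + b) powr (- 1/4)) has_real_derivative (u + b) powr (- 5/4)) (at u)" if "0 \<le> u" for u
        using that b by (auto intro!: derivative_eq_intros)
      have "((\<lambda>u. (u + b) powr (- 1/4)) \<longlongrightarrow> 0) at_top"
        by real_asymp
      from tendsto_mult_right [OF this, of "- 4"]
      show "((\<lambda>u. - 4 * (u + b) powr (- 1/4)) \<longlongrightarrow> 0) at_top" by (simp add: mult.commute)
    qed auto
    then show ?thesis by simp
  qed
  have "(\<integral>\<^sup>+u. ennreal ((\<bar>u - c\<bar> + b) powr (- 5/4)) \<partial>lborel) = (\<integral>\<^sup>+u. ennreal ((\<bar>u\<bar> + b) powr (- 5/4)) \<partial>lborel)"
    by (subst nn_integral_real_affine [of _ 1 c]) auto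
  also have "\<dots> \<le> (\<integral>\<^sup>+u. ennreal ((u + b) powr (- 5/4)) * indicator {0..} u
      + ennreal ((- u + b) powr (- 5/4)) * indicator {0..} (- u) \<partial>lborel)"
    by (intro nn_integral_mono) (auto simp: indicator_def)
  also have "\<dots> = (\<integral>\<^sup>+u. ennreal ((u + b) powr (- 5/4)) * indicator {0..} u \<partial>lborel)
      + (\<integral>\<^sup>+u. ennreal ((- u + b) powr (- 5/4)) * indicator {0..} (- u) \<partial>lborel)"
    by (rule nn_integral_add) auto
  also have "(\<integral>\<^sup>+u. ennreal ((- u + b) powr (- 5/4)) * indicator {0..} (- u) \<partial>lborel)
      = (\<integral>\<^sup>+u. ennreal ((u + b) powr (- 5/4)) * indicator {0..} u \<partial>lborel)"
    by (subst (2) nn_integral_real_affine [of _ "-1" 0]) auto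
  finally show ?thesis unfolding half by (simp flip: ennreal_plus)
qed

text \<open>When \<open>T + \<nu>\<close> has modulus at least \<open>T / 2\<close>,
  \<open>\<phi>\<close> is dominated by a power of T integrable at 0 (for T up to 1) or at infinity
  (for T from 1 on). Otherwise T lies between \<open>- \<nu> / 2\<close> and
  \<open>- 2 * \<nu>\<close>, and the powers of T can be frozen at that size.\<close>

lemma \<phi>_bound:
  assumes T: "0 < T"
  shows "\<phi> \<nu> T \<le> T powr (- 1/3) * indicator {0..1} T + 4 * T powr (- 7/6) * indicator {1..} T
    + (- 2 * \<nu>) powr (1/12) * (\<bar>T + \<nu>\<bar> + (- \<nu> / 2) powr (1/3)) powr (- 5/4) * indicator {..<0} \<nu>"
proof -
  have p: "0 < T powr (1/3)" using T by simp
  have nonneg: "0 \<le> T powr (- 1/3) * indicator {0..1} T" "0 \<le> 4 * T powr (- 7/6) * indicator {1..} T"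
    "0 \<le> (- 2 * \<nu>) powr (1/12) * (\<bar>T + \<nu>\<bar> + (- \<nu> / 2) powr (1/3)) powr (- 5/4) * indicator {..<0} \<nu>"
    by auto
  show ?thesis
  proof (cases "T / 2 \<le> \<bar>T + \<nu>\<bar>")
    case far: True
    show ?thesis
    proof (cases "T \<le> 1")
      case True
      have "(\<bar>T + \<nu>\<bar> + T powr (1/3)) powr (- 5/4) \<le> (T powr (1/3)) powr (- 5/4)"
        using p by (intro powr_mono2') linarith+
      then have "\<phi> \<nu> T \<le> T powr (1/12) * (T powr (1/3)) powr (- 5/4)"
        unfolding \<phi>_def by (intro mult_left_mono) auto
      also have "\<dots> = T powr (- 1/3)" unfolding powr_powr powr_add [symmetric] by simp
      finally have "\<phi> \<nu> T \<le> T powr (- 1/3) * indicator {0..1} T" using True T by simp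
      then show ?thesis using nonneg by linarith
    next
      case False
      have "(\<bar>T + \<nu>\<bar> + T powr (1/3)) powr (- 5/4) \<le> (T * (1/2)) powr (- 5/4)"
        using p far T by (intro powr_mono2') linarith+
      also have "\<dots> = T powr (- 5/4) * (1/2) powr (- 5/4)" using T by (intro powr_mult)
      also have "\<dots> \<le> T powr (- 5/4) * (1/2) powr (- 2)"
        by (intro mult_left_mono powr_mono') auto
      also have "(1/2) powr (- 2) = (4 :: real)" by (simp add: powr_minus power2_eq_square)
      finally have "\<phi> \<nu> T \<le> T powr (1/12) * (T powr (- 5/4) * 4)"
        unfolding \<phi>_def by (intro mult_left_mono) auto
      also have "\<dots> = 4 * T powr (- 7/6)" unfolding mult.assoc [symmetric] powr_add [symmetric] by simp
      finally have "\<phi> \<nu> T \<le> 4 * T powr (- 7/6) * indicator {1..} T" using False by simp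
      then show ?thesis using nonneg by linarith
    qed
  next
    case False
    then have \<nu>: "\<nu> < 0" "T \<le> - 2 * \<nu>" "- \<nu> / 2 \<le> T" using T by linarith+
    have "T powr (1/12) \<le> (- 2 * \<nu>) powr (1/12)"
      using \<nu> T by (intro powr_mono2) auto
    moreover have "(- \<nu> / 2) powr (1/3) \<le> T powr (1/3)"
      using \<nu> T by (intro powr_mono2) auto
    then have "(\<bar>T + \<nu>\<bar> + T powr (1/3)) powr (- 5/4) \<le> (\<bar>T + \<nu>\<bar> + (- \<nu> / 2) powr (1/3)) powr (- 5/4)"
      using \<nu>(1) powr_gt_zero [of "- \<nu> / 2" "1/3"] by (intro powr_mono2') (simp_all add: add_nonneg_pos)
    ultimately have "\<phi> \<nu> T \<le> (- 2 * \<nu>) powr (1/12) * (\<bar>T + \<nu>\<bar> + (- \<nu> / 2) powr (1/3)) powr (- 5/4)"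
      unfolding \<phi>_def by (intro mult_mono) auto
    then have "\<phi> \<nu> T \<le> (- 2 * \<nu>) powr (1/12) * (\<bar>T + \<nu>\<bar> + (- \<nu> / 2) powr (1/3)) powr (- 5/4) * indicator {..<0} \<nu>"
      using \<nu> by simp
    then show ?thesis using nonneg by linarith
  qed
qed

text \<open>The three pieces contribute 3/2, 4 * 6 and at most 16. The bound is uniform because in
  the last piece the factors |\<nu>|^(1/12) and |\<nu>|^(-1/12) cancel.\<close>

lemma nn_integral_\<phi>:
  "(\<integral>\<^sup>+T. ennreal (\<phi> \<nu> T) * indicator {0<..} T \<partial>lborel) \<le> 50"
proof -
  let ?a = "\<lambda>T. ennreal (indicator {0..1} T * T powr (- 1/3))"
  let ?b = "\<lambda>T. ennreal (indicator {1..} T * T powr (- 7/6))"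
  let ?c = "\<lambda>T. ennreal ((\<bar>T - (- \<nu>)\<bar> + (- \<nu> / 2) powr (1/3)) powr (- 5/4))"
  let ?k = "ennreal ((- 2 * \<nu>) powr (1/12) * indicator {..<0} \<nu>)"
  have a: "(\<integral>\<^sup>+T. ?a T \<partial>lborel) = ennreal (3/2)"
    using nn_integral_has_integral_lebesgue [OF _ has_integral_powr_from_0 [of "- 1/3" 1]] by simp
  have b: "(\<integral>\<^sup>+T. ?b T \<partial>lborel) = ennreal 6"
    using nn_integral_has_integral_lebesgue [OF _ has_integral_powr_to_inf [of "- 7/6" 1]] by simp
  have c: "?k * (\<integral>\<^sup>+T. ?c T \<partial>lborel) \<le> ennreal 16"
  proof (cases "\<nu> < 0")
    case True
    then have \<nu>: "0 < (- \<nu> / 2) powr (1/3)" by simp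
    have "?k * (\<integral>\<^sup>+T. ?c T \<partial>lborel) \<le> ?k * ennreal (8 * ((- \<nu> / 2) powr (1/3)) powr (- 1/4))"
      by (intro mult_left_mono nn_integral_powr_shift \<nu>) auto
    also have "\<dots> = ennreal (8 * ((- \<nu> * 2) powr (1/12) * (- \<nu> * (1/2)) powr (- 1/12)))"
      using True by (simp add: powr_powr mult.commute flip: ennreal_mult')
    also have "(- \<nu> * 2) powr (1/12) * (- \<nu> * (1/2)) powr (- 1/12)
        = ((- \<nu>) powr (1/12) * (- \<nu>) powr (- 1/12)) * (2 powr (1/12) * (1/2) powr (- 1/12))"
      using True by (simp only: powr_mult [of "- \<nu>"] mult_ac)
    also have "(- \<nu>) powr (1/12) * (- \<nu>) powr (- 1/12) = 1"
      using True by (simp flip: powr_add)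
    also have "(1/2) powr (- 1/12) = (2 :: real) powr (1/12)"
      using powr_minus_divide [of "1/2 :: real" "1/12"] by (simp add: powr_divide)
    also have "2 powr (1/12) * 2 powr (1/12) = (2 :: real) powr (1/6)"
      unfolding powr_add [symmetric] by simp
    also have "ennreal (8 * (1 * 2 powr (1/6))) \<le> ennreal (8 * 2 powr 1)"
      using powr_mono [of "1/6" 1 "2 :: real"] by (intro ennreal_leI) simp
    finally show ?thesis by simp
  qed simp
  have "(\<integral>\<^sup>+T. ennreal (\<phi> \<nu> T) * indicator {0<..} T \<partial>lborel) \<le> (\<integral>\<^sup>+T. ?a T + 4 * ?b T + ?k * ?c T \<partial>lborel)"
  proof (intro nn_integral_mono)
    fix T :: real
    show "ennreal (\<phi> \<nu> T) * indicator {0<..} T \<le> ?a T + 4 * ?b T + ?k * ?c T"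
    proof (cases "0 < T")
      case True
      have "ennreal (\<phi> \<nu> T) \<le> ennreal (T powr (- 1/3) * indicator {0..1} T + 4 * T powr (- 7/6) * indicator {1..} T
        + (- 2 * \<nu>) powr (1/12) * (\<bar>T + \<nu>\<bar> + (- \<nu> / 2) powr (1/3)) powr (- 5/4) * indicator {..<0} \<nu>)"
        by (rule ennreal_leI [OF \<phi>_bound [OF True]])
      also have "\<dots> = ?a T + 4 * ?b T + ?k * ?c T"
        by (simp add: ennreal_plus ennreal_mult mult_ac indicator_def)
      finally show ?thesis using True by simp
    qed simp
  qed
  also have "\<dots> = (\<integral>\<^sup>+T. ?a T \<partial>lborel) + 4 * (\<integral>\<^sup>+T. ?b T \<partial>lborel) + ?k * (\<integral>\<^sup>+T. ?c T \<partial>lborel)"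
    by (simp add: nn_integral_add nn_integral_cmult)
  also have "\<dots> \<le> ennreal (3/2) + 4 * ennreal 6 + ennreal 16"
    unfolding a b by (intro add_left_mono c)
  also have "\<dots> = ennreal (3/2 + 4 * 6 + 16)"
  proof -
    have "4 * ennreal 6 = ennreal (4 * 6)"
      by (subst ennreal_numeral [symmetric], subst ennreal_mult [symmetric]) auto
    moreover have "ennreal (3/2) + ennreal (4 * 6) + ennreal 16 = ennreal (3/2 + 4 * 6 + 16)"
      by (simp only: ennreal_plus [symmetric] zero_le_numeral zero_le_divide_iff zero_le_mult_iff add_nonneg_nonneg simp_thms)
    ultimately show ?thesis by simp
  qed
  also have "\<dots> \<le> 50"
    unfolding ennreal_numeral [symmetric] by (intro ennreal_leI) simp
  finally show ?thesis .
qed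

section \<open>Size of \<omega> and integrability of its inverse\<close>

lemma AE_rst_mem: "A \<in> sets borel \<Longrightarrow> AE x in rst A. x \<in> A"
  by (simp add: AE_rst)

lemma AE_torus_nonzero: "AE \<xi> :: real ^ 'n in rst torus. \<forall>j. \<xi> $ j \<noteq> 0"
proof -
  have "AE \<xi> :: real ^ 'n in lborel. \<xi> $ j \<noteq> 0" for j
  proof (rule AE_I')
    have "negligible {\<xi> :: real ^ 'n. \<xi> $ j = 0}" by (rule negligible_standard_hyperplane_cart)
    then show "{\<xi> :: real ^ 'n. \<xi> $ j = 0} \<in> null_sets lborel"
      by (simp add: negligible_iff_null_sets null_sets_completion_iff)
  qed auto
  then have "AE \<xi> :: real ^ 'n in lborel. \<forall>j. \<xi> $ j \<noteq> 0" by (simp add: AE_all_countable)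
  then show ?thesis
    unfolding AE_rst [OF torus_borel] by (rule eventually_mono) simp
qed

lemma two_minus_two_cos_ge:
  assumes "x \<in> {-pi..pi}" shows "(\<bar>x\<bar> / 2)\<^sup>2 \<le> 2 - 2 * cos x"
proof -
  have "\<bar>x\<bar> / 2 / 2 \<le> sin (\<bar>x\<bar> / 2)" using assms by (intro sin_ge_half) auto
  then have "(\<bar>x\<bar> / 2 / 2)\<^sup>2 \<le> (sin (\<bar>x\<bar> / 2))\<^sup>2" by (intro power_mono) auto
  moreover have "cos x = 1 - 2 * (sin (\<bar>x\<bar> / 2))\<^sup>2"
    using cos_double_sin [of "\<bar>x\<bar> / 2"] by simp
  ultimately show ?thesis by (simp add: power_divide)
qed

lemma \<omega>_square: "(\<omega> \<xi>)\<^sup>2 = (\<Sum>j\<in>UNIV. 2 - 2 * cos (\<xi> $ j))"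
  unfolding \<omega>_def by (intro real_sqrt_pow2 sum_nonneg) simp

lemma \<omega>_nonneg [simp]: "0 \<le> \<omega> \<xi>"
  unfolding \<omega>_def by (intro real_sqrt_ge_zero sum_nonneg) simp

lemma \<omega>_le: "\<omega> (\<xi> :: real ^ 'n) \<le> sqrt (4 * CARD('n))"
proof -
  have "(\<Sum>j\<in>UNIV. 2 - 2 * cos (\<xi> $ j)) \<le> (\<Sum>j\<in>(UNIV :: 'n set). 4)"
    by (intro sum_mono) (use cos_ge_minus_one in \<open>smt (verit)\<close>)
  then show ?thesis unfolding \<omega>_def by (intro real_sqrt_le_mono) simp
qed

lemma \<omega>_ge:
  assumes "\<xi> \<in> torus" shows "\<bar>\<xi> $ j\<bar> / 2 \<le> \<omega> \<xi>"
proof (rule power2_le_imp_le)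
  have "(\<bar>\<xi> $ j\<bar> / 2)\<^sup>2 \<le> 2 - 2 * cos (\<xi> $ j)"
    using two_minus_two_cos_ge [of "\<xi> $ j"] assms by (simp add: mem_torus)
  also have "\<dots> \<le> (\<Sum>j\<in>UNIV. 2 - 2 * cos (\<xi> $ j))"
    by (rule member_le_sum) auto
  finally show "(\<bar>\<xi> $ j\<bar> / 2)\<^sup>2 \<le> (\<omega> \<xi>)\<^sup>2" by (simp add: \<omega>_square)
qed simp

lemma integrable_powr_interval:
  fixes a :: real
  assumes "- 1 < a"
  shows "integrable (rst {-pi..pi}) (\<lambda>x. \<bar>x\<bar> powr a)"
proof -
  have "((\<lambda>x. \<bar>x\<bar> powr a) has_integral pi powr (a + 1) / (a + 1)) {0..pi}"
    using has_integral_powr_from_0 [OF assms, of pi] by (rule has_integral_eq [rotated]) auto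
  moreover have "((\<lambda>x. \<bar>x\<bar> powr a) has_integral pi powr (a + 1) / (a + 1)) {-pi..0}"
    using calculation has_integral_reflect_real [of "\<lambda>x. \<bar>x\<bar> powr a" _ pi 0] by simp
  ultimately have "(\<lambda>x. \<bar>x\<bar> powr a) integrable_on {-pi..pi}"
    using has_integral_combine [of "-pi" 0 pi "\<lambda>x. \<bar>x\<bar> powr a"] by fastforce
  then have "(\<lambda>x. \<bar>x\<bar> powr a) absolutely_integrable_on {-pi..pi}"
    by (intro nonnegative_absolutely_integrable_1) auto
  then show ?thesis
    by (subst integrable_rst) (simp_all add: set_integrable_def integrable_completion)
qed

text \<open>Since \<open>2 * \<omega> \<xi>\<close> dominates every coordinate, its inverse is at
  most the product of the powers |\<xi>_j|^(-1/d). Each exponent exceeds -1, so the majorant is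
  integrable coordinate by coordinate.\<close>

lemma integrable_inverse_\<omega>: 
  assumes "2 \<le> CARD('n)"
  shows "integrable (rst torus) (\<lambda>\<xi> :: real ^ 'n. 1 / \<omega> \<xi>)"
proof -
  define a where "a = - 1 / real CARD('n)"
  have a: "- 1 < a" using assms by (simp add: a_def)
  let ?g = "\<lambda>\<xi> :: real ^ 'n. \<Prod>j\<in>UNIV. \<bar>\<xi> $ j\<bar> powr a"
  have "integrable (rst torus) ?g"
    by (intro integrable_prod_torus integrable_powr_interval a)
  then have "integrable (rst torus) (\<lambda>\<xi>. 2 * ?g \<xi>)" by simp
  then show ?thesis
  proof (rule Bochner_Integration.integrable_bound)
    show "AE \<xi> in rst torus. norm (1 / \<omega> \<xi>) \<le> norm (2 * ?g \<xi>)"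
      using AE_torus_nonzero AE_rst_mem [OF torus_borel]
    proof eventually_elim
      fix \<xi> :: "real ^ 'n" assume nz: "\<forall>j. \<xi> $ j \<noteq> 0" and t: "\<xi> \<in> torus"
      define w where "w = 2 * \<omega> \<xi>"
      have le: "\<bar>\<xi> $ j\<bar> \<le> w" for j
        using \<omega>_ge [OF t, of j] by (simp add: w_def field_simps)
      have w: "0 < w" using le nz by (metis zero_less_abs_iff less_le_trans)
      have "(\<Prod>j\<in>(UNIV :: 'n set). w powr a) \<le> ?g \<xi>"
        using le nz a assms by (intro prod_mono conjI powr_mono2') (auto simp: a_def)
      also have "(\<Prod>j\<in>(UNIV :: 'n set). w powr a) = w powr (- 1)"
        using w by (simp add: powr_power a_def)
      finally have "1 / w \<le> ?g \<xi>" using w by (simp add: powr_minus divide_inverse)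
      then have "2 * (1 / w) \<le> 2 * ?g \<xi>" by (intro mult_left_mono) auto
      moreover have "2 * (1 / w) = 1 / \<omega> \<xi>" by (simp add: w_def)
      moreover have "0 \<le> ?g \<xi>" by (intro prod_nonneg) auto
      ultimately show "norm (1 / \<omega> \<xi>) \<le> norm (2 * ?g \<xi>)" by simp
    qed
  qed simp
qed

section \<open>Subordination under the Fourier transform\<close>

lemma exp_phase: "exp (\<i> * of_real (phase x \<xi>)) = (\<Prod>j\<in>UNIV. exp (\<i> * of_int (x $ j) * of_real (\<xi> $ j)))"
  by (simp add: phase_def sum_distrib_left exp_sum [symmetric] mult.assoc)

lemma integral_exp_kernel:
  "(\<integral>\<xi>. exp (\<i> * of_real (phase x \<xi>)) * exp (- z * of_real ((\<omega> \<xi>)\<^sup>2 * s)) \<partial>rst torus)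
    = (\<Prod>j\<in>UNIV. kernel z (x $ j) s)"
proof -
  have "exp (- z * of_real ((\<omega> \<xi>)\<^sup>2 * s)) = (\<Prod>j\<in>UNIV. exp (- z * of_real (s * (2 - 2 * cos (\<xi> $ j)))))" for \<xi> :: "real ^ 'a"
    unfolding \<omega>_square exp_sum [OF finite, symmetric] of_real_sum sum_distrib_right sum_distrib_left
    by (simp add: mult.commute)
  then have "(\<integral>\<xi>. exp (\<i> * of_real (phase x \<xi>)) * exp (- z * of_real ((\<omega> \<xi>)\<^sup>2 * s)) \<partial>rst torus)
    = (\<integral>\<xi>. (\<Prod>j\<in>UNIV. exp (\<i> * of_int (x $ j) * of_real (\<xi> $ j)) * exp (- z * of_real (s * (2 - 2 * cos (\<xi> $ j))))) \<partial>rst torus)"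
    by (simp add: exp_phase prod.distrib)
  also have "\<dots> = (\<Prod>j\<in>UNIV. kernel z (x $ j) s)"
    unfolding kernel_def
  proof (rule integral_prod_torus)
    fix j
    let ?f = "\<lambda>y :: real. exp (\<i> * of_int (x $ j) * of_real y) * exp (- z * of_real (s * (2 - 2 * cos y)))"
    have cont: "continuous_on {-pi..pi} ?f" by (intro continuous_intros)
    then show "integrable (rst {-pi..pi}) ?f"
      by (subst integrable_rst) (auto intro: borel_integrable_atLeastAtMost')
  qed
  finally show ?thesis .
qed

text \<open>Subordination is inserted pointwise and the integrals are exchanged. For absolute
  integrability, the norm of the integrand at \<open>z\<close> is the integrand at
  \<open>Re z\<close>, so subordination itself evaluates its s-integral, and what remains is a
  multiple of 1 / \<omega>.\<close>

lemma FT_exp_\<omega>: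
  fixes x :: "int ^ 'n"
  assumes z: "0 < Re z" and d: "2 \<le> CARD('n)"
  shows "gauss z * FT (\<lambda>\<xi>. exp (- z * of_real (\<omega> \<xi>)) / of_real (\<omega> \<xi>)) x
    = (\<integral>s. of_real (s powr (- 1/2)) * exp (- z / of_real (4 * s)) * (\<Prod>j\<in>UNIV. kernel z (x $ j) s) \<partial>rst {0<..})"
proof -
  interpret t: sigma_finite_measure "rst (torus :: (real ^ 'n) set)" by (rule sigma_finite_rst) simp
  interpret h: sigma_finite_measure "rst {0 :: real<..}" by (rule sigma_finite_rst) simp
  interpret p: pair_sigma_finite "rst (torus :: (real ^ 'n) set)" "rst {0 :: real<..}" ..
  define f where "f = (\<lambda>(z :: complex) (\<mu> :: real) (s :: real). of_real (s powr (- 1/2)) * exp (- z * of_real (\<mu>\<^sup>2 * s + 1 / (4 * s))))"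
  define F where "F = (\<lambda>(\<xi> :: real ^ 'n) s. exp (\<i> * of_real (phase x \<xi>)) * f z (\<omega> \<xi>) s)"
  have AE_\<omega>: "AE \<xi> :: real ^ 'n in rst torus. 0 < \<omega> \<xi>"
    using AE_torus_nonzero AE_rst_mem [OF torus_borel]
  proof eventually_elim
    fix \<xi> :: "real ^ 'n" and j :: 'n assume nz: "\<forall>j. \<xi> $ j \<noteq> 0" and t: "\<xi> \<in> torus"
    have "0 < \<bar>\<xi> $ undefined\<bar> / 2" using nz by simp
    also have "\<dots> \<le> \<omega> \<xi>" by (rule \<omega>_ge [OF t])
    finally show "0 < \<omega> \<xi>" .
  qed
  have norm_f: "of_real (norm (f z \<mu> s)) = f (of_real (Re z)) \<mu> s" for \<mu> s
  proof -
    have "norm (f z \<mu> s) = s powr (- 1/2) * exp (- Re z * (\<mu>\<^sup>2 * s + 1 / (4 * s)))"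
      unfolding f_def norm_mult norm_exp_eq_Re by simp
    then show ?thesis unfolding f_def by (simp flip: exp_of_real)
  qed
  have [measurable]: "case_prod F \<in> borel_measurable (rst torus \<Otimes>\<^sub>M rst {0<..})"
    unfolding F_def f_def by measurable
  have int: "integrable (rst torus \<Otimes>\<^sub>M rst {0<..}) (case_prod F)"
  proof (rule p.Fubini_integrable)
    let ?C = "norm (gauss (of_real (Re z)))"
    have "integrable (rst torus) (\<lambda>\<xi> :: real ^ 'n. ?C * (1 / \<omega> \<xi>))"
      using integrable_inverse_\<omega> [OF d] by (intro integrable_mult_right)
    then show "integrable (rst torus) (\<lambda>\<xi>. \<integral>s. norm (case_prod F (\<xi>, s)) \<partial>rst {0<..})"
    proof (rule Bochner_Integration.integrable_bound)
      show "AE \<xi> in rst torus. norm (\<integral>s. norm (case_prod F (\<xi>, s)) \<partial>rst {0<..}) \<le> norm (?C * (1 / \<omega> \<xi>))"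
        using AE_\<omega>
      proof eventually_elim
        fix \<xi> :: "real ^ 'n" assume w: "0 < \<omega> \<xi>"
        have "(\<integral>s. norm (case_prod F (\<xi>, s)) \<partial>rst {0<..}) = (\<integral>s. norm (f z (\<omega> \<xi>) s) \<partial>rst {0<..})"
          by (simp add: F_def norm_mult)
        then have "norm (\<integral>s. norm (case_prod F (\<xi>, s)) \<partial>rst {0<..})
            = norm (of_real (\<integral>s. norm (f z (\<omega> \<xi>) s) \<partial>rst {0<..}) :: complex)"
          by (simp only: norm_of_real real_norm_def)
        also have "(of_real (\<integral>s. norm (f z (\<omega> \<xi>) s) \<partial>rst {0<..}) :: complex)
          = (\<integral>s. f (of_real (Re z)) (\<omega> \<xi>) s \<partial>rst {0<..})"
          by (simp only: integral_complex_of_real [symmetric] norm_f)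
        also have "\<dots> = gauss (of_real (Re z)) * exp (- of_real (Re z) * of_real (\<omega> \<xi>)) / of_real (\<omega> \<xi>)"
          unfolding f_def using z by (intro subordination w) simp
        also have "norm \<dots> \<le> ?C * (1 / \<omega> \<xi>)"
          using z w by (simp add: norm_mult norm_divide divide_right_mono mult_left_le)
        also have "\<dots> \<le> norm (?C * (1 / \<omega> \<xi>))" by simp
        finally show "norm (\<integral>s. norm (case_prod F (\<xi>, s)) \<partial>rst {0<..}) \<le> norm (?C * (1 / \<omega> \<xi>))" .
      qed
    qed measurable
    show "AE \<xi> in rst torus. integrable (rst {0<..}) (\<lambda>s. case_prod F (\<xi>, s))"
      using AE_\<omega>
    proof eventually_elim
      fix \<xi> :: "real ^ 'n" assume "0 < \<omega> \<xi>"
      then show "integrable (rst {0<..}) (\<lambda>s. case_prod F (\<xi>, s))"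
        unfolding F_def prod.case f_def using z by (intro integrable_mult_right subordination)
    qed
  qed simp
  have "gauss z * FT (\<lambda>\<xi>. exp (- z * of_real (\<omega> \<xi>)) / of_real (\<omega> \<xi>)) x
      = (\<integral>\<xi>. gauss z * (exp (\<i> * of_real (phase x \<xi>)) * (exp (- z * of_real (\<omega> \<xi>)) / of_real (\<omega> \<xi>))) \<partial>rst torus)"
    unfolding FT_def by (rule integral_mult_right_zero [symmetric])
  also have "\<dots> = (\<integral>\<xi>. (\<integral>s. F \<xi> s \<partial>rst {0<..}) \<partial>rst torus)"
  proof (rule integral_cong_AE)
    show "AE \<xi> in rst torus. gauss z * (exp (\<i> * of_real (phase x \<xi>)) * (exp (- z * of_real (\<omega> \<xi>)) / of_real (\<omega> \<xi>)))
        = (\<integral>s. F \<xi> s \<partial>rst {0<..})"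
      using AE_\<omega>
    proof eventually_elim
      fix \<xi> :: "real ^ 'n" assume w: "0 < \<omega> \<xi>"
      show "gauss z * (exp (\<i> * of_real (phase x \<xi>)) * (exp (- z * of_real (\<omega> \<xi>)) / of_real (\<omega> \<xi>)))
        = (\<integral>s. F \<xi> s \<partial>rst {0<..})"
        unfolding F_def f_def integral_mult_right_zero subordination(2) [OF w z] by simp
    qed
  qed measurable
  also have "\<dots> = (\<integral>s. (\<integral>\<xi>. F \<xi> s \<partial>rst torus) \<partial>rst {0<..})"
    by (rule p.Fubini_integral [symmetric]) (rule int)
  also have "\<dots> = (\<integral>s. of_real (s powr (- 1/2)) * exp (- z / of_real (4 * s)) * (\<Prod>j\<in>UNIV. kernel z (x $ j) s) \<partial>rst {0<..})"
  proof (rule Bochner_Integration.integral_cong [OF refl])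
    fix s :: real
    have "F \<xi> s = (of_real (s powr (- 1/2)) * exp (- z / of_real (4 * s)))
       * (exp (\<i> * of_real (phase x \<xi>)) * exp (- z * of_real ((\<omega> \<xi>)\<^sup>2 * s)))" for \<xi>
      unfolding F_def f_def by (simp add: ring_distribs exp_diff exp_minus field_simps)
    then have "(\<integral>\<xi>. F \<xi> s \<partial>rst torus) = (of_real (s powr (- 1/2)) * exp (- z / of_real (4 * s)))
       * (\<integral>\<xi>. exp (\<i> * of_real (phase x \<xi>)) * exp (- z * of_real ((\<omega> \<xi>)\<^sup>2 * s)) \<partial>rst torus)"
      by simp
    then show "(\<integral>\<xi>. F \<xi> s \<partial>rst torus)
      = of_real (s powr (- 1/2)) * exp (- z / of_real (4 * s)) * (\<Prod>j\<in>UNIV. kernel z (x $ j) s)"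
      by (simp only: integral_exp_kernel)
  qed
  finally show ?thesis .
qed


section \<open>Estimate of the subordination integral\<close>

lemma powr_exp_bound:
  fixes u e c :: real
  assumes "0 < u" "0 < e" "0 < c"
  shows "u powr e * exp (- c * u) \<le> (e / c) powr e"
proof -
  \<comment> \<open>The whole bound is x \<le> exp x at x = c u / e, raised to the power e.\<close>
  have "c * u / e \<le> exp (c * u / e)" using exp_ge_add_one_self [of "c * u / e"] by linarith
  then have "u \<le> e / c * exp (c * u / e)" using assms by (simp add: field_simps)
  then have "u powr e \<le> (e / c * exp (c * u / e)) powr e"
    using assms by (intro powr_mono2) auto
  also have "\<dots> = (e / c) powr e * exp (c * u / e) powr e"
    by (rule powr_mult)
  also have "exp (c * u / e) powr e = exp (c * u)"
    using assms by (simp add: exp_powr_real)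
  finally have "u powr e * exp (- c * u) \<le> ((e / c) powr e * exp (c * u)) * exp (- c * u)"
    by (intro mult_right_mono) auto
  also have "\<dots> = (e / c) powr e" by (simp add: mult.assoc mult_exp_exp)
  finally show ?thesis .
qed

lemma \<beta>_nonneg: "0 \<le> \<beta> \<nu> T"
  by (simp add: \<beta>_def)

text \<open>Five factors are kept together as T^(-4/3) times the integrable profile
  \<open>\<phi>\<close>; each of the other d - 5 is estimated by T^(-1/3).\<close>

lemma \<beta>_power_le:
  assumes T: "0 < T" and d: "5 \<le> d"
  shows "\<beta> \<nu> T ^ d \<le> T powr (- (real d - 1) / 3) * \<phi> \<nu> T"
proof -
  let ?b = "\<bar>T + \<nu>\<bar> + T powr (1/3)"
  have p: "0 < T powr (1/3)" using T by simp
  then have b: "0 < ?b" "T powr (1/3) \<le> ?b" by linarith+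
  have "\<beta> \<nu> T \<le> T powr (- 1/4) * (T powr (1/3)) powr (- 1/4)"
    unfolding \<beta>_def using p b by (intro mult_left_mono powr_mono2') auto
  also have "\<dots> = T powr (- 1/3)" by (simp add: powr_powr flip: powr_add)
  finally have 1: "\<beta> \<nu> T \<le> T powr (- 1/3)" .
  have "\<beta> \<nu> T ^ 5 = T powr (- 5/4) * ?b powr (- 5/4)"
    unfolding \<beta>_def power_mult_distrib using T b by (simp add: powr_power)
  also have "T powr (- 5/4) = T powr (- 4/3) * T powr (1/12)" by (simp flip: powr_add)
  finally have 2: "\<beta> \<nu> T ^ 5 = T powr (- 4/3) * \<phi> \<nu> T" by (simp add: \<phi>_def mult.assoc)
  have "\<beta> \<nu> T ^ d = \<beta> \<nu> T ^ (d - 5) * \<beta> \<nu> T ^ 5"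
    using d by (simp flip: power_add)
  also have "\<dots> \<le> (T powr (- 1/3)) ^ (d - 5) * \<beta> \<nu> T ^ 5"
    using 1 \<beta>_nonneg by (intro mult_right_mono power_mono) auto
  also have "(T powr (- 1/3)) ^ (d - 5) = T powr (- (real d - 5) / 3)"
  proof -
    have "(T powr (- 1/3)) ^ (d - 5) = T powr ((- 1/3) * real (d - 5))"
      using T by (simp add: powr_power mult.commute)
    also have "(- 1/3) * real (d - 5) = - (real d - 5) / 3"
      using d by (simp add: of_nat_diff field_simps)
    finally show ?thesis .
  qed
  also have "T powr (- (real d - 5) / 3) * \<beta> \<nu> T ^ 5 = (T powr (- (real d - 5) / 3) * T powr (- 4/3)) * \<phi> \<nu> T"
    unfolding 2 by (simp only: mult.assoc)
  also have "T powr (- (real d - 5) / 3) * T powr (- 4/3) = T powr (- (real d - 1) / 3)"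
    unfolding powr_add [symmetric] by (rule arg_cong [where f = "(powr) T"]) (simp add: field_simps)
  finally show ?thesis .
qed

lemma power_add_le:
  fixes x y :: real
  assumes "0 \<le> x" "0 \<le> y"
  shows "(x + y) ^ n \<le> 2 ^ n * (x ^ n + y ^ n)"
proof -
  have "(x + y) ^ n \<le> (2 * max x y) ^ n" using assms by (intro power_mono) auto
  also have "\<dots> = 2 ^ n * (max x y) ^ n" by (rule power_mult_distrib)
  also have "(max x y) ^ n \<le> x ^ n + y ^ n" using assms by (simp add: max_def)
  finally show ?thesis by simp
qed

text \<open>Passing to the largest factor decouples the coordinates, so that each integral in s
  involves a single order \<open>\<nu>\<close>.\<close>

lemma prod_le_sum_power:
  fixes f :: "'n::finite \<Rightarrow> real"
  assumes "\<And>j. 0 \<le> f j"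
  shows "(\<Prod>j\<in>UNIV. f j) \<le> (\<Sum>j\<in>UNIV. f j ^ CARD('n))"
proof -
  have "Max (range f) \<in> range f" by (rule Max_in) auto
  then obtain k where k: "Max (range f) = f k" by blast
  have "(\<Prod>j\<in>UNIV. f j) \<le> (\<Prod>j\<in>(UNIV :: 'n set). f k)"
    using assms by (intro prod_mono) (auto simp flip: k)
  also have "\<dots> = f k ^ CARD('n)" by simp
  also have "\<dots> \<le> (\<Sum>j\<in>UNIV. f j ^ CARD('n))"
    by (rule member_le_sum) (auto simp: assms)
  finally show ?thesis .
qed

lemma nn_integral_\<phi>_scaled:
  assumes t: "0 < t"
  shows "(\<integral>\<^sup>+s. ennreal (\<phi> \<nu> (2 * t * s)) \<partial>rst {0<..}) \<le> ennreal (25 / t)"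
proof -
  have "ennreal (2 * t) * (\<integral>\<^sup>+s. ennreal (\<phi> \<nu> (2 * t * s)) \<partial>rst {0<..})
      = ennreal (2 * t) * (\<integral>\<^sup>+s. ennreal (\<phi> \<nu> (0 + 2 * t * s)) * indicator {0<..} (0 + 2 * t * s) \<partial>lborel)"
  proof -
    have "(\<integral>\<^sup>+s. ennreal (\<phi> \<nu> (2 * t * s)) \<partial>rst {0<..})
      = (\<integral>\<^sup>+s. ennreal (indicator {0<..} s) * ennreal (\<phi> \<nu> (2 * t * s)) \<partial>lborel)"
      unfolding rst_def by (rule nn_integral_density) auto
    also have "\<dots> = (\<integral>\<^sup>+s. ennreal (\<phi> \<nu> (0 + 2 * t * s)) * indicator {0<..} (0 + 2 * t * s) \<partial>lborel)"
      using t by (intro nn_integral_cong) (auto simp: indicator_def zero_less_mult_iff)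
    finally show ?thesis by simp
  qed
  also have "\<dots> = (\<integral>\<^sup>+T. ennreal (\<phi> \<nu> T) * indicator {0<..} T \<partial>lborel)"
    using t by (subst nn_integral_real_affine [of _ "2 * t" 0]) auto
  also have "\<dots> \<le> 50" by (rule nn_integral_\<phi>)
  finally have "ennreal (1 / (2 * t)) * (ennreal (2 * t) * (\<integral>\<^sup>+s. ennreal (\<phi> \<nu> (2 * t * s)) \<partial>rst {0<..}))
      \<le> ennreal (1 / (2 * t)) * 50"
    by (rule mult_left_mono) simp
  moreover have "ennreal (1 / (2 * t)) * ennreal (2 * t) = 1"
    using t by (simp flip: ennreal_mult ennreal_1)
  moreover have "ennreal (1 / (2 * t)) * 50 = ennreal (25 / t)"
    using t unfolding ennreal_numeral [symmetric] by (subst ennreal_mult [symmetric]) auto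
  ultimately show ?thesis by (simp flip: mult.assoc)
qed

text \<open>The powers s^(-1/2) and s^(-(d-1)/3) combine to \<open>(1 / s) powr e\<close>, which
  \<open>exp (- a / (4 s))\<close> turns into the constant \<open>(e / (a / 4)) powr e\<close>. Only
  \<open>\<phi>\<close> at 2 t s is left under the integral, and it yields \<open>25 / t\<close> per
  sign and coordinate.\<close>

lemma nn_integral_kernel_bound:
  fixes x :: "int ^ 'n"
  assumes a: "0 < a" and t: "0 < t" and d: "5 \<le> CARD('n)"
  defines "e \<equiv> 1/2 + (real CARD('n) - 1) / 3"
  defines "C \<equiv> 896 ^ CARD('n) * (e / (a / 4)) powr e"
  shows "(\<integral>\<^sup>+s. ennreal (norm (of_real (s powr (- 1/2)) * exp (- Complex a (- t) / of_real (4 * s))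
        * (\<Prod>j\<in>UNIV. kernel (Complex a (- t)) (x $ j) s))) \<partial>rst {0<..})
    \<le> ennreal (C * 50 * real CARD('n) * t powr (- (real CARD('n) - 1) / 3 - 1))"
proof -
  let ?d = "CARD('n)"
  let ?J = "\<lambda>s. norm (of_real (s powr (- 1/2)) * exp (- Complex a (- t) / of_real (4 * s))
        * (\<Prod>j\<in>UNIV. kernel (Complex a (- t)) (x $ j) s))"
  let ?p = "(real ?d - 1) / 3"
  have e: "0 < e" using d by (simp add: e_def add_pos_nonneg)
  have C: "0 \<le> C" by (simp add: C_def)
  have pw: "?J s
      \<le> C * t powr (- ?p) * (\<Sum>j\<in>UNIV. \<phi> (of_int (x $ j)) (2 * t * s) + \<phi> (- of_int (x $ j)) (2 * t * s))"
    if s: "0 < s" for s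
  proof -
    define T where "T = 2 * t * s"
    have T: "0 < T" using s t by (simp add: T_def)
    define S where "S = (\<Sum>j\<in>UNIV. \<phi> (of_int (x $ j)) T + \<phi> (- of_int (x $ j)) T)"
    have S: "0 \<le> S" unfolding S_def by (intro sum_nonneg add_nonneg_nonneg) auto
    have K: "norm (kernel (Complex a (- t)) n s) ^ ?d
        \<le> 896 ^ ?d * T powr (- ?p) * (\<phi> (of_int n) T + \<phi> (- of_int n) T)" for n
    proof -
      have "norm (kernel (Complex a (- t)) n s) ^ ?d \<le> (448 * (\<beta> (of_int n) T + \<beta> (- of_int n) T)) ^ ?d"
        unfolding T_def using a t s by (intro power_mono kernel_bound) auto
      also have "\<dots> = 448 ^ ?d * (\<beta> (of_int n) T + \<beta> (- of_int n) T) ^ ?d"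
        by (rule power_mult_distrib)
      also have "\<dots> \<le> 448 ^ ?d * (2 ^ ?d * (\<beta> (of_int n) T ^ ?d + \<beta> (- of_int n) T ^ ?d))"
        by (intro mult_left_mono power_add_le \<beta>_nonneg) auto
      also have "\<dots> \<le> 448 ^ ?d * (2 ^ ?d * (T powr (- ?p) * \<phi> (of_int n) T + T powr (- ?p) * \<phi> (- of_int n) T))"
        using \<beta>_power_le [OF T d] by (intro mult_left_mono add_mono) (auto simp: minus_divide_left)
      also have "\<dots> = (448 ^ ?d * 2 ^ ?d) * T powr (- ?p) * (\<phi> (of_int n) T + \<phi> (- of_int n) T)"
        by (simp only: ring_distribs mult.assoc)
      also have "448 ^ ?d * 2 ^ ?d = (896 :: real) ^ ?d" by (simp flip: power_mult_distrib)
      finally show ?thesis .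
    qed
    have exps: "norm (exp (- Complex a (- t) / of_real (4 * s))) = exp (- (a / 4) * (1 / s))"
      by (simp add: Re_divide_of_real)
    have "norm (\<Prod>j\<in>UNIV. kernel (Complex a (- t)) (x $ j) s)
        \<le> (\<Sum>j\<in>UNIV. norm (kernel (Complex a (- t)) (x $ j) s) ^ ?d)"
      unfolding prod_norm [symmetric] by (rule prod_le_sum_power) simp
    also have "\<dots> \<le> (\<Sum>j\<in>UNIV. 896 ^ ?d * T powr (- ?p) * (\<phi> (of_int (x $ j)) T + \<phi> (- of_int (x $ j)) T))"
      by (intro sum_mono K)
    also have "\<dots> = 896 ^ ?d * T powr (- ?p) * S"
      by (simp only: S_def sum_distrib_left)
    finally have "?J s
      \<le> (s powr (- 1/2) * exp (- (a / 4) * (1 / s))) * (896 ^ ?d * T powr (- ?p) * S)"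
      unfolding norm_mult exps by (intro mult_mono) auto
    also have "T powr (- ?p) = (2 * t) powr (- ?p) * s powr (- ?p)"
      unfolding T_def using s t by (simp add: powr_mult)
    also have "(s powr (- 1/2) * exp (- (a / 4) * (1 / s))) * (896 ^ ?d * ((2 * t) powr (- ?p) * s powr (- ?p)) * S)
      = ((s powr (- 1/2) * s powr (- ?p)) * exp (- (a / 4) * (1 / s))) * (896 ^ ?d * (2 * t) powr (- ?p) * S)"
      by (simp only: mult_ac)
    also have "s powr (- 1/2) * s powr (- ?p) = (1 / s) powr e"
      using s by (simp add: e_def powr_divide powr_minus_divide powr_add divide_simps flip: powr_add)
    also have "((1 / s) powr e * exp (- (a / 4) * (1 / s))) * (896 ^ ?d * (2 * t) powr (- ?p) * S)
      \<le> (e / (a / 4)) powr e * (896 ^ ?d * t powr (- ?p) * S)"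
      using s a e t S d by (intro mult_mono mult_right_mono mult_left_mono powr_exp_bound powr_mono2') auto
    also have "\<dots> = C * t powr (- ?p) * S" by (simp add: C_def)
    finally show ?thesis by (simp only: S_def T_def)
  qed
  have "(\<integral>\<^sup>+s. ennreal (?J s) \<partial>rst {0<..})
    \<le> (\<integral>\<^sup>+s. ennreal (C * t powr (- ?p)) * (\<Sum>j\<in>UNIV. ennreal (\<phi> (of_int (x $ j)) (2 * t * s))
        + ennreal (\<phi> (- of_int (x $ j)) (2 * t * s))) \<partial>rst {0<..})"
  proof (intro nn_integral_mono_AE AE_rstI)
    fix s :: real assume "s \<in> {0<..}"
    then have "ennreal (?J s)
      \<le> ennreal (C * t powr (- ?p) * (\<Sum>j\<in>UNIV. \<phi> (of_int (x $ j)) (2 * t * s) + \<phi> (- of_int (x $ j)) (2 * t * s)))"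
      by (intro ennreal_leI pw) simp
    also have "\<dots> = ennreal (C * t powr (- ?p)) * (\<Sum>j\<in>UNIV. ennreal (\<phi> (of_int (x $ j)) (2 * t * s))
        + ennreal (\<phi> (- of_int (x $ j)) (2 * t * s)))"
      using C by (simp add: ennreal_mult' sum_nonneg flip: ennreal_plus sum_ennreal)
    finally show "ennreal (?J s)
      \<le> ennreal (C * t powr (- ?p)) * (\<Sum>j\<in>UNIV. ennreal (\<phi> (of_int (x $ j)) (2 * t * s))
        + ennreal (\<phi> (- of_int (x $ j)) (2 * t * s)))" .
  qed simp
  also have "\<dots> = ennreal (C * t powr (- ?p)) * (\<Sum>j\<in>UNIV.
      (\<integral>\<^sup>+s. ennreal (\<phi> (of_int (x $ j)) (2 * t * s)) \<partial>rst {0<..})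
      + (\<integral>\<^sup>+s. ennreal (\<phi> (- of_int (x $ j)) (2 * t * s)) \<partial>rst {0<..}))"
    by (simp add: nn_integral_cmult nn_integral_sum nn_integral_add)
  also have "\<dots> \<le> ennreal (C * t powr (- ?p)) * (\<Sum>j\<in>(UNIV :: 'n set). ennreal (25 / t) + ennreal (25 / t))"
    by (intro mult_left_mono sum_mono add_mono nn_integral_\<phi>_scaled t) auto
  also have "(\<Sum>j\<in>(UNIV :: 'n set). ennreal (25 / t) + ennreal (25 / t)) = ennreal (real ?d * (50 / t))"
    using t by (simp add: ennreal_of_nat_eq_real_of_nat flip: ennreal_plus ennreal_mult)
  also have "ennreal (C * t powr (- ?p)) * \<dots> = ennreal (C * t powr (- ?p) * (real ?d * (50 / t)))"
    using C t by (subst ennreal_mult) auto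
  also have "C * t powr (- ?p) * (real ?d * (50 / t)) = C * 50 * real ?d * (t powr (- ?p) / t powr 1)"
    using t by simp
  also have "t powr (- ?p) / t powr 1 = t powr (- (real ?d - 1) / 3 - 1)"
    unfolding powr_diff by (simp add: minus_divide_left)
  finally show ?thesis .
qed

text \<open>The squared modulus of \<open>gauss\<close> is \<pi> / |z| with |z| of order t: dividing
  by it loses the factor t^(1/2).\<close>

lemma norm_gauss_ge:
  assumes a: "0 < a" and t: "1 \<le> t"
  shows "1 / norm (gauss (Complex a (- t))) \<le> sqrt (a + 1) * t powr (1/2)"
proof -
  let ?z = "Complex a (- t)"
  have z: "0 < Re ?z" using a by simp
  have n: "norm ?z \<le> (a + 1) * t"
  proof -
    have "a * 1 \<le> a * t" using a t by (intro mult_left_mono) auto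
    moreover have "norm ?z \<le> a + t" using cmod_le [of ?z] a t by simp
    ultimately show ?thesis unfolding distrib_right by linarith
  qed
  have nz: "0 < norm ?z" using z by (metis zero_less_norm_iff zero_complex.simps(1) less_irrefl)
  have "norm (gauss ?z) ^ 2 = pi / norm ?z"
    using arg_cong [OF gauss_square [OF z], of norm] by (simp add: norm_power norm_divide)
  then have "(1 / norm (gauss ?z))\<^sup>2 = norm ?z / pi" by (simp add: power_divide)
  also have "\<dots> \<le> norm ?z / 1" using pi_gt3 by (intro divide_left_mono) auto
  also have "\<dots> \<le> (a + 1) * t" using n by simp
  finally have "1 / norm (gauss ?z) \<le> sqrt ((a + 1) * t)" by (rule real_le_rsqrt)
  then show ?thesis using t by (simp add: real_sqrt_mult powr_half_sqrt)
qed

lemma FT_half_wave_bound: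
  assumes a: "0 < a" and d: "5 \<le> CARD('n)"
  shows "\<exists>D\<ge>0. \<forall>t\<ge>1. \<forall>x :: int ^ 'n.
    norm (FT (\<lambda>\<xi>. exp (- Complex a (- t) * of_real (\<omega> \<xi>)) / of_real (\<omega> \<xi>)) x) \<le> D * t powr (- \<sigma> CARD('n))"
proof -
  let ?d = "CARD('n)"
  define e where "e = 1/2 + (real ?d - 1) / 3"
  define C where "C = 896 ^ ?d * (e / (a / 4)) powr e"
  have C: "0 \<le> C" by (simp add: C_def)
  define D where "D = sqrt (a + 1) * (C * 50 * real ?d)"
  show ?thesis
  proof (intro exI [of _ D] conjI allI impI)
    show "0 \<le> D" using C a by (simp add: D_def)
    fix t :: real and x :: "int ^ 'n" assume t: "1 \<le> t"
    let ?z = "Complex a (- t)"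
    let ?F = "FT (\<lambda>\<xi>. exp (- ?z * of_real (\<omega> \<xi>)) / of_real (\<omega> \<xi>)) x"
    let ?I = "\<lambda>s. of_real (s powr (- 1/2)) * exp (- ?z / of_real (4 * s)) * (\<Prod>j\<in>UNIV. kernel ?z (x $ j) s)"
    have z: "0 < Re ?z" using a by simp
    have "?z \<noteq> 0" using a by (auto simp: complex_eq_iff)
    then have "(gauss ?z)\<^sup>2 \<noteq> 0" unfolding gauss_square [OF z] by simp
    then have g: "0 < norm (gauss ?z)" by simp
    have "ennreal (norm (gauss ?z * ?F)) = ennreal (norm (\<integral>s. ?I s \<partial>rst {0<..}))"
      using d by (subst FT_exp_\<omega> [OF z]) auto
    \<comment> \<open>If \<open>?I\<close> were not integrable, its Bochner integral would be 0 by
      convention and the inequality trivial.\<close>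
    also have "\<dots> \<le> (\<integral>\<^sup>+s. ennreal (norm (?I s)) \<partial>rst {0<..})"
      by (cases "integrable (rst {0<..}) ?I")
        (auto simp: integral_norm_bound_ennreal not_integrable_integral_eq)
    also have "\<dots> \<le> ennreal (C * 50 * real ?d * t powr (- (real ?d - 1) / 3 - 1))"
      unfolding C_def e_def using a t d by (intro nn_integral_kernel_bound) auto
    finally have "norm (gauss ?z * ?F) \<le> C * 50 * real ?d * t powr (- (real ?d - 1) / 3 - 1)"
      using C by (subst (asm) ennreal_le_iff) auto
    then have "norm ?F \<le> (1 / norm (gauss ?z)) * (C * 50 * real ?d * t powr (- (real ?d - 1) / 3 - 1))"
      using g by (simp add: norm_mult field_simps)
    also have "\<dots> \<le> (sqrt (a + 1) * t powr (1/2)) * (C * 50 * real ?d * t powr (- (real ?d - 1) / 3 - 1))"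
      using C by (intro mult_right_mono norm_gauss_ge a t) auto
    also have "\<dots> = D * (t powr (1/2) * t powr (- (real ?d - 1) / 3 - 1))"
      by (simp add: D_def)
    also have "t powr (1/2) * t powr (- (real ?d - 1) / 3 - 1) = t powr (- \<sigma> ?d)"
      unfolding powr_add [symmetric] \<sigma>_def by (rule arg_cong [where f = "(powr) t"]) (simp add: field_simps)
    finally show "norm ?F \<le> D * t powr (- \<sigma> ?d)" .
  qed
qed

section \<open>The upper bound\<close>

text \<open>A shifted cosine is a sum of two characters with coefficients of modulus 1/2.\<close>

lemma wiener_cos: "wiener 1 (\<lambda>\<xi>. of_real (cos (c + phase y \<xi>)))"
proof -
  have "wiener (norm (exp (\<i> * of_real c) / 2) + norm (exp (- \<i> * of_real c) / 2))
    (\<lambda>\<xi>. exp (\<i> * of_real c) / 2 * exp (\<i> * of_real (phase y \<xi>))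
      + exp (- \<i> * of_real c) / 2 * exp (\<i> * of_real (phase (- y) \<xi>)))"
    by (intro wiener_add wiener_char)
  moreover have "norm (exp (\<i> * of_real c) / 2) + norm (exp (- \<i> * of_real c) / 2) = 1"
    using norm_exp_i_times [of c] norm_exp_i_times [of "- c"] by (simp add: norm_divide)
  moreover have "exp (\<i> * of_real c) / 2 * exp (\<i> * of_real (phase y \<xi>))
      + exp (- \<i> * of_real c) / 2 * exp (\<i> * of_real (phase (- y) \<xi>)) = of_real (cos (c + phase y \<xi>))" for \<xi>
    unfolding cos_of_real [symmetric] cos_exp_eq
    by (simp add: phase_uminus ring_distribs exp_add exp_diff exp_minus field_simps)
  ultimately show ?thesis by simp
qed

lemma wiener_sin: "wiener 1 (\<lambda>\<xi>. of_real (sin (c + phase y \<xi>)))"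
proof -
  have "sin (c + phase y \<xi>) = cos ((c - pi / 2) + phase y \<xi>)" for \<xi>
    using sin_cos_eq [of "c + phase y \<xi>"] cos_minus [of "c - pi / 2 + phase y \<xi>"]
    by (simp add: algebra_simps)
  then show ?thesis using wiener_cos [of "c - pi / 2" y] by simp
qed

lemma phase_axis: "phase (axis j 1) \<xi> = \<xi> $ j"
proof -
  have "of_int (axis j 1 $ i) * \<xi> $ i = (if i = j then \<xi> $ i else 0)" for i
    by (simp add: axis_def)
  then show ?thesis by (simp add: phase_def)
qed

lemma wiener_\<omega>_square: "wiener (4 * CARD('n)) (\<lambda>\<xi> :: real ^ 'n. of_real ((\<omega> \<xi>)\<^sup>2))"
proof -
  have "wiener (\<Sum>j\<in>(UNIV :: 'n set). norm (2 :: complex) + norm (- 2 :: complex) * 1)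
      (\<lambda>\<xi>. \<Sum>j\<in>(UNIV :: 'n set). 2 + - 2 * of_real (cos (0 + phase (axis j 1) \<xi>)))"
    by (intro wiener_sum wiener_add wiener_mult wiener_const wiener_cos) auto
  then show ?thesis by (simp add: \<omega>_square phase_axis mult.commute)
qed

lemma wiener_cosh_\<omega>: "\<exists>B\<ge>0. wiener B (\<lambda>\<xi> :: real ^ 'n. of_real (cosh (\<omega> \<xi>)))"
proof -
  define r where "r = sqrt (4 * CARD('n))"
  have r: "0 \<le> r" by (simp add: r_def)
  \<comment> \<open>Only even powers of \<omega> occur, and they are powers of the trigonometric
    polynomial \<omega>^2. The odd terms are kept as zeros so that the series is the standard one
    for \<open>cosh\<close>.\<close>
  define m where "m = (\<lambda>n (\<xi> :: real ^ 'n). complex_of_real (if even n then \<omega> \<xi> ^ n /\<^sub>R fact n else 0))"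
  have m: "wiener (r ^ n / fact n) (m n)" for n
  proof (cases "even n")
    case True
    then obtain k where n: "n = 2 * k" by (elim evenE)
    have eq: "m n = (\<lambda>\<xi>. of_real (1 / fact n) * of_real ((\<omega> \<xi>)\<^sup>2) ^ k)"
      by (auto simp: m_def n power_mult divide_inverse)
    have "wiener (norm (of_real (1 / fact n) :: complex) * (real (4 * CARD('n))) ^ k) (m n)"
      unfolding eq by (intro wiener_mult wiener_const wiener_power wiener_\<omega>_square)
    also have "norm (of_real (1 / fact n) :: complex) * (real (4 * CARD('n))) ^ k = r ^ n / fact n"
      unfolding norm_of_real n r_def power_mult by simp
    finally show ?thesis .
  next
    case False
    then have "m n = (\<lambda>_. 0)" by (simp add: m_def)
    then show ?thesis using r wiener_mono [OF wiener_const [of 0], of "r ^ n / fact n"] by simp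
  qed
  have sums: "(\<lambda>n. r ^ n / fact n) sums exp r"
    using exp_converges [of r] by (simp add: divide_inverse mult.commute)
  have "wiener (exp r) (\<lambda>\<xi> :: real ^ 'n. of_real (cosh (\<omega> \<xi>)))"
  proof (rule wiener_limit [where m = "\<lambda>K \<xi>. \<Sum>n<K. m n \<xi>" and b = "exp r"])
    show "wiener (exp r) (\<lambda>\<xi>. \<Sum>n<K. m n \<xi>)" for K
    proof (rule wiener_mono)
      show "wiener (\<Sum>n<K. r ^ n / fact n) (\<lambda>\<xi>. \<Sum>n<K. m n \<xi>)"
        by (intro wiener_sum m) auto
      show "(\<Sum>n<K. r ^ n / fact n) \<le> exp r"
        using sum_le_suminf [OF sums_summable [OF sums], of "{..<K}"] sums_unique [OF sums] r by simp
    qed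
    fix \<xi> :: "real ^ 'n"
    show "(\<lambda>K. \<Sum>n<K. m n \<xi>) \<longlonglongrightarrow> of_real (cosh (\<omega> \<xi>))"
      using cosh_converges [of "\<omega> \<xi>"] unfolding sums_def m_def of_real_sum [symmetric]
      by (rule tendsto_of_real)
    show "norm (\<Sum>n<K. m n \<xi>) \<le> exp r" for K
    proof -
      have "norm (\<Sum>n<K. m n \<xi>) \<le> (\<Sum>n<K. r ^ n / fact n)"
      proof (intro order_trans [OF norm_sum] sum_mono)
        fix n
        have "\<omega> \<xi> ^ n \<le> r ^ n" unfolding r_def by (intro power_mono \<omega>_le) simp
        then show "norm (m n \<xi>) \<le> r ^ n / fact n"
          using r by (auto simp: m_def norm_power divide_inverse mult.commute norm_mult intro!: mult_left_mono)
      qed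
      also have "\<dots> \<le> exp r"
        using sum_le_suminf [OF sums_summable [OF sums], of "{..<K}"] sums_unique [OF sums] r by simp
      finally show ?thesis .
    qed
    show "(\<lambda>\<xi> :: real ^ 'n. complex_of_real (cosh (\<omega> \<xi>))) \<in> borel_measurable borel"
      unfolding cosh_def by measurable
  qed
  then show ?thesis by (intro exI [of _ "exp r"]) simp
qed

section \<open>Damped waves and removal of the damping\<close>

lemma FT_cnj:
  "FT (\<lambda>\<xi>. cnj (f \<xi>)) x = cnj (FT f (- x))"
proof -
  have "cnj (FT f (- x)) = (\<integral>\<xi>. cnj (exp (\<i> * of_real (phase (- x) \<xi>)) * f \<xi>) \<partial>rst torus)"
    unfolding FT_def by (rule Bochner_Integration.integral_cnj [symmetric])
  then show ?thesis unfolding FT_def by (simp add: phase_uminus exp_cnj)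
qed

lemma FT_diff:
  assumes "integrable (rst torus) f" "integrable (rst torus) g"
  shows "FT (\<lambda>\<xi>. f \<xi> - g \<xi>) x = FT f x - FT g x"
  unfolding FT_def Bochner_Integration.integral_diff [OF integrable_FT [OF assms(1)] integrable_FT [OF assms(2)], symmetric]
  by (simp add: algebra_simps)

lemma FT_cmult: "FT (\<lambda>\<xi>. c * f \<xi>) x = c * FT f x"
  unfolding FT_def integral_mult_right_zero [symmetric] by (simp add: mult_ac)

definition wave :: "real \<Rightarrow> real \<Rightarrow> real ^ 'n \<Rightarrow> complex" where
  "wave a t \<xi> = of_real (exp (- a * \<omega> \<xi>) * (sin (t * \<omega> \<xi>) / \<omega> \<xi>))"

lemma wave_measurable [measurable]: "wave a t \<in> borel_measurable borel"
  unfolding wave_def [abs_def] by measurable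

lemma norm_wave_le: "0 \<le> a \<Longrightarrow> norm (wave a t \<xi>) \<le> \<bar>t\<bar>"
proof -
  assume a: "0 \<le> a"
  have "\<bar>sin (t * \<omega> \<xi>) / \<omega> \<xi>\<bar> \<le> \<bar>t\<bar>"
    using abs_sin_x_le_abs_x [of "t * \<omega> \<xi>"] \<omega>_nonneg [of \<xi>]
    by (cases "\<omega> \<xi> = 0") (auto simp: abs_mult pos_divide_le_eq less_le)
  moreover have "exp (- a * \<omega> \<xi>) \<le> 1" using a by simp
  ultimately show ?thesis unfolding wave_def norm_of_real abs_mult
    using mult_mono [of "\<bar>exp (- a * \<omega> \<xi>)\<bar>" 1 "\<bar>sin (t * \<omega> \<xi>) / \<omega> \<xi>\<bar>" "\<bar>t\<bar>"] by simp
qed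

lemma integrable_wave: "0 \<le> a \<Longrightarrow> integrable (rst torus) (wave a t)"
  by (rule integrable_rst_bounded [where B = "\<bar>t\<bar>"]) (auto intro: norm_wave_le)

lemma G_eq_FT: "G x t = of_real (1 / (2 * pi) ^ CARD('n)) * FT (wave 0 t) (x :: int ^ 'n)"
  unfolding G_def FT_def wave_def by (subst integral_rst) auto

text \<open>The sine is the difference of a half wave \<open>E\<close> and its conjugate, and
  conjugation only reflects x. Each half is singular like 1 / \<omega> at 0, so splitting the
  transform needs the integrability of 1 / \<omega>.\<close>

lemma FT_damped_wave_bound:
  assumes a: "0 < a" and d: "5 \<le> CARD('n)"
  shows "\<exists>D\<ge>0. \<forall>t\<ge>1. \<forall>x :: int ^ 'n. norm (FT (wave a t) x) \<le> D * t powr (- \<sigma> CARD('n))"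
proof -
  obtain D where D: "0 \<le> D" "\<And>t x. 1 \<le> t \<Longrightarrow>
      norm (FT (\<lambda>\<xi>. exp (- Complex a (- t) * of_real (\<omega> \<xi>)) / of_real (\<omega> \<xi>)) (x :: int ^ 'n)) \<le> D * t powr (- \<sigma> CARD('n))"
    using FT_half_wave_bound [OF a d] by blast
  show ?thesis
  proof (intro exI [of _ D] conjI allI impI)
    fix t :: real and x :: "int ^ 'n" assume t: "1 \<le> t"
    define E where "E = (\<lambda>\<xi> :: real ^ 'n. exp (- Complex a (- t) * of_real (\<omega> \<xi>)) / of_real (\<omega> \<xi>))"
    have [measurable]: "E \<in> borel_measurable borel" unfolding E_def by measurable
    have norm_E: "norm (E \<xi>) \<le> norm (1 / \<omega> \<xi>)" for \<xi>
      unfolding E_def norm_divide norm_exp_eq_Re using a by (simp add: divide_right_mono)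
    have iE: "integrable (rst torus) E"
      using d by (intro integrable_rst_boundE [OF _ integrable_inverse_\<omega>] norm_E) auto
    have iE': "integrable (rst torus) (\<lambda>\<xi>. cnj (E \<xi>))"
      by (rule integrable_bounded_linear [OF bounded_linear_cnj iE])
    have w: "wave a t = (\<lambda>\<xi>. 1 / (2 * \<i>) * (E \<xi> - cnj (E \<xi>)))"
    proof
      fix \<xi> :: "real ^ 'n"
      have "E \<xi> = of_real (exp (- a * \<omega> \<xi>)) * cis (t * \<omega> \<xi>) / of_real (\<omega> \<xi>)"
      proof -
        have "- Complex a (- t) * of_real (\<omega> \<xi>) = of_real (- a * \<omega> \<xi>) + \<i> * of_real (t * \<omega> \<xi>)"
          by (simp add: complex_eq_iff)
        then show ?thesis unfolding E_def by (simp only: exp_add cis_conv_exp exp_of_real)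
      qed
      then show "wave a t \<xi> = 1 / (2 * \<i>) * (E \<xi> - cnj (E \<xi>))"
        by (simp add: wave_def complex_eq_iff Re_divide_of_real Im_divide_of_real)
    qed
    have "FT (wave a t) x = 1 / (2 * \<i>) * (FT E x - cnj (FT E (- x)))"
      unfolding w FT_cmult FT_diff [OF iE iE'] FT_cnj ..
    then have "norm (FT (wave a t) x) = norm (FT E x - cnj (FT E (- x))) / 2"
      by (simp add: norm_mult norm_divide)
    also have "\<dots> \<le> (norm (FT E x) + norm (FT E (- x))) / 2"
      using norm_triangle_ineq4 [of "FT E x" "cnj (FT E (- x))"] by simp
    also have "\<dots> \<le> D * t powr (- \<sigma> CARD('n))"
      using D(2) [OF t, of x] D(2) [OF t, of "- x"] unfolding E_def by simp
    finally show "norm (FT (wave a t) x) \<le> D * t powr (- \<sigma> CARD('n))" .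
  qed (fact D(1))
qed

lemma FT_wave_bound:
  assumes d: "5 \<le> CARD('n)"
  shows "\<exists>D\<ge>0. \<forall>t\<ge>1. \<forall>x :: int ^ 'n. norm (FT (wave 0 t) x) \<le> D * t powr (- \<sigma> CARD('n))"
proof -
  obtain D1 where D1: "0 \<le> D1" "\<And>t x. 1 \<le> t \<Longrightarrow> norm (FT (wave 1 t) (x :: int ^ 'n)) \<le> D1 * t powr (- \<sigma> CARD('n))"
    using FT_damped_wave_bound [OF _ d, of 1] by auto
  obtain D2 where D2: "0 \<le> D2" "\<And>t x. 1 \<le> t \<Longrightarrow> norm (FT (wave 2 t) (x :: int ^ 'n)) \<le> D2 * t powr (- \<sigma> CARD('n))"
    using FT_damped_wave_bound [OF _ d, of 2] by auto
  obtain B where B: "0 \<le> B" "wiener B (\<lambda>\<xi> :: real ^ 'n. of_real (cosh (\<omega> \<xi>)))"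
    using wiener_cosh_\<omega> by blast
  show ?thesis
  proof (intro exI [of _ "2 * (B * D1) + D2"] conjI allI impI)
    fix t :: real and x :: "int ^ 'n" assume t: "1 \<le> t"
    let ?c = "\<lambda>\<xi> :: real ^ 'n. of_real (cosh (\<omega> \<xi>)) * wave 1 t \<xi>"
    have ic: "integrable (rst torus) ?c"
      by (intro wiener_integrable [OF B(2)] integrable_wave) simp
    \<comment> \<open>\<open>1 = 2 cosh u e\<^sup>-\<^sup>u - e\<^sup>-\<^sup>2\<^sup>u\<close>, and \<open>cosh \<omega>\<close> is an entire function of the symbol \<open>\<omega>\<^sup>2\<close>.\<close>
    have "wave 0 t \<xi> = 2 * ?c \<xi> - wave 2 t \<xi>" for \<xi> :: "real ^ 'n"
    proof -
      have id: "2 * (cosh (\<omega> \<xi>) * exp (- 1 * \<omega> \<xi>)) - exp (- 2 * \<omega> \<xi>) = 1"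
        by (simp add: cosh_def field_simps flip: exp_add)
      have alg: "c * q = 2 * (u * (v * q)) - w * q" if "2 * (u * v) - w = 1" "c = 1" for c u v w q :: real
      proof -
        have "c * q = (2 * (u * v) - w) * q" using that by simp
        then show ?thesis by (simp add: algebra_simps)
      qed
      have "exp (- 0 * \<omega> \<xi>) * (sin (t * \<omega> \<xi>) / \<omega> \<xi>) =
         2 * (cosh (\<omega> \<xi>) * (exp (- 1 * \<omega> \<xi>) * (sin (t * \<omega> \<xi>) / \<omega> \<xi>))) - exp (- 2 * \<omega> \<xi>) * (sin (t * \<omega> \<xi>) / \<omega> \<xi>)"
        by (rule alg [OF id]) simp
      from arg_cong [OF this, of complex_of_real] show ?thesis
        unfolding wave_def by (simp only: of_real_diff of_real_mult of_real_numeral)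
    qed
    then have "wave 0 t = (\<lambda>\<xi> :: real ^ 'n. 2 * ?c \<xi> - wave 2 t \<xi>)" by blast
    then have "FT (wave 0 t) x = 2 * FT ?c x - FT (wave 2 t) x"
      using FT_diff [OF integrable_mult_right [OF ic] integrable_wave [of 2 t], of 2 x] by (simp add: FT_cmult)
    then have "norm (FT (wave 0 t) x) \<le> 2 * norm (FT ?c x) + norm (FT (wave 2 t) x)"
      using norm_triangle_ineq4 [of "2 * FT ?c x" "FT (wave 2 t) x"] by (simp add: norm_mult)
    also have "\<dots> \<le> 2 * (B * (D1 * t powr (- \<sigma> CARD('n)))) + D2 * t powr (- \<sigma> CARD('n))"
      by (intro add_mono mult_left_mono wienerD [OF B(2)] integrable_wave D1(2) [OF t] D2(2) [OF t]) auto
    also have "\<dots> = (2 * (B * D1) + D2) * t powr (- \<sigma> CARD('n))" by (simp add: ring_distribs)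
    finally show "norm (FT (wave 0 t) x) \<le> (2 * (B * D1) + D2) * t powr (- \<sigma> CARD('n))" .
  qed (use B(1) D1(1) D2(1) in simp)
qed

lemma FT_wave_minus: "FT (wave 0 (- t)) x = - FT (wave 0 t) x"
proof -
  have eq: "wave 0 (- t) = (\<lambda>\<xi>. (- 1) * wave 0 t \<xi>)" by (auto simp: wave_def)
  show ?thesis unfolding eq FT_cmult by simp
qed

lemma \<sigma>_pos: "0 < \<sigma> d"
  by (simp add: \<sigma>_def)

lemma G_upper_bound:
  assumes d: "5 \<le> CARD('n)"
  shows "\<exists>C>0. \<forall>(x :: int ^ 'n) t. cmod (G x t) \<le> C * (1 + \<bar>t\<bar>) powr (- \<sigma> CARD('n))"
proof -
  let ?s = "\<sigma> CARD('n)"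
  obtain D where D: "0 \<le> D" "\<And>t x. 1 \<le> t \<Longrightarrow> norm (FT (wave 0 t) (x :: int ^ 'n)) \<le> D * t powr (- ?s)"
    using FT_wave_bound [OF d] by blast
  define V where "V = measure (rst (torus :: (real ^ 'n) set)) UNIV"
  have V: "0 \<le> V" by (simp add: V_def)
  \<comment> \<open>The power of 2 pays for comparing \<open>1 + \<bar>t\<bar>\<close> with 2 when
    |t| is at most 1, and with 2 |t| otherwise.\<close>
  define C where "C = (D + V + 1) * 2 powr ?s"
  have bound: "norm (FT (wave 0 t) x) \<le> C * (1 + \<bar>t\<bar>) powr (- ?s)" for x :: "int ^ 'n" and t
  proof (cases "\<bar>t\<bar> \<le> 1")
    case True
    interpret finite_measure "rst (torus :: (real ^ 'n) set)" by (rule finite_measure_rst) simp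
    have "norm (FT (wave 0 t) x) \<le> (\<integral>\<xi>. norm (exp (\<i> * of_real (phase x \<xi>)) * wave 0 t \<xi>) \<partial>rst torus)"
      unfolding FT_def by (rule integral_norm_bound)
    also have "\<dots> \<le> (\<integral>\<xi>. 1 \<partial>rst (torus :: (real ^ 'n) set))"
      using norm_wave_le [of 0 t] True
      by (intro integral_mono integrable_norm integrable_FT integrable_wave)
        (auto simp: norm_mult intro: order_trans)
    also have "\<dots> = V * 1" by (simp add: V_def)
    also have "\<dots> \<le> (D + V + 1) * (2 powr ?s * (1 + \<bar>t\<bar>) powr (- ?s))"
    proof (intro mult_mono)
      have "2 powr (- ?s) \<le> (1 + \<bar>t\<bar>) powr (- ?s)"
        using True \<sigma>_pos [of "CARD('n)"] by (intro powr_mono2') auto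
      then have "2 powr ?s * 2 powr (- ?s) \<le> 2 powr ?s * (1 + \<bar>t\<bar>) powr (- ?s)"
        by (intro mult_left_mono) auto
      then show "1 \<le> 2 powr ?s * (1 + \<bar>t\<bar>) powr (- ?s)" by (simp flip: powr_add)
    qed (use D(1) V in auto)
    finally show ?thesis by (simp add: C_def mult.assoc)
  next
    case False
    have "norm (FT (wave 0 t) x) = norm (FT (wave 0 \<bar>t\<bar>) x)"
      by (cases "0 \<le> t") (simp_all add: FT_wave_minus)
    also have "\<dots> \<le> D * \<bar>t\<bar> powr (- ?s)" using False by (intro D(2)) auto
    also have "\<dots> \<le> (D + V + 1) * (2 powr ?s * (1 + \<bar>t\<bar>) powr (- ?s))"
    proof (intro mult_mono)
      have "(2 * \<bar>t\<bar>) powr (- ?s) \<le> (1 + \<bar>t\<bar>) powr (- ?s)"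
        using False \<sigma>_pos [of "CARD('n)"] by (intro powr_mono2') auto
      then have "2 powr ?s * (2 powr (- ?s) * \<bar>t\<bar> powr (- ?s)) \<le> 2 powr ?s * (1 + \<bar>t\<bar>) powr (- ?s)"
        unfolding powr_mult [symmetric] by (intro mult_left_mono) auto
      then show "\<bar>t\<bar> powr (- ?s) \<le> 2 powr ?s * (1 + \<bar>t\<bar>) powr (- ?s)"
        unfolding mult.assoc [symmetric] powr_add [symmetric] by simp
    qed (use D(1) V in auto)
    finally show ?thesis by (simp add: C_def mult.assoc)
  qed
  have C: "0 < C" unfolding C_def using D(1) V by (intro mult_pos_pos) auto
  have "cmod (G x t) \<le> C * (1 + \<bar>t\<bar>) powr (- ?s)" for x :: "int ^ 'n" and t
  proof -
    have "1 \<le> (2 * pi) ^ CARD('n)" using pi_gt3 by (intro one_le_power) simp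
    then have "cmod (G x t) \<le> norm (FT (wave 0 t) x)"
      unfolding G_eq_FT norm_mult norm_of_real by (intro mult_left_le_one_le) auto
    then show ?thesis using bound [of t x] by linarith
  qed
  then show ?thesis using C by blast
qed

section \<open>Concentrated trigonometric polynomials\<close>

text \<open>The l-th Fourier coefficient of \<open>((1 + cos \<eta>) / 2) ^ p\<close>: a centred
  binomial distribution on the integers, zero for |l| > p because the binomial coefficient vanishes
  there.\<close>

definition A :: "nat \<Rightarrow> int \<Rightarrow> real" where
  "A p l = real (2 * p choose (p + nat \<bar>l\<bar>)) / 4 ^ p"

lemma A_nonneg [simp]: "0 \<le> A p l"
  by (simp add: A_def)

lemma A_eq_0: "int p < \<bar>l\<bar> \<Longrightarrow> A p l = 0"
  by (auto simp: A_def intro!: binomial_eq_0)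

lemma A_antimono:
  assumes "\<bar>k\<bar> \<le> \<bar>l\<bar>" shows "A p l \<le> A p k"
proof (cases "\<bar>l\<bar> \<le> int p")
  case True
  have "(2 * p choose (p + nat \<bar>l\<bar>)) \<le> (2 * p choose (p + nat \<bar>k\<bar>))"
    using assms True by (intro binomial_antimono) auto
  then show ?thesis unfolding A_def by (intro divide_right_mono) auto
qed (simp add: A_eq_0)

lemma A_Suc: "(real p + real l + 1) * A p (int (Suc l)) = (real p - real l) * A p (int l)"
proof (cases "l < p")
  case True
  define b where "b = p - Suc l"
  have b: "Suc (p + l + b) = 2 * p" "real (Suc b) = real p - real l" using True by (auto simp: b_def)
  have "real (Suc (p + l) * (2 * p choose Suc (p + l))) = real (Suc b * (2 * p choose (p + l)))"
    unfolding b(1) [symmetric] by (subst Suc_times_binomial_add) simp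
  then have "(real p + real l + 1) * real (2 * p choose Suc (p + l)) = (real p - real l) * real (2 * p choose (p + l))"
    unfolding of_nat_mult b(2) by (simp add: algebra_simps)
  then show ?thesis by (simp add: A_def nat_add_distrib)
qed (cases "l = p"; simp add: A_eq_0)

text \<open>Consecutive coefficients have ratio 1 - (2l+1)/(p+l+1), at least 1 - (2l+1)/p, and the
  odd numbers below 2l add up to the square of l. Once that square exceeds p the claim is
  trivial.\<close>

lemma A_ge:
  assumes "1 \<le> p"
  shows "A p 0 * (1 - (real l)\<^sup>2 / p) \<le> A p (int l)"
proof (induction l)
  case (Suc l)
  show ?case
  proof (cases "(real (Suc l))\<^sup>2 \<le> real p")
    case False
    then have "1 - (real (Suc l))\<^sup>2 / p \<le> 0" using assms by (simp add: divide_simps)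
    then have "A p 0 * (1 - (real (Suc l))\<^sup>2 / p) \<le> 0" by (intro mult_nonneg_nonpos) auto
    then show ?thesis by (rule order_trans) simp
  next
    case True
    have p: "0 < real p" using assms by simp
    have l: "(real l)\<^sup>2 \<le> real p" "2 * real l + 1 \<le> real p"
    proof -
      have "(real (Suc l))\<^sup>2 = (real l)\<^sup>2 + (2 * real l + 1)" by (simp add: power2_eq_square algebra_simps)
      then show "(real l)\<^sup>2 \<le> real p" "2 * real l + 1 \<le> real p"
        using True zero_le_power2 [of "real l"] by linarith+
    qed
    define u v where "u = (real l)\<^sup>2 / p" and "v = (2 * real l + 1) / p"
    have uv: "0 \<le> u" "u \<le> 1" "0 \<le> v" "v \<le> 1" using l p by (auto simp: u_def v_def)
    define w where "w = (2 * real l + 1) / (real p + real l + 1)"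
    have w: "w \<le> v" unfolding w_def v_def using p by (intro divide_left_mono) auto
    have "1 - u - v \<le> (1 - u) * (1 - v)" using uv by (simp add: algebra_simps)
    then have "A p 0 * (1 - u - v) \<le> A p 0 * ((1 - u) * (1 - v))" by (intro mult_left_mono) auto
    also have "\<dots> = (A p 0 * (1 - u)) * (1 - v)" by simp
    also have "\<dots> \<le> A p (int l) * (1 - v)"
      using Suc uv unfolding u_def by (intro mult_right_mono) auto
    also have "\<dots> \<le> A p (int l) * (1 - w)" using w by (intro mult_left_mono) auto
    also have "\<dots> = A p (int (Suc l))"
      using A_Suc [of p l] p by (simp add: w_def field_simps)
    also have "1 - u - v = 1 - (real (Suc l))\<^sup>2 / p"
      using p by (simp add: u_def v_def power2_eq_square field_simps)
    finally show ?thesis .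
  qed
qed simp

lemma A_0_Suc: "A (Suc p) 0 = A p 0 * ((2 * real p + 1) / (2 * real p + 2))"
proof -
  have "real (2 * Suc p choose Suc p) * (real p + 1) = 2 * (2 * real p + 1) * real (2 * p choose p)"
  proof -
    have "Suc p * (2 * Suc p choose Suc p) = 2 * (Suc (2 * p)) * (2 * p choose p)"
    proof -
      have 1: "Suc (2 * p) * (2 * p choose p) = (Suc (2 * p) choose Suc p) * Suc p"
        by (rule Suc_times_binomial_eq)
      have 3: "(Suc (2 * p) choose p) = (Suc (2 * p) choose Suc p)"
        using binomial_symmetric [of p "Suc (2 * p)"] by (simp add: Suc_diff_le)
      have "(2 * Suc p choose Suc p) = 2 * (Suc (2 * p) choose Suc p)"
        using 3 by (simp del: binomial_Suc_Suc add: binomial_Suc_Suc [of "Suc (2 * p)" p])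
      moreover have "Suc p * (2 * (Suc (2 * p) choose Suc p)) = 2 * ((Suc (2 * p) choose Suc p) * Suc p)"
        by (simp only: mult.commute mult.left_commute)
      ultimately show ?thesis unfolding 1 [symmetric] by (simp only: mult.assoc)
    qed
    then have "real (Suc p * (2 * Suc p choose Suc p)) = real (2 * (Suc (2 * p)) * (2 * p choose p))"
      by (rule arg_cong)
    then show ?thesis by (simp add: algebra_simps)
  qed
  moreover define N B where "N = real (2 * Suc p choose Suc p)" and "B = real (2 * p choose p)"
  ultimately have "N * (real p + 1) = 2 * (2 * real p + 1) * B" by (simp only:)
  then have N: "N = 2 * (2 * real p + 1) * B / (real p + 1)"
    by (simp add: nonzero_eq_divide_eq add_nonneg_eq_0_iff)
  have A1: "A (Suc p) 0 = N / (4 * 4 ^ p)"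
    by (simp add: A_def N_def del: binomial_Suc_Suc mult_Suc_right)
  have A2: "A p 0 = B / 4 ^ p" by (simp add: A_def B_def)
  show ?thesis unfolding A1 A2 N by (simp add: divide_simps) (simp add: algebra_simps)
qed

text \<open>As for Wallis' product, \<open>(A p 0)\<^sup>2 * (2 * real p + 1)\<close> does not
  increase with p and equals 1 at p = 0.\<close>

lemma A_0_upper: "A p 0 \<le> 1 / sqrt (2 * real p + 1)"
proof -
  have "(A p 0)\<^sup>2 * (2 * real p + 1) \<le> 1"
  proof (induction p)
    case (Suc p)
    have "(A (Suc p) 0)\<^sup>2 * (2 * real (Suc p) + 1)
        = ((A p 0)\<^sup>2 * (2 * real p + 1)) * ((2 * real p + 1) * (2 * real p + 3) / (2 * real p + 2)\<^sup>2)"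
      unfolding A_0_Suc by (simp add: power_mult_distrib power_divide power2_eq_square algebra_simps)
    also have "\<dots> \<le> 1 * 1"
    proof (intro mult_mono Suc)
      have "(2 * real p + 1) * (2 * real p + 3) \<le> (2 * real p + 2)\<^sup>2"
        by (simp add: power2_eq_square algebra_simps)
      then show "(2 * real p + 1) * (2 * real p + 3) / (2 * real p + 2)\<^sup>2 \<le> 1"
        by (intro divide_le_eq_1 [THEN iffD2]) auto
    qed auto
    finally show ?case by simp
  qed (simp add: A_def)
  then have "(A p 0)\<^sup>2 \<le> 1 / (2 * real p + 1)" by (simp add: field_simps)
  then have "A p 0 \<le> sqrt (1 / (2 * real p + 1))" by (rule real_le_rsqrt)
  then show ?thesis by (simp add: real_sqrt_divide)
qed

text \<open>Here \<open>(A p 0)\<^sup>2 * (4 * real p)\<close> does not decrease with p and equals 1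
  at p = 1.\<close>

lemma A_0_lower:
  assumes "1 \<le> p" shows "1 / (2 * sqrt (real p)) \<le> A p 0"
proof -
  have "1 \<le> (A p 0)\<^sup>2 * (4 * real p)"
    using assms
  proof (induction p rule: dec_induct)
    case (step p)
    have p: "1 \<le> real p" using step by simp
    have "1 * 1 \<le> ((A p 0)\<^sup>2 * (4 * real p)) * ((2 * real p + 1)\<^sup>2 / ((2 * real p + 2) * (2 * real p)))"
    proof (intro mult_mono step.IH)
      have "(2 * real p + 2) * (2 * real p) \<le> (2 * real p + 1)\<^sup>2"
        by (simp add: power2_eq_square algebra_simps)
      then show "1 \<le> (2 * real p + 1)\<^sup>2 / ((2 * real p + 2) * (2 * real p))"
        using p by (simp add: le_divide_eq_1_pos)
    qed auto
    also have "\<dots> = (A (Suc p) 0)\<^sup>2 * (4 * real (Suc p))"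
      unfolding A_0_Suc using p by (simp add: power_mult_distrib power_divide power2_eq_square divide_simps) (simp add: algebra_simps)
    finally show ?case by simp
  qed (simp add: A_def power2_eq_square)
  then have "(1 / (2 * sqrt (real p)))\<^sup>2 \<le> (A p 0)\<^sup>2"
    using assms by (simp add: power_divide power_mult_distrib field_simps)
  then show ?thesis by (rule power2_le_imp_le) simp
qed

text \<open>With the half angle, (1 + cos \<eta>) / 2 is the square of (u + 1/u) / 2, so the
  binomial theorem applies; its index k corresponds to l = k - p.\<close>

lemma fourier_cos_power:
  "complex_of_real (((1 + cos \<eta>) / 2) ^ p) = (\<Sum>l=-int p..int p. of_real (A p l) * exp (\<i> * of_int l * of_real \<eta>))"
proof -
  define u where "u = exp (\<i> * of_real (\<eta> / 2))"
  have u: "u \<noteq> 0" by (simp add: u_def)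
  have "of_real ((1 + cos \<eta>) / 2) = (of_real (cos (\<eta> / 2)) :: complex) ^ 2"
    using cos_double_cos [of "\<eta> / 2"] by (simp flip: of_real_power)
  also have "of_real (cos (\<eta> / 2)) = (u + inverse u) / 2"
    unfolding cos_of_real [symmetric] cos_exp_eq u_def by (simp add: exp_minus)
  finally have eq: "complex_of_real ((1 + cos \<eta>) / 2) = ((u + inverse u) / 2) ^ 2" .
  have "complex_of_real (((1 + cos \<eta>) / 2) ^ p) = (u + inverse u) ^ (2 * p) / 4 ^ p"
    unfolding of_real_power eq by (simp add: power_divide power_mult)
  also have "(u + inverse u) ^ (2 * p) = (\<Sum>k\<le>2 * p. of_nat (2 * p choose k) * u ^ k * inverse u ^ (2 * p - k))"
    by (rule binomial_ring)
  also have "\<dots> / 4 ^ p = (\<Sum>k\<le>2 * p. of_nat (2 * p choose k) * u ^ k * inverse u ^ (2 * p - k) / 4 ^ p)"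
    by (rule sum_divide_distrib)
  also have "\<dots> = (\<Sum>l=-int p..int p. of_real (A p l) * exp (\<i> * of_int l * of_real \<eta>))"
  proof (rule sum.reindex_bij_witness [where i = "\<lambda>l. nat (l + int p)" and j = "\<lambda>k. int k - int p"])
    fix k assume k: "k \<in> {..2 * p}"
    have "(2 * p choose (p + nat \<bar>int k - int p\<bar>)) = (2 * p choose k)"
    proof (cases "p \<le> k")
      case False
      then have "p + nat \<bar>int k - int p\<bar> = 2 * p - k" by auto
      then show ?thesis unfolding \<open>p + nat \<bar>int k - int p\<bar> = 2 * p - k\<close>
        using k by (intro binomial_symmetric [symmetric]) simp
    next
      case True
      then have "p + nat \<bar>int k - int p\<bar> = k" by auto
      then show ?thesis by (simp only:)
    qed
    moreover have "u ^ k * inverse u ^ (2 * p - k) = exp (\<i> * of_int (int k - int p) * of_real \<eta>)"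
    proof -
      have "inverse u = exp (- (\<i> * of_real (\<eta> / 2)))" by (simp add: u_def exp_minus)
      then have "u ^ k * inverse u ^ (2 * p - k)
          = exp (of_nat k * (\<i> * of_real (\<eta> / 2)) + of_nat (2 * p - k) * (- (\<i> * of_real (\<eta> / 2))))"
        unfolding u_def by (simp only: exp_of_nat_mult [symmetric] exp_add)
      also have "of_nat k * (\<i> * of_real (\<eta> / 2)) + of_nat (2 * p - k) * (- (\<i> * of_real (\<eta> / 2)))
          = \<i> * of_int (int k - int p) * of_real \<eta>"
        using k by (simp add: of_nat_diff field_simps)
      finally show ?thesis .
    qed
    ultimately show "of_real (A p (int k - int p)) * exp (\<i> * of_int (int k - int p) * of_real \<eta>)
        = of_nat (2 * p choose k) * u ^ k * inverse u ^ (2 * p - k) / 4 ^ p"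
      by (simp add: A_def mult.assoc)
  qed auto
  finally show ?thesis .
qed

lemma sum_A: "(\<Sum>l=-int p..int p. A p l) = 1"
proof -
  have "complex_of_real (\<Sum>l=-int p..int p. A p l) = 1"
    using fourier_cos_power [of 0 p] by simp
  then show ?thesis by (simp only: of_real_eq_1_iff)
qed

lemma sum_A_le:
  assumes "finite I" shows "(\<Sum>l\<in>I. A p l) \<le> 1"
proof -
  have "(\<Sum>l\<in>I. A p l) = (\<Sum>l\<in>I \<inter> {-int p..int p}. A p l)"
    using assms by (intro sum.mono_neutral_right) (auto intro!: A_eq_0)
  also have "\<dots> \<le> (\<Sum>l=-int p..int p. A p l)"
    by (intro sum_mono2) auto
  finally show ?thesis by (simp add: sum_A)
qed

text \<open>The coefficients decrease in |l|, so \<open>n\<close> copies of this one are at most the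
  sum of those at 1, ..., n, which is at most 1.\<close>

lemma A_le_inverse:
  assumes "1 \<le> n" "int n \<le> \<bar>l\<bar>" shows "A p l \<le> 1 / n"
proof -
  have "real n * A p l = (\<Sum>k=1..int n. A p l)" by simp
  also have "\<dots> \<le> (\<Sum>k=1..int n. A p k)"
    using assms by (intro sum_mono A_antimono) auto
  also have "\<dots> \<le> 1" by (rule sum_A_le) simp
  finally show ?thesis using assms by (simp add: field_simps)
qed

lemma integral_character:
  "(\<integral>x. exp (\<i> * of_int m * of_real (x - c)) \<partial>rst {-pi..pi}) = (if m = 0 then of_real (2 * pi) else 0)"
proof (cases "m = 0")
  case True
  have "(\<integral>x. (1 :: complex) \<partial>rst {-pi..pi}) = (LINT x:{-pi..pi}|lborel. 1)"
    by (rule integral_rst) auto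
  then show ?thesis using True by (simp add: set_lebesgue_integral_def scaleR_conv_of_real)
next
  case False
  let ?f = "\<lambda>x :: real. exp (\<i> * of_int m * of_real (x - c))"
  have cont: "continuous_on S ?f" for S by (intro continuous_intros)
  have int: "set_integrable lborel {-pi..pi} ?f" by (rule borel_integrable_atLeastAtMost' [OF cont])
  let ?F = "\<lambda>x :: real. ?f x / (\<i> * of_int m)"
  have "(?f has_integral ?F pi - ?F (- pi)) {-pi..pi}"
  proof (rule fundamental_theorem_of_calculus)
    fix x :: real
    have "((\<lambda>z. exp (\<i> * of_int m * (z - of_real c)) / (\<i> * of_int m)) has_field_derivative
      exp (\<i> * of_int m * (of_real x - of_real c))) (at (of_real x))"
      using False by (auto intro!: derivative_eq_intros)
    from has_vector_derivative_real_field [OF this]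
    show "(?F has_vector_derivative ?f x) (at x within {-pi..pi})" by (simp add: has_vector_derivative_at_within)
  qed simp
  moreover have "?f pi = ?f (- pi)"
  proof -
    have arg: "\<i> * of_int m * of_real (pi - c) = \<i> * of_int m * of_real (- pi - c) + 2 * of_real pi * \<i> * of_int m"
      by (simp add: algebra_simps)
    have "?f pi = ?f (- pi) * exp (2 * of_real pi * \<i> * of_int m)"
      unfolding arg exp_add ..
    also have "exp (2 * of_real pi * \<i> * of_int m) = (1 :: complex)"
      using exp_integer_2pi [of "of_int m"] by (simp add: mult_ac)
    finally show ?thesis by simp
  qed
  ultimately have "(?f has_integral 0) {-pi..pi}" by simp
  then have "integral {-pi..pi} ?f = 0" by (rule integral_unique)
  then have "(LINT x:{-pi..pi}|lborel. ?f x) = 0" using set_borel_integral_eq_integral(2) [OF int] by simp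
  then show ?thesis using False by (subst integral_rst) auto
qed

section \<open>A trigonometric polynomial localized on an anisotropic box\<close>

definition bump :: "real \<Rightarrow> real" where
  "bump \<eta> = (1 + cos \<eta>) / 2"

lemma bump_nonneg [simp]: "0 \<le> bump \<eta>"
proof -
  have "0 \<le> 1 + cos \<eta>" using cos_ge_minus_one [of \<eta>] by linarith
  then show ?thesis by (simp add: bump_def)
qed

lemma bump_le_1 [simp]: "bump \<eta> \<le> 1"
proof -
  have "1 + cos \<eta> \<le> 2" using cos_le_one [of \<eta>] by linarith
  then show ?thesis by (simp add: bump_def)
qed

lemma bump_measurable [measurable]: "bump \<in> borel_measurable borel"
  unfolding bump_def [abs_def] by measurable

lemma norm_character: "norm (exp (\<i> * of_int k * of_real x)) = 1"
  using norm_exp_i_times [of "of_int k * x"] by (simp add: mult.assoc)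

lemma character_add:
  "exp (\<i> * of_int k * r) * exp (\<i> * of_int m * r) = exp (\<i> * of_int (k + m) * r)"
  by (simp add: ring_distribs flip: exp_add)

lemma integral_bump_power:
  "(\<integral>x. of_real (bump (x - pi / 2) ^ p) * exp (\<i> * of_int m * of_real (x - pi / 2)) \<partial>rst {-pi..pi})
    = of_real (2 * pi * A p m)"
proof -
  let ?e = "\<lambda>k x. exp (\<i> * of_int k * of_real (x - pi / 2)) :: complex"
  have eq: "of_real (bump (x - pi / 2) ^ p) * ?e m x = (\<Sum>l=-int p..int p. of_real (A p l) * ?e (l + m) x)" for x
    unfolding bump_def fourier_cos_power sum_distrib_right
    by (intro sum.cong refl) (simp only: mult.assoc [of "of_real (A p _)"] character_add)
  have int: "integrable (rst {-pi..pi}) (?e k)" for k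
  proof (rule integrable_rst_bounded [where B = 1])
    show "norm (?e k x) \<le> 1" for x unfolding norm_character by simp
  qed auto
  have "(\<integral>x. of_real (bump (x - pi / 2) ^ p) * ?e m x \<partial>rst {-pi..pi})
      = (\<Sum>l=-int p..int p. of_real (A p l) * (\<integral>x. ?e (l + m) x \<partial>rst {-pi..pi}))"
    unfolding eq integral_mult_right_zero [symmetric]
    by (rule Bochner_Integration.integral_sum) (rule integrable_mult_right [OF int])
  also have "\<dots> = (\<Sum>l=-int p..int p. if l = - m then of_real (2 * pi * A p l) else 0)"
    unfolding integral_character by (intro sum.cong) auto
  also have "\<dots> = of_real (2 * pi * A p m)"
    using A_eq_0 [of p m] by (auto simp: A_def)
  finally show ?thesis .
qed

definition shift_sum :: "real ^ 'n \<Rightarrow> real" where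
  "shift_sum \<xi> = (\<Sum>j\<in>UNIV. \<xi> $ j - pi / 2)"

text \<open>The product confines every coordinate to distance about p^(-1/2) from \<pi>/2; the last
  factor confines the coordinate sum, modulo 2 \<pi>, to scale q^(-1/2). With p of order t^(2/3) and
  q of order t this is a smoothed indicator of the box.\<close>

definition \<Phi> :: "nat \<Rightarrow> nat \<Rightarrow> real ^ 'n \<Rightarrow> real" where
  "\<Phi> p q \<xi> = (\<Prod>j\<in>UNIV. bump (\<xi> $ j - pi / 2) ^ p) * bump (shift_sum \<xi>) ^ q"

lemma shift_sum_measurable [measurable]: "shift_sum \<in> borel_measurable borel"
  unfolding shift_sum_def [abs_def] by measurable

lemma \<Phi>_measurable [measurable]: "\<Phi> p q \<in> borel_measurable borel"
  unfolding \<Phi>_def [abs_def] by measurable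

lemma \<Phi>_range: "0 \<le> \<Phi> p q \<xi>" "\<Phi> p q \<xi> \<le> 1"
  unfolding \<Phi>_def
  by (auto intro!: mult_nonneg_nonneg prod_nonneg mult_le_one prod_le_1 power_le_one)

text \<open>Once the last bump is expanded in characters of \<open>shift_sum\<close>, every term is
  a product over the coordinates.\<close>

lemma integral_\<Phi>_character:
  "(\<integral>\<xi> . of_real (\<Phi> p q \<xi>) * exp (\<i> * of_int m * of_real (shift_sum \<xi>)) \<partial>rst (torus :: (real ^ 'n) set))
    = of_real ((2 * pi) ^ CARD('n) * (\<Sum>l=-int q..int q. A q l * A p (l + m) ^ CARD('n)))"
proof -
  let ?e = "\<lambda>k x. exp (\<i> * of_int k * of_real (x - pi / 2)) :: complex"
  let ?f = "\<lambda>k x. of_real (bump (x - pi / 2) ^ p) * ?e k x"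
  have e: "exp (\<i> * of_int k * of_real (shift_sum \<xi>)) = (\<Prod>j\<in>UNIV. ?e k (\<xi> $ j))" for k and \<xi> :: "real ^ 'n"
    unfolding exp_sum [OF finite, symmetric] shift_sum_def of_real_sum sum_distrib_left ..
  have int: "integrable (rst {-pi..pi}) (?f k)" for k
    by (rule integrable_rst_bounded [where B = 1])
      (simp_all only: norm_mult norm_character, measurable, simp_all add: norm_power power_le_one)
  have eq: "of_real (\<Phi> p q \<xi>) * exp (\<i> * of_int m * of_real (shift_sum \<xi>))
      = (\<Sum>l=-int q..int q. of_real (A q l) * (\<Prod>j\<in>UNIV. ?f (l + m) (\<xi> $ j)))" for \<xi> :: "real ^ 'n"
  proof -
    have "of_real (\<Phi> p q \<xi>) * exp (\<i> * of_int m * of_real (shift_sum \<xi>))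
      = (\<Prod>j\<in>UNIV. of_real (bump (\<xi> $ j - pi / 2) ^ p)) * (\<Sum>l=-int q..int q. of_real (A q l) *
        exp (\<i> * of_int (l + m) * of_real (shift_sum \<xi>)))"
      by (simp only: \<Phi>_def of_real_mult bump_def [of "shift_sum \<xi>"] fourier_cos_power of_real_prod
          sum_distrib_right mult.assoc [of "prod _ _"] mult.assoc [of "of_real (A q _)"] character_add)
    then show ?thesis
      unfolding e by (simp add: sum_distrib_left prod.distrib mult_ac)
  qed
  have "(\<integral>\<xi>. of_real (\<Phi> p q \<xi>) * exp (\<i> * of_int m * of_real (shift_sum \<xi>)) \<partial>rst (torus :: (real ^ 'n) set))
    = (\<Sum>l=-int q..int q. of_real (A q l) * (\<Prod>j\<in>(UNIV :: 'n set). integral\<^sup>L (rst {-pi..pi}) (?f (l + m))))"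
    unfolding eq integral_prod_torus [OF int, symmetric] integral_mult_right_zero [symmetric]
    by (rule Bochner_Integration.integral_sum) (rule integrable_mult_right [OF integrable_prod_torus [OF int]])
  also have "\<dots> = (\<Sum>l=-int q..int q. of_real (A q l * (2 * pi * A p (l + m)) ^ CARD('n)))"
    unfolding integral_bump_power by simp
  also have "\<dots> = of_real ((2 * pi) ^ CARD('n) * (\<Sum>l=-int q..int q. A q l * A p (l + m) ^ CARD('n)))"
    unfolding of_real_sum [symmetric] sum_distrib_left
    by (intro arg_cong [where f = of_real] sum.cong) (auto simp: power_mult_distrib)
  finally show ?thesis .
qed

lemma integrable_\<Phi>: "integrable (rst torus) (\<Phi> p q)"
  by (intro integrable_rst_bounded [where B = 1]) (auto simp: abs_of_nonneg [OF \<Phi>_range(1)] \<Phi>_range(2))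

lemma integral_\<Phi>:
  "(\<integral>\<xi>. \<Phi> p q \<xi> \<partial>rst (torus :: (real ^ 'n) set)) = (2 * pi) ^ CARD('n) * (\<Sum>l=-int q..int q. A q l * A p l ^ CARD('n))"
proof -
  have "complex_of_real (\<integral>\<xi>. \<Phi> p q \<xi> \<partial>rst (torus :: (real ^ 'n) set))
      = of_real ((2 * pi) ^ CARD('n) * (\<Sum>l=-int q..int q. A q l * A p l ^ CARD('n)))"
    using integral_\<Phi>_character [where 'n = 'n, of p q 0] by simp
  then show ?thesis by (simp only: of_real_eq_iff)
qed

text \<open>One of the d factors \<open>A p (l + m)\<close> is summed, with total at most 1; the
  others are replaced by the central value. The bound on \<open>A q l\<close> is asked for only
  where \<open>A p (l + m)\<close> is nonzero, which is what makes high frequencies small.\<close>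

lemma sum_A_power_le:
  assumes "finite I" "\<And>l. l \<in> I \<Longrightarrow> A p (l + m) \<noteq> 0 \<Longrightarrow> A q l \<le> B" "0 \<le> B" "1 \<le> d"
  shows "(\<Sum>l\<in>I. A q l * A p (l + m) ^ d) \<le> B * A p 0 ^ (d - 1)"
proof -
  have "(\<Sum>l\<in>I. A q l * A p (l + m) ^ d) \<le> (\<Sum>l\<in>I. B * A p 0 ^ (d - 1) * A p (l + m))"
  proof (intro sum_mono)
    fix l assume l: "l \<in> I"
    show "A q l * A p (l + m) ^ d \<le> B * A p 0 ^ (d - 1) * A p (l + m)"
    proof (cases "A p (l + m) = 0")
      case True
      then show ?thesis using assms(4) by (simp add: zero_power)
    next
      case False
      have "A q l * A p (l + m) ^ d = A q l * (A p (l + m) ^ (d - 1) * A p (l + m))"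
        using assms(4) by (simp add: power_eq_if mult.commute)
      also have "\<dots> \<le> B * (A p 0 ^ (d - 1) * A p (l + m))"
        using assms(2) [OF l False] assms(3)
        by (intro mult_mono mult_right_mono power_mono A_antimono) auto
      finally show ?thesis by simp
    qed
  qed
  also have "\<dots> = B * A p 0 ^ (d - 1) * (\<Sum>l\<in>I. A p (l + m))" by (simp add: sum_distrib_left)
  also have "(\<Sum>l\<in>I. A p (l + m)) = (\<Sum>l\<in>(\<lambda>l. l + m) ` I. A p l)"
    by (subst sum.reindex) (auto simp: inj_on_def)
  also have "\<dots> \<le> 1" using assms(1) by (intro sum_A_le) auto
  then have "B * A p 0 ^ (d - 1) * (\<Sum>l\<in>(\<lambda>l. l + m) ` I. A p l) \<le> B * A p 0 ^ (d - 1) * 1"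
    using assms(3) by (intro mult_left_mono) auto
  finally show ?thesis by simp
qed

lemma integral_\<Phi>_upper:
  "(\<integral>\<xi>. \<Phi> p q \<xi> \<partial>rst (torus :: (real ^ 'n) set)) \<le> (2 * pi) ^ CARD('n) * (A q 0 * A p 0 ^ (CARD('n) - 1))"
  unfolding integral_\<Phi>
  using sum_A_power_le [of "{-int q..int q}" p 0 q "A q 0" "CARD('n)"]
  by (intro mult_left_mono) (auto simp: A_antimono Suc_leI)

text \<open>A nonzero \<open>A p (l + 2 * int n)\<close> forces |l + 2n| \<le> p \<le> n, hence |l|
  \<ge> n, and there the coefficients of the last bump are at most 1/n. This makes the mean of a
  squared sine close to 1/2.\<close>

lemma integral_\<Phi>_cos:
  assumes n: "1 \<le> n" "p \<le> n"
  shows "\<bar>\<integral>\<xi>. \<Phi> p q \<xi> * cos (c + 2 * real n * shift_sum \<xi>) \<partial>rst (torus :: (real ^ 'n) set)\<bar>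
    \<le> (2 * pi) ^ CARD('n) * (1 / n * A p 0 ^ (CARD('n) - 1))"
proof -
  let ?I = "\<integral>\<xi>. of_real (\<Phi> p q \<xi>) * exp (\<i> * of_int (2 * int n) * of_real (shift_sum \<xi>)) \<partial>rst (torus :: (real ^ 'n) set)"
  have int: "complex_integrable (rst torus) (\<lambda>\<xi> :: real ^ 'n. cis c * (of_real (\<Phi> p q \<xi>) * exp (\<i> * of_int (2 * int n) * of_real (shift_sum \<xi>))))"
    by (intro integrable_mult_right integrable_rst_bounded [where B = 1])
      (simp_all only: norm_mult norm_character, measurable, simp_all add: abs_of_nonneg [OF \<Phi>_range(1)] \<Phi>_range(2))
  have "\<Phi> p q \<xi> * cos (c + 2 * real n * shift_sum \<xi>)
      = Re (cis c * (of_real (\<Phi> p q \<xi>) * exp (\<i> * of_int (2 * int n) * of_real (shift_sum \<xi>))))" for \<xi> :: "real ^ 'n"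
  proof -
    have "cis c * (of_real (\<Phi> p q \<xi>) * exp (\<i> * of_int (2 * int n) * of_real (shift_sum \<xi>)))
      = of_real (\<Phi> p q \<xi>) * (cis c * cis (2 * real n * shift_sum \<xi>))"
      by (simp add: cis_conv_exp mult_ac)
    also have "\<dots> = of_real (\<Phi> p q \<xi>) * cis (c + 2 * real n * shift_sum \<xi>)" by (simp only: cis_mult)
    finally have eq: "cis c * (of_real (\<Phi> p q \<xi>) * exp (\<i> * of_int (2 * int n) * of_real (shift_sum \<xi>)))
      = of_real (\<Phi> p q \<xi>) * cis (c + 2 * real n * shift_sum \<xi>)" .
    show ?thesis unfolding eq by simp
  qed
  then have "(\<integral>\<xi>. \<Phi> p q \<xi> * cos (c + 2 * real n * shift_sum \<xi>) \<partial>rst (torus :: (real ^ 'n) set))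
      = Re (\<integral>\<xi>. cis c * (of_real (\<Phi> p q \<xi>) * exp (\<i> * of_int (2 * int n) * of_real (shift_sum \<xi>))) \<partial>rst (torus :: (real ^ 'n) set))"
    using integral_Re [OF int] by simp
  also have "\<dots> = Re (cis c * ?I)" by simp
  also have "\<bar>\<dots>\<bar> \<le> norm (cis c * ?I)" by (rule abs_Re_le_cmod)
  also have "\<dots> = norm ?I" by (simp add: norm_mult)
  also have "\<dots> = (2 * pi) ^ CARD('n) * (\<Sum>l=-int q..int q. A q l * A p (l + 2 * int n) ^ CARD('n))"
    unfolding integral_\<Phi>_character norm_of_real by (intro abs_of_nonneg mult_nonneg_nonneg sum_nonneg) auto
  also have "\<dots> \<le> (2 * pi) ^ CARD('n) * (1 / n * A p 0 ^ (CARD('n) - 1))"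
  proof (intro mult_left_mono sum_A_power_le)
    fix l assume "A p (l + 2 * int n) \<noteq> 0"
    then have "\<bar>l + 2 * int n\<bar> \<le> int p" using A_eq_0 not_less by blast
    then have "int n \<le> \<bar>l\<bar>" using n by linarith
    then show "A q l \<le> 1 / n" using n by (intro A_le_inverse)
  qed (auto simp: Suc_leI)
  finally show ?thesis .
qed

lemma integral_\<Phi>_lower:
  assumes p: "1 \<le> p" "p \<le> q"
  shows "(2 * pi) ^ CARD('n) * (sqrt (real p / 2) * (A q 0 / 2 * (A p 0 / 2) ^ CARD('n)))
    \<le> (\<integral>\<xi>. \<Phi> p q \<xi> \<partial>rst (torus :: (real ^ 'n) set))"
proof -
  \<comment> \<open>For l up to this threshold l^2 / p is at most 1/2, so \<open>A_ge\<close> keeps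
    at least half of the central coefficient for both \<open>p\<close> and \<open>q\<close>. The L +
    1 terms from 0 to L already give the bound.\<close>
  define L where "L = nat \<lfloor>sqrt (real p / 2)\<rfloor>"
  have L: "real L \<le> sqrt (real p / 2)" "sqrt (real p / 2) \<le> real L + 1"
    unfolding L_def by (auto simp: of_nat_floor)
  have half: "A k 0 / 2 \<le> A k (int l)" if "l \<le> L" "p \<le> k" for k l
  proof -
    have "(real l)\<^sup>2 \<le> (sqrt (real p / 2))\<^sup>2" using that L by (intro power_mono) auto
    then have "(real l)\<^sup>2 \<le> real p / 2" by simp
    also have "\<dots> \<le> real k / 2" using that by simp
    finally have "(real l)\<^sup>2 / k \<le> 1 / 2" using that p by (simp add: divide_simps)
    then have "A k 0 * (1 / 2) \<le> A k 0 * (1 - (real l)\<^sup>2 / k)" by (intro mult_left_mono) auto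
    also have "\<dots> \<le> A k (int l)" using that p by (intro A_ge) auto
    finally show ?thesis by simp
  qed
  have "L \<le> p"
  proof -
    have "sqrt (real p / 2) \<le> sqrt ((real p)\<^sup>2)"
      using p by (intro real_sqrt_le_mono) (auto simp: power2_eq_square divide_simps)
    then show ?thesis using L by simp
  qed
  have "sqrt (real p / 2) * (A q 0 / 2 * (A p 0 / 2) ^ CARD('n)) \<le> (real L + 1) * (A q 0 / 2 * (A p 0 / 2) ^ CARD('n))"
    using L by (intro mult_right_mono) auto
  also have "\<dots> = (\<Sum>l\<le>L. A q 0 / 2 * (A p 0 / 2) ^ CARD('n))" by simp
  also have "\<dots> \<le> (\<Sum>l\<le>L. A q (int l) * A p (int l) ^ CARD('n))"
    using p half by (intro sum_mono mult_mono power_mono) auto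
  also have "\<dots> = (\<Sum>l\<in>int ` {..L}. A q l * A p l ^ CARD('n))"
    by (subst sum.reindex) auto
  also have "\<dots> \<le> (\<Sum>l=-int q..int q. A q l * A p l ^ CARD('n))"
    using p \<open>L \<le> p\<close> by (intro sum_mono2) auto
  finally show ?thesis unfolding integral_\<Phi> by (intro mult_left_mono) auto
qed

section \<open>The lower bound\<close>

text \<open>The r + 1 copies of \<open>y ^ r\<close> are at most the geometric sum, which times 1 -
  y telescopes.\<close>

lemma one_minus_mult_power_le:
  fixes y :: real
  assumes "0 \<le> y" "y \<le> 1"
  shows "(1 - y) * y ^ r \<le> 1 / (real r + 1)"
proof -
  have "(real r + 1) * y ^ r = (\<Sum>k\<le>r. y ^ r)" by simp
  also have "\<dots> \<le> (\<Sum>k\<le>r. y ^ k)"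
    using assms by (intro sum_mono power_decreasing) auto
  finally have "(1 - y) * ((real r + 1) * y ^ r) \<le> (1 - y) * (\<Sum>k\<le>r. y ^ k)"
    using assms by (intro mult_left_mono) auto
  also have "\<dots> = 1 - y ^ Suc r"
    using sum_gp_basic [of y r] by simp
  also have "\<dots> \<le> 1" using assms by simp
  finally have "(1 - y) * y ^ r * (real r + 1) \<le> 1" by (simp add: mult_ac)
  then show ?thesis by (subst pos_le_divide_eq) auto
qed

text \<open>With u half the distance from \<pi>/2, the right factor is sin(u)^2 and u is at most
  3\<pi>/4. The bound sin u \<ge> u/6 is forced by the far end: (\<pi> - u)/2 \<ge> u/6 holds
  exactly up to 3\<pi>/4. Then 144 = 4 * 36.\<close>

lemma square_le_bump:
  assumes "x \<in> {-pi..pi}" shows "(x - pi / 2)\<^sup>2 \<le> 144 * (1 - bump (x - pi / 2))"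
proof -
  define u where "u = \<bar>x - pi / 2\<bar> / 2"
  have "- pi \<le> x" "x \<le> pi" using assms by auto
  then have "\<bar>x - pi / 2\<bar> \<le> 3 * (pi / 2)" by (intro abs_leI) linarith+
  then have u: "0 \<le> u" "u \<le> 3 * pi / 4" by (auto simp: u_def)
  have "u / 6 \<le> sin u"
  proof (cases "u \<le> pi / 2")
    case True
    then show ?thesis using sin_ge_half [OF u(1)] u(1) by simp
  next
    case False
    have "(pi - u) / 2 \<le> sin (pi - u)" using False u by (intro sin_ge_half) auto
    then show ?thesis using u by (simp add: field_simps)
  qed
  then have "(u / 6)\<^sup>2 \<le> (sin u)\<^sup>2" using u by (intro power_mono) auto
  moreover have "cos (2 * u) = cos (x - pi / 2)" by (simp add: u_def)
  then have "1 - bump (x - pi / 2) = (sin u)\<^sup>2"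
    unfolding bump_def using cos_double_sin [of u] by (simp add: field_simps)
  moreover have "(x - pi / 2)\<^sup>2 = 4 * u\<^sup>2" by (simp add: u_def power_divide)
  ultimately show ?thesis by (simp add: power_divide)
qed

text \<open>Each of k blocks of r factors absorbs one squared distance at cost 144 / r. The last
  block is kept, so the result can still be integrated over the box.\<close>

lemma bump_power_moment:
  assumes x: "x \<in> {-pi..pi}" and r: "1 \<le> r"
  shows "bump (x - pi / 2) ^ (k * r + r) * ((x - pi / 2)\<^sup>2) ^ k \<le> (144 / r) ^ k * bump (x - pi / 2) ^ r"
proof -
  let ?y = "bump (x - pi / 2)"
  have "(1 - ?y) * ?y ^ r \<le> 1 / (real r + 1)" by (rule one_minus_mult_power_le) auto
  also have "\<dots> \<le> 1 / r" using r by (intro divide_left_mono) auto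
  finally have "144 * ((1 - ?y) * ?y ^ r) \<le> 144 / r" by simp
  moreover have "(x - pi / 2)\<^sup>2 * ?y ^ r \<le> 144 * ((1 - ?y) * ?y ^ r)"
    unfolding mult.assoc [symmetric] using square_le_bump [OF x] by (intro mult_right_mono) auto
  ultimately have "(x - pi / 2)\<^sup>2 * ?y ^ r \<le> 144 / r" by (rule order_trans [rotated])
  then have "((x - pi / 2)\<^sup>2 * ?y ^ r) ^ k \<le> (144 / r) ^ k" by (intro power_mono) auto
  then have "((x - pi / 2)\<^sup>2 * ?y ^ r) ^ k * ?y ^ r \<le> (144 / r) ^ k * ?y ^ r" by (intro mult_right_mono) auto
  then show ?thesis by (simp add: power_mult_distrib power_add power_mult mult_ac) (metis power_mult mult.commute)
qed

text \<open>The third moment measures the error of replacing a sine by its argument; it is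
  interpolated between the second and the fourth.\<close>

lemma bump_power_moment_cubic:
  assumes x: "x \<in> {-pi..pi}" and r: "1 \<le> r"
  shows "bump (x - pi / 2) ^ (4 * r) * \<bar>x - pi / 2\<bar> ^ 3 \<le> 144 ^ 2 / (r * sqrt r) * bump (x - pi / 2) ^ r"
proof -
  let ?y = "bump (x - pi / 2)"
  define e where "e = \<bar>x - pi / 2\<bar>"
  have e: "0 \<le> e" "(x - pi / 2)\<^sup>2 = e\<^sup>2" by (auto simp: e_def)
  have s: "0 < sqrt r" "sqrt r * sqrt r = r" using r by auto
  have m1: "?y ^ (4 * r) * e\<^sup>2 \<le> 144 / r * ?y ^ r"
  proof -
    have "?y ^ (4 * r) * e\<^sup>2 \<le> ?y ^ (1 * r + r) * e\<^sup>2"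
      by (intro mult_right_mono power_decreasing) auto
    also have "\<dots> \<le> 144 / r * ?y ^ r" using bump_power_moment [OF x r, of 1] e by simp
    finally show ?thesis .
  qed
  have m2: "?y ^ (4 * r) * (e\<^sup>2)\<^sup>2 \<le> (144 / r)\<^sup>2 * ?y ^ r"
  proof -
    have "?y ^ (4 * r) * (e\<^sup>2)\<^sup>2 \<le> ?y ^ (2 * r + r) * (e\<^sup>2)\<^sup>2"
      by (intro mult_right_mono power_decreasing) auto
    also have "\<dots> \<le> (144 / r)\<^sup>2 * ?y ^ r" using bump_power_moment [OF x r, of 2] e by simp
    finally show ?thesis .
  qed
  \<comment> \<open>AM-GM: \<open>2 e \<le> 1 / \<surd>r + \<surd>r e\<^sup>2\<close>\<close>
  have "2 * e * sqrt r \<le> 1 + (e * sqrt r)\<^sup>2"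
    using zero_le_power2 [of "1 - e * sqrt r"] by (simp add: power2_diff)
  then have "e \<le> (1 / sqrt r + sqrt r * e\<^sup>2) / 2"
    using s(1) by (simp add: field_simps power2_eq_square)
  then have "e\<^sup>2 * e \<le> e\<^sup>2 * ((1 / sqrt r + sqrt r * e\<^sup>2) / 2)" by (intro mult_left_mono) auto
  then have "e ^ 3 \<le> (e\<^sup>2 / sqrt r + sqrt r * (e\<^sup>2)\<^sup>2) / 2"
    by (simp add: power2_eq_square power3_eq_cube algebra_simps add_divide_distrib)
  then have "?y ^ (4 * r) * e ^ 3 \<le> ?y ^ (4 * r) * ((e\<^sup>2 / sqrt r + sqrt r * (e\<^sup>2)\<^sup>2) / 2)"
    by (intro mult_left_mono) auto
  also have "\<dots> = ((?y ^ (4 * r) * e\<^sup>2) * (1 / sqrt r) + (?y ^ (4 * r) * (e\<^sup>2)\<^sup>2) * sqrt r) / 2"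
    by (simp add: field_simps)
  also have "\<dots> \<le> ((144 / r * ?y ^ r) * (1 / sqrt r) + ((144 / r)\<^sup>2 * ?y ^ r) * sqrt r) / 2"
    using m1 m2 by (intro divide_right_mono add_mono mult_right_mono) auto
  also have "\<dots> = (144 + 144\<^sup>2) / 2 / (r * sqrt r) * ?y ^ r"
  proof -
    have "(144 / real r)\<^sup>2 * sqrt r = 144\<^sup>2 / (r * sqrt r)"
      using s r by (simp add: power_divide power2_eq_square divide_simps)
    then have "((144 / real r)\<^sup>2 * ?y ^ r) * sqrt r = ?y ^ r * (144\<^sup>2 / (r * sqrt r))"
      by (metis mult.assoc mult.commute)
    moreover have "(144 / r * ?y ^ r) * (1 / sqrt r) = ?y ^ r * (144 / (r * sqrt r))" by simp
    ultimately have "((144 / r * ?y ^ r) * (1 / sqrt r) + ((144 / r)\<^sup>2 * ?y ^ r) * sqrt r) / 2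
        = (?y ^ r * (144 / (r * sqrt r)) + ?y ^ r * (144\<^sup>2 / (r * sqrt r))) / 2" by (simp only:)
    then show ?thesis by (simp add: field_simps)
  qed
  also have "\<dots> \<le> 144 ^ 2 / (r * sqrt r) * ?y ^ r"
    using s by (intro mult_right_mono divide_right_mono) auto
  finally show ?thesis by (simp add: e_def)
qed

text \<open>Only the j-th factor spends its surplus powers on the moment; in the others the
  exponents are merely lowered. Errors are thus measured by \<open>\<Phi> r s\<close>, whose
  integral is comparable to that of \<open>\<Phi> (4 * r) (2 * s)\<close>.\<close>

lemma \<Phi>_le_factor:
  fixes \<xi> :: "real ^ 'n"
  assumes "bump (\<xi> $ j - pi / 2) ^ (4 * r) * a \<le> b * bump (\<xi> $ j - pi / 2) ^ r" "0 \<le> a" "0 \<le> b"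
  shows "\<Phi> (4 * r) (2 * s) \<xi> * a \<le> b * \<Phi> r s \<xi>"
proof -
  let ?y = "\<lambda>i. bump (\<xi> $ i - pi / 2)"
  have "\<Phi> (4 * r) (2 * s) \<xi> * a
      = (?y j ^ (4 * r) * a) * ((\<Prod>i\<in>UNIV - {j}. ?y i ^ (4 * r)) * bump (shift_sum \<xi>) ^ (2 * s))"
    unfolding \<Phi>_def by (subst prod.remove [of _ j]) (auto simp: mult_ac)
  also have "\<dots> \<le> (b * ?y j ^ r) * ((\<Prod>i\<in>UNIV - {j}. ?y i ^ r) * bump (shift_sum \<xi>) ^ s)"
    using assms
    by (intro mult_mono assms(1) prod_mono conjI power_decreasing prod_nonneg mult_nonneg_nonneg) auto
  also have "\<dots> = b * \<Phi> r s \<xi>"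
    unfolding \<Phi>_def by (subst (2) prod.remove [of _ j]) (auto simp: mult_ac)
  finally show ?thesis .
qed

lemma \<Phi>_le_last:
  fixes \<xi> :: "real ^ 'n"
  assumes s: "1 \<le> s"
  shows "\<Phi> (4 * r) (2 * s) \<xi> * (1 - cos (shift_sum \<xi>)) \<le> 2 / s * \<Phi> r s \<xi>"
proof -
  let ?y = "\<lambda>i. bump (\<xi> $ i - pi / 2)" and ?Y = "bump (shift_sum \<xi>)"
  have "(1 - ?Y) * ?Y ^ s \<le> 1 / (real s + 1)" by (rule one_minus_mult_power_le) auto
  also have "\<dots> \<le> 1 / s" using s by (intro divide_left_mono) auto
  finally have "2 * ((1 - ?Y) * ?Y ^ s) * ?Y ^ s \<le> 2 * (1 / s) * ?Y ^ s" by (intro mult_right_mono) auto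
  moreover have "2 * ((1 - ?Y) * ?Y ^ s) * ?Y ^ s = ?Y ^ (2 * s) * (1 - cos (shift_sum \<xi>))"
  proof -
    have "1 - cos (shift_sum \<xi>) = 2 * (1 - ?Y)" by (simp add: bump_def field_simps)
    moreover have "?Y ^ (2 * s) = ?Y ^ s * ?Y ^ s" by (simp add: mult_2 power_add)
    ultimately show ?thesis by (simp only: mult_ac)
  qed
  ultimately have *: "?Y ^ (2 * s) * (1 - cos (shift_sum \<xi>)) \<le> 2 / s * ?Y ^ s" by simp
  have "\<Phi> (4 * r) (2 * s) \<xi> * (1 - cos (shift_sum \<xi>))
      = (\<Prod>i\<in>UNIV. ?y i ^ (4 * r)) * (?Y ^ (2 * s) * (1 - cos (shift_sum \<xi>)))"
    by (simp add: \<Phi>_def)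
  also have "\<dots> \<le> (\<Prod>i\<in>UNIV. ?y i ^ r) * (2 / s * ?Y ^ s)"
    by (intro mult_mono * prod_mono conjI power_decreasing prod_nonneg mult_nonneg_nonneg) auto
  also have "\<dots> = 2 / s * \<Phi> r s \<xi>" by (simp add: \<Phi>_def)
  finally show ?thesis .
qed

lemma \<Phi>_mono: "\<Phi> (4 * r) (2 * s) \<xi> \<le> \<Phi> r s \<xi>"
  unfolding \<Phi>_def by (intro mult_mono prod_mono conjI power_decreasing prod_nonneg) auto

section \<open>Linearization of \<omega> around (\<pi>/2, ..., \<pi>/2)\<close>

definition sine_sum :: "real ^ 'n \<Rightarrow> real" where
  "sine_sum \<xi> = (\<Sum>j\<in>UNIV. sin (\<xi> $ j - pi / 2))"

lemma sine_sum_measurable [measurable]: "sine_sum \<in> borel_measurable borel"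
  unfolding sine_sum_def [abs_def] by measurable

lemma \<omega>_square_sine_sum: "(\<omega> (\<xi> :: real ^ 'n))\<^sup>2 = 2 * CARD('n) + 2 * sine_sum \<xi>"
proof -
  have "2 - 2 * cos x = 2 + 2 * sin (x - pi / 2)" for x :: real by (simp add: sin_diff)
  then show ?thesis unfolding \<omega>_square sine_sum_def sum_distrib_left by (simp only: sum.distrib) simp
qed

lemma abs_sine_sum_le: "\<bar>sine_sum (\<xi> :: real ^ 'n)\<bar> \<le> CARD('n)"
proof -
  have "\<bar>sine_sum \<xi>\<bar> \<le> (\<Sum>j\<in>(UNIV :: 'n set). 1)"
    unfolding sine_sum_def by (intro order_trans [OF sum_abs] sum_mono) auto
  then show ?thesis by simp
qed

lemma shift_sum_minus_sine_sum:
  "\<bar>shift_sum \<xi> - sine_sum \<xi>\<bar> \<le> (\<Sum>j\<in>UNIV. \<bar>\<xi> $ j - pi / 2\<bar> ^ 3)"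
proof -
  have "\<bar>shift_sum \<xi> - sine_sum \<xi>\<bar> \<le> (\<Sum>j\<in>UNIV. \<bar>(\<xi> $ j - pi / 2) - sin (\<xi> $ j - pi / 2)\<bar>)"
    unfolding shift_sum_def sine_sum_def sum_subtractf [symmetric] by (rule sum_abs)
  also have "\<dots> \<le> (\<Sum>j\<in>UNIV. \<bar>\<xi> $ j - pi / 2\<bar> ^ 3)"
  proof (intro sum_mono)
    fix j
    show "\<bar>(\<xi> $ j - pi / 2) - sin (\<xi> $ j - pi / 2)\<bar> \<le> \<bar>\<xi> $ j - pi / 2\<bar> ^ 3"
      using abs_sin_minus_self_le [of "\<xi> $ j - pi / 2"] zero_le_power [of "\<bar>\<xi> $ j - pi / 2\<bar>" 3] by linarith
  qed
  finally show ?thesis .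
qed

lemma one_minus_cos_ge:
  assumes "\<bar>x :: real\<bar> \<le> 1" shows "x\<^sup>2 / 8 \<le> 1 - cos x"
proof -
  have "\<bar>x\<bar> / 2 / 2 \<le> sin (\<bar>x\<bar> / 2)" using assms pi_gt3 by (intro sin_ge_half) auto
  then have "(\<bar>x\<bar> / 2 / 2)\<^sup>2 \<le> (sin (\<bar>x\<bar> / 2))\<^sup>2" by (intro power_mono) auto
  moreover have "cos x = 1 - 2 * (sin (\<bar>x\<bar> / 2))\<^sup>2"
    using cos_double_sin [of "\<bar>x\<bar> / 2"] by simp
  ultimately show ?thesis by (simp add: power_divide)
qed

text \<open>The last bump sees \<open>shift_sum\<close> only modulo 2 \<pi>. If the distances
  \<open>e j\<close> add up to at most 1, no wrapping occurs: \<open>1 - cos\<close> controls the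
  squared sum, and the cubic remainder is handled by Cauchy-Schwarz. Otherwise some
  \<open>e j\<close> is at least 1/d, and its sixth power times d^8 exceeds the trivial bound
  d^2.\<close>

lemma sine_sum_square_le:
  fixes \<xi> :: "real ^ 'n"
  defines "d \<equiv> real CARD('n)"
  shows "(sine_sum \<xi>)\<^sup>2 \<le> (d ^ 8 + 2 * d + 16) * ((1 - cos (shift_sum \<xi>)) + (\<Sum>j\<in>UNIV. ((\<xi> $ j - pi / 2)\<^sup>2) ^ 3))"
proof -
  define e where "e = (\<lambda>j. \<bar>\<xi> $ j - pi / 2\<bar>)"
  have d: "1 \<le> d" by (simp add: d_def Suc_leI)
  have e0: "0 \<le> e j" for j by (simp add: e_def)
  let ?Q = "\<Sum>j\<in>UNIV. e j ^ 6"
  have Q: "(\<Sum>j\<in>UNIV. ((\<xi> $ j - pi / 2)\<^sup>2) ^ 3) = ?Q"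
    by (simp add: e_def flip: power_mult)
  have Q0: "0 \<le> ?Q" by (intro sum_nonneg) (simp add: e0)
  have c0: "0 \<le> 1 - cos (shift_sum \<xi>)" by simp
  have "(sine_sum \<xi>)\<^sup>2 \<le> 16 * (1 - cos (shift_sum \<xi>)) + (d ^ 8 + 2 * d) * ?Q"
  proof (cases "(\<Sum>j\<in>UNIV. e j) \<le> 1")
    case True
    have "\<bar>shift_sum \<xi>\<bar> \<le> (\<Sum>j\<in>UNIV. e j)"
      unfolding shift_sum_def e_def by (rule sum_abs)
    then have S: "(shift_sum \<xi>)\<^sup>2 \<le> 8 * (1 - cos (shift_sum \<xi>))"
      using one_minus_cos_ge [of "shift_sum \<xi>"] True by simp
    define X where "X = shift_sum \<xi> - sine_sum \<xi>"
    have "\<bar>X\<bar> \<le> (\<Sum>j\<in>UNIV. e j ^ 3)"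
      unfolding X_def e_def by (rule shift_sum_minus_sine_sum)
    then have "X\<^sup>2 \<le> (\<Sum>j\<in>UNIV. e j ^ 3)\<^sup>2"
      by (metis abs_ge_zero power2_abs power_mono)
    also have "\<dots> \<le> d * (\<Sum>j\<in>UNIV. (e j ^ 3)\<^sup>2)"
      using Cauchy_Schwarz_ineq_sum [of "\<lambda>_. 1" "\<lambda>j. e j ^ 3" "UNIV :: 'n set"] by (simp add: d_def)
    also have "\<dots> = d * ?Q" by (simp flip: power_mult)
    finally have X: "X\<^sup>2 \<le> d * ?Q" .
    have "sine_sum \<xi> = shift_sum \<xi> - X" by (simp add: X_def)
    then have "(sine_sum \<xi>)\<^sup>2 \<le> 2 * (shift_sum \<xi>)\<^sup>2 + 2 * X\<^sup>2"
      using zero_le_power2 [of "shift_sum \<xi> + X"] by (simp add: power2_sum power2_diff)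
    also have "\<dots> \<le> 16 * (1 - cos (shift_sum \<xi>)) + 2 * d * ?Q" using S X by simp
    also have "\<dots> \<le> 16 * (1 - cos (shift_sum \<xi>)) + (d ^ 8 + 2 * d) * ?Q"
      using d Q0 by (intro add_left_mono mult_right_mono) auto
    finally show ?thesis .
  next
    case False
    have "\<exists>j. 1 / d \<le> e j"
    proof (rule ccontr)
      assume "\<nexists>j. 1 / d \<le> e j"
      then have "(\<Sum>j\<in>UNIV. e j) \<le> (\<Sum>j\<in>(UNIV :: 'n set). 1 / d)"
        by (intro sum_mono) (auto simp: not_le less_imp_le)
      also have "\<dots> = 1" by (simp add: d_def)
      finally show False using False by simp
    qed
    then obtain j where "1 / d \<le> e j" by blast
    then have "(1 / d) ^ 6 \<le> e j ^ 6" using d by (intro power_mono) auto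
    also have "\<dots> \<le> ?Q" by (rule member_le_sum) (auto simp: e0)
    finally have "d ^ 8 * (1 / d) ^ 6 \<le> d ^ 8 * ?Q" using d by (intro mult_left_mono) auto
    moreover have "d ^ 8 * (1 / d) ^ 6 = d\<^sup>2" 
    proof -
      have "d ^ 8 * (1 / d) ^ 6 = d\<^sup>2 * (d * (1 / d)) ^ 6"
        by (simp only: power_mult_distrib mult.assoc [symmetric] power_add [symmetric]) simp
      then show ?thesis using d by simp
    qed
    moreover have "(sine_sum \<xi>)\<^sup>2 \<le> d\<^sup>2"
      using abs_sine_sum_le [of \<xi>] unfolding d_def by (metis abs_ge_zero power2_abs power_mono)
    ultimately have "(sine_sum \<xi>)\<^sup>2 \<le> d ^ 8 * ?Q" by simp
    moreover have "0 \<le> 16 * (1 - cos (shift_sum \<xi>))" "0 \<le> 2 * d * ?Q" using c0 d Q0 by auto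
    ultimately show ?thesis unfolding distrib_right by linarith
  qed
  also have "\<dots> \<le> (d ^ 8 + 2 * d + 16) * (1 - cos (shift_sum \<xi>)) + (d ^ 8 + 2 * d + 16) * ?Q"
  proof (rule add_mono)
    have "0 \<le> d ^ 8" using d by simp
    then show "16 * (1 - cos (shift_sum \<xi>)) \<le> (d ^ 8 + 2 * d + 16) * (1 - cos (shift_sum \<xi>))"
      using d c0 by (intro mult_right_mono) linarith+
    show "(d ^ 8 + 2 * d) * ?Q \<le> (d ^ 8 + 2 * d + 16) * ?Q"
      using Q0 by (intro mult_right_mono) linarith+
  qed
  finally show ?thesis unfolding Q distrib_left .
qed

lemma sin_diff_abs_le: "\<bar>sin x - sin y\<bar> \<le> \<bar>x - y :: real\<bar>"
proof -
  have "\<bar>sin x - sin y\<bar> = 2 * \<bar>sin ((x - y) / 2)\<bar> * \<bar>cos ((x + y) / 2)\<bar>"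
    by (simp add: sin_diff_sin abs_mult)
  also have "\<dots> \<le> 2 * \<bar>(x - y) / 2\<bar> * 1"
    by (intro mult_mono mult_left_mono abs_sin_x_le_abs_x) auto
  finally show ?thesis by simp
qed

text \<open>\<open>\<theta>\<close> is the affine model of \<open>t * \<omega> \<xi>\<close>, with
  slope t / sqrt(2d) replaced by a nearby integer \<open>n\<close> so that its sine is a
  trigonometric polynomial. In the constant, \<open>2 * sqrt d\<close> bounds \<omega> in front of
  the phase error, and 1 pays for replacing \<omega> by sqrt(2d).\<close>

lemma wave_product_ge:
  fixes \<xi> :: "real ^ 'n" and t :: real and n :: nat
  defines "d \<equiv> real CARD('n)"
  assumes t: "0 \<le> t" and n: "real n \<le> t / sqrt (2 * d)" "t / sqrt (2 * d) - 1 \<le> real n" and d2: "2 \<le> CARD('n)"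
  defines "\<theta> \<equiv> t * sqrt (2 * d) + real n * shift_sum \<xi>"
  shows "sqrt (2 * d) * (sin \<theta>)\<^sup>2 - (1 + 2 * sqrt d) * (t * (sine_sum \<xi>)\<^sup>2 + \<bar>sine_sum \<xi>\<bar>
      + t * (\<Sum>j\<in>UNIV. \<bar>\<xi> $ j - pi / 2\<bar> ^ 3))
    \<le> \<omega> \<xi> * sin (t * \<omega> \<xi>) * sin \<theta>"
proof -
  define R where "R = sine_sum \<xi>"
  define Q where "Q = (\<Sum>j\<in>UNIV. \<bar>\<xi> $ j - pi / 2\<bar> ^ 3)"
  define D where "D = sqrt (2 * d)"
  define w where "w = \<omega> \<xi>"
  have d: "2 \<le> d" using d2 by (simp add: d_def)
  have D: "2 \<le> D" "D * D = 2 * d"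
    using d real_sqrt_le_mono [of 4 "2 * d"] by (simp_all add: D_def)
  have w0: "0 \<le> w" by (simp add: w_def)
  have ww: "w * w = D * D + 2 * R"
    using \<omega>_square_sine_sum [of \<xi>] by (simp add: w_def R_def D d_def power2_eq_square)
  have "(w - D) * (w + D) = 2 * R" using ww by (simp add: algebra_simps)
  then have wD: "w - D = 2 * R / (w + D)" using w0 D by (simp add: nonzero_eq_divide_eq)
  have absw: "\<bar>w - D\<bar> \<le> \<bar>R\<bar>"
  proof -
    have "\<bar>w - D\<bar> = 2 * \<bar>R\<bar> / (w + D)" unfolding wD using w0 D by (simp add: abs_mult)
    also have "\<dots> \<le> 2 * \<bar>R\<bar> / 2" using w0 D by (intro divide_left_mono) auto
    finally show ?thesis by simp
  qed
  have lin: "\<bar>w - D - R / D\<bar> \<le> R\<^sup>2"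
  proof -
    have "w - D - R / D = R * (D - w) / (D * (w + D))"
      unfolding wD using w0 D by (simp add: divide_simps) (simp add: algebra_simps)
    then have "\<bar>w - D - R / D\<bar> = \<bar>R\<bar> * \<bar>w - D\<bar> / (D * (w + D))"
      using w0 D by (simp add: abs_mult abs_minus_commute)
    also have "\<dots> \<le> \<bar>R\<bar> * \<bar>R\<bar> / 1"
    proof (intro frac_le mult_mono absw)
      have "1 * 1 \<le> D * (w + D)" using w0 D by (intro mult_mono) auto
      then show "1 \<le> D * (w + D)" by simp
    qed auto
    finally show ?thesis by (simp add: power2_eq_square)
  qed
  have Q0: "0 \<le> Q" unfolding Q_def by (intro sum_nonneg) auto
  have nt: "real n \<le> t"
  proof -
    have "t / D \<le> t / 1" using D t by (intro divide_left_mono) auto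
    then show ?thesis using n(1) by (simp add: D_def)
  qed
  \<comment> \<open>Three errors: the quadratic remainder of the square root, the rounding of
    \<open>t / D\<close> to \<open>n\<close> (at most 1), and the cubic difference between
    \<open>sine_sum\<close> and \<open>shift_sum\<close>.\<close>
  have ph: "\<bar>t * w - \<theta>\<bar> \<le> t * R\<^sup>2 + \<bar>R\<bar> + t * Q"
  proof -
    have "t * w - \<theta> = t * (w - D - R / D) + (t / D - real n) * R + real n * (R - shift_sum \<xi>)"
    proof -
      have "\<theta> = t * D + real n * shift_sum \<xi>" by (simp add: \<theta>_def D_def)
      then show ?thesis by (simp add: algebra_simps)
    qed
    moreover have "\<bar>x + y + z\<bar> \<le> \<bar>x\<bar> + \<bar>y\<bar> + \<bar>z\<bar>" for x y z :: real by linarith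
    ultimately have "\<bar>t * w - \<theta>\<bar> \<le> \<bar>t * (w - D - R / D)\<bar> + \<bar>(t / D - real n) * R\<bar> + \<bar>real n * (R - shift_sum \<xi>)\<bar>"
      by metis
    also have "\<bar>t * (w - D - R / D)\<bar> \<le> t * R\<^sup>2"
      unfolding abs_mult using t lin by (simp add: mult_left_mono)
    also have "\<bar>(t / D - real n) * R\<bar> \<le> 1 * \<bar>R\<bar>"
      unfolding abs_mult using n by (intro mult_right_mono) (auto simp: D_def)
    also have "\<bar>real n * (R - shift_sum \<xi>)\<bar> \<le> t * Q"
      unfolding abs_mult using nt shift_sum_minus_sine_sum [of \<xi>] t
      by (intro mult_mono) (auto simp: R_def Q_def abs_minus_commute)
    finally show ?thesis by simp
  qed
  have wle: "w \<le> 2 * sqrt d"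
    using \<omega>_le [of \<xi>] by (simp add: w_def d_def real_sqrt_mult)
  have E0: "0 \<le> t * R\<^sup>2 + \<bar>R\<bar> + t * Q" using t Q0 by simp
  have "w * (sin \<theta>)\<^sup>2 - w * sin (t * w) * sin \<theta> = w * sin \<theta> * (sin \<theta> - sin (t * w))"
    by (simp add: power2_eq_square algebra_simps)
  also have "\<dots> \<le> \<bar>w * sin \<theta> * (sin \<theta> - sin (t * w))\<bar>" by simp
  also have "\<dots> = w * \<bar>sin \<theta>\<bar> * \<bar>sin \<theta> - sin (t * w)\<bar>" using w0 by (simp add: abs_mult)
  also have "\<dots> \<le> 2 * sqrt d * 1 * (t * R\<^sup>2 + \<bar>R\<bar> + t * Q)"
  proof (intro mult_mono)
    show "\<bar>sin \<theta> - sin (t * w)\<bar> \<le> t * R\<^sup>2 + \<bar>R\<bar> + t * Q"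
      using sin_diff_abs_le [of \<theta> "t * w"] ph by (simp add: abs_minus_commute)
  qed (use w0 wle d in auto)
  finally have 1: "w * (sin \<theta>)\<^sup>2 - 2 * sqrt d * (t * R\<^sup>2 + \<bar>R\<bar> + t * Q) \<le> w * sin (t * w) * sin \<theta>" by simp
  have "(D - w) * (sin \<theta>)\<^sup>2 \<le> \<bar>R\<bar> * 1"
    using absw by (intro mult_mono) (auto simp: abs_square_le_1)
  moreover have "\<bar>R\<bar> \<le> t * R\<^sup>2 + \<bar>R\<bar> + t * Q" using t Q0 by simp
  ultimately have "D * (sin \<theta>)\<^sup>2 - (t * R\<^sup>2 + \<bar>R\<bar> + t * Q) \<le> w * (sin \<theta>)\<^sup>2" by (simp add: left_diff_distrib)
  moreover have "p - (1 + k) * E \<le> q" if "p - E \<le> b" "b - k * E \<le> q" for p E k b q :: real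
    using that by (simp add: distrib_right)
  ultimately show ?thesis using 1 unfolding R_def Q_def D_def w_def by blast
qed

lemma \<Phi>_sine_sum_square_le:
  fixes \<xi> :: "real ^ 'n"
  defines "d \<equiv> real CARD('n)"
  assumes \<xi>: "\<xi> \<in> torus" and r: "1 \<le> r" and s: "1 \<le> s"
  shows "\<Phi> (4 * r) (2 * s) \<xi> * (sine_sum \<xi>)\<^sup>2
    \<le> (d ^ 8 + 2 * d + 16) * (2 / s + d * (144 / r) ^ 3) * \<Phi> r s \<xi>"
proof -
  let ?m = "\<Phi> (4 * r) (2 * s) \<xi>" and ?U = "\<Phi> r s \<xi>" and ?C = "d ^ 8 + 2 * d + 16"
  have C: "0 \<le> ?C" by (simp add: d_def)
  have j: "?m * ((\<xi> $ j - pi / 2)\<^sup>2) ^ 3 \<le> (144 / r) ^ 3 * ?U" for j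
  proof (rule \<Phi>_le_factor)
    show "bump (\<xi> $ j - pi / 2) ^ (4 * r) * ((\<xi> $ j - pi / 2)\<^sup>2) ^ 3 \<le> (144 / r) ^ 3 * bump (\<xi> $ j - pi / 2) ^ r"
      using bump_power_moment [of "\<xi> $ j" r 3] \<xi> r by (simp add: mem_torus)
  qed auto
  have "?m * (sine_sum \<xi>)\<^sup>2 \<le> ?m * (?C * ((1 - cos (shift_sum \<xi>)) + (\<Sum>j\<in>UNIV. ((\<xi> $ j - pi / 2)\<^sup>2) ^ 3)))"
    unfolding d_def by (intro mult_left_mono sine_sum_square_le \<Phi>_range)
  also have "\<dots> = ?C * (?m * (1 - cos (shift_sum \<xi>)) + (\<Sum>j\<in>UNIV. ?m * ((\<xi> $ j - pi / 2)\<^sup>2) ^ 3))"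
    by (subst mult.left_commute) (simp only: distrib_left sum_distrib_left)
  also have "\<dots> \<le> ?C * (2 / s * ?U + (\<Sum>j\<in>(UNIV :: 'n set). (144 / r) ^ 3 * ?U))"
    by (intro mult_left_mono add_mono sum_mono j \<Phi>_le_last s C)
  also have "\<dots> = ?C * (2 / s + d * (144 / r) ^ 3) * ?U" by (simp add: d_def algebra_simps)
  finally show ?thesis .
qed

text \<open>The choices r \<ge> K t^(2/3) and s \<ge> K t make t/s, t r^(-3/2) and t r^(-3) all
  O(1/K), so every error of \<open>wave_product_ge\<close> is at most a constant over K times
  \<open>\<Phi> r s\<close>.\<close>

lemma \<Phi>_wave_product_ge:
  fixes \<xi> :: "real ^ 'n" and t K :: real and n r s :: nat
  defines "d \<equiv> real CARD('n)"
  assumes \<xi>: "\<xi> \<in> torus" and d2: "2 \<le> CARD('n)"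
    and n: "real n \<le> t / sqrt (2 * d)" "t / sqrt (2 * d) - 1 \<le> real n"
    and K: "1 \<le> K" "K\<^sup>2 \<le> t" and r: "K * t powr (2/3) \<le> r" and s: "K * t \<le> s"
  defines "\<theta> \<equiv> t * sqrt (2 * d) + real n * shift_sum \<xi>"
  defines "C \<equiv> (1 + 2 * sqrt d) * (2 * (d ^ 8 + 2 * d + 16) * (2 + d * 144 ^ 3) + 1 + d * 144\<^sup>2)"
  shows "sqrt (2 * d) * (\<Phi> (4 * r) (2 * s) \<xi> * (sin \<theta>)\<^sup>2) - C / K * \<Phi> r s \<xi>
    \<le> \<Phi> (4 * r) (2 * s) \<xi> * (\<omega> \<xi> * sin (t * \<omega> \<xi>) * sin \<theta>)"
proof -
  let ?m = "\<Phi> (4 * r) (2 * s) \<xi>" and ?U = "\<Phi> r s \<xi>" and ?D = "d ^ 8 + 2 * d + 16"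
  define R where "R = sine_sum \<xi>"
  define Q where "Q = (\<Sum>j\<in>UNIV. \<bar>\<xi> $ j - pi / 2\<bar> ^ 3)"
  have m: "0 \<le> ?m" and U: "0 \<le> ?U" by (rule \<Phi>_range)+
  have d: "2 \<le> d" using d2 by (simp add: d_def)
  have "1 \<le> K\<^sup>2" using K(1) by simp
  then have t: "1 \<le> t" using K(2) by linarith
  have st: "K \<le> sqrt t" using K by (intro real_le_rsqrt) auto
  define T where "T = t powr (2/3)"
  have T: "1 \<le> T" using t by (simp add: T_def ge_one_powr_ge_zero)
  have TT: "T * sqrt T = t" "t \<le> T ^ 3"
  proof -
    have "T * sqrt T = t powr (2/3) * t powr (1/3)"
      using t by (simp add: T_def powr_half_sqrt [symmetric] powr_powr)
    also have "\<dots> = t" using t by (simp flip: powr_add)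
    finally show "T * sqrt T = t" .
    have "T ^ 3 = t powr 2" using t by (simp add: T_def powr_power)
    also have "t powr 1 \<le> t powr 2" using t by (intro powr_mono) auto
    finally show "t \<le> T ^ 3" using t by simp
  qed
  have KT: "K * T \<le> r" "1 \<le> K * T" using r K(1) T mult_mono [of 1 K 1 T] by (auto simp: T_def)
  have KT1: "1 \<le> real r" using KT by linarith
  then have r1: "1 \<le> r" by simp
  have "1 * 1 \<le> K * t" using K(1) t by (intro mult_mono) auto
  then have s1': "1 \<le> real s" using s by linarith
  then have s1: "1 \<le> s" by simp
  have a1: "t / s \<le> 1 / K" using s s1' K(1) t by (simp add: field_simps)
  have a2: "t / (r * sqrt r) \<le> 1 / K"
  proof -
    have "K * t = (K * T) * sqrt T" using TT by simp
    also have "\<dots> \<le> r * sqrt r"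
    proof (intro mult_mono KT real_sqrt_le_mono)
      have "1 * T \<le> K * T" using K(1) T by (intro mult_right_mono) auto
      then show "T \<le> r" using KT by linarith
    qed (use K(1) T in auto)
    finally show ?thesis using KT1 K(1) by (simp add: field_simps)
  qed
  have a3: "t * (144 / r) ^ 3 \<le> 144 ^ 3 / K"
  proof -
    have "K * t \<le> K ^ 3 * T ^ 3"
      using K(1) TT t by (intro mult_mono) (auto intro: self_le_power)
    also have "\<dots> \<le> real r ^ 3" unfolding power_mult_distrib [symmetric] using KT K(1) T by (intro power_mono) auto
    finally show ?thesis using KT1 K(1) by (simp add: power_divide field_simps)
  qed
  have mR2: "?m * (t * R\<^sup>2) \<le> ?D * (2 + d * 144 ^ 3) / K * ?U"
  proof -
    have "?m * (t * R\<^sup>2) = t * (?m * R\<^sup>2)" by simp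
    also have "\<dots> \<le> t * (?D * (2 / s + d * (144 / r) ^ 3) * ?U)"
      unfolding R_def d_def using t by (intro mult_left_mono \<Phi>_sine_sum_square_le \<xi> r1 s1) auto
    also have "\<dots> = ?D * (2 * (t / s) + d * (t * (144 / r) ^ 3)) * ?U" by (simp add: algebra_simps)
    also have "\<dots> \<le> ?D * (2 * (1 / K) + d * (144 ^ 3 / K)) * ?U"
      using a1 a3 d U by (intro mult_right_mono mult_left_mono add_mono) auto
    also have "\<dots> = ?D * (2 + d * 144 ^ 3) / K * ?U" by (simp add: add_divide_distrib algebra_simps)
    finally show ?thesis .
  qed
  \<comment> \<open>AM-GM reduces the first power of |R| to 1 / sqrt t and sqrt t R^2; the first is
    at most 1/K because K^2 \<le> t. This is why the quadratic error is counted twice in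
    \<open>C\<close>.\<close>
  have mR: "?m * \<bar>R\<bar> \<le> ?m * (t * R\<^sup>2) + 1 / K * ?U"
  proof -
    have "2 * (sqrt t * \<bar>R\<bar>) \<le> 1 + (sqrt t * \<bar>R\<bar>)\<^sup>2"
      using zero_le_power2 [of "1 - sqrt t * \<bar>R\<bar>"] by (simp add: power2_diff)
    then have "2 * (sqrt t * \<bar>R\<bar>) / (2 * sqrt t) \<le> (1 + (sqrt t * \<bar>R\<bar>)\<^sup>2) / (2 * sqrt t)"
      using t by (intro divide_right_mono) auto
    moreover have "(1 + (sqrt t * \<bar>R\<bar>)\<^sup>2) / (2 * sqrt t) = (1 / sqrt t + sqrt t * R\<^sup>2) / 2"
    proof -
      have "(sqrt t * \<bar>R\<bar>)\<^sup>2 = sqrt t * (sqrt t * R\<^sup>2)" by (simp add: power_mult_distrib power2_eq_square)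
      then show ?thesis using t by (simp add: add_divide_distrib)
    qed
    ultimately have "\<bar>R\<bar> \<le> (1 / sqrt t + sqrt t * R\<^sup>2) / 2" using t by simp
    also have "\<dots> \<le> 1 / sqrt t + sqrt t * R\<^sup>2"
    proof -
      have half: "x / 2 \<le> x" if "0 \<le> x" for x :: real using that by simp
      have "0 \<le> 1 / sqrt t + sqrt t * R\<^sup>2" using t by (intro add_nonneg_nonneg mult_nonneg_nonneg) auto
      then show ?thesis using half by blast
    qed
    also have "\<dots> \<le> 1 / K + t * R\<^sup>2"
    proof (intro add_mono mult_right_mono)
      show "1 / sqrt t \<le> 1 / K" using st K(1) t by (intro divide_left_mono mult_pos_pos) auto
      show "sqrt t \<le> t" using t real_sqrt_le_mono [of t "t\<^sup>2"] by (simp add: power2_eq_square)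
    qed simp
    finally have "?m * \<bar>R\<bar> \<le> ?m * (1 / K + t * R\<^sup>2)" using m by (intro mult_left_mono)
    also have "\<dots> = 1 / K * ?m + ?m * (t * R\<^sup>2)" by (simp add: algebra_simps)
    also have "1 / K * ?m \<le> 1 / K * ?U" using K(1) by (intro mult_left_mono \<Phi>_mono) auto
    finally show ?thesis by simp
  qed
  have mQ: "?m * (t * Q) \<le> d * 144\<^sup>2 / K * ?U"
  proof -
    have j: "?m * \<bar>\<xi> $ j - pi / 2\<bar> ^ 3 \<le> 144\<^sup>2 / (r * sqrt r) * ?U" for j
      by (rule \<Phi>_le_factor [OF bump_power_moment_cubic]) (use \<xi> r1 in \<open>auto simp: mem_torus\<close>)
    have "?m * (t * Q) = t * (\<Sum>j\<in>UNIV. ?m * \<bar>\<xi> $ j - pi / 2\<bar> ^ 3)"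
      by (simp add: Q_def sum_distrib_left mult_ac)
    also have "\<dots> \<le> t * (\<Sum>j\<in>(UNIV :: 'n set). 144\<^sup>2 / (r * sqrt r) * ?U)"
      using t by (intro mult_left_mono sum_mono j) auto
    also have "\<dots> = d * 144\<^sup>2 * (t / (r * sqrt r)) * ?U" by (simp add: d_def)
    also have "\<dots> \<le> d * 144\<^sup>2 * (1 / K) * ?U" using a2 d U by (intro mult_right_mono mult_left_mono) auto
    finally show ?thesis by simp
  qed
  have "?m * (t * R\<^sup>2 + \<bar>R\<bar> + t * Q) = ?m * (t * R\<^sup>2) + ?m * \<bar>R\<bar> + ?m * (t * Q)" by (simp add: distrib_left)
  also have "\<dots> \<le> 2 * (?D * (2 + d * 144 ^ 3) / K * ?U) + 1 / K * ?U + d * 144\<^sup>2 / K * ?U"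
    using mR2 mR mQ by linarith
  also have "\<dots> = (2 * ?D * (2 + d * 144 ^ 3) + 1 + d * 144\<^sup>2) / K * ?U"
    by (simp add: add_divide_distrib algebra_simps)
  finally have "(1 + 2 * sqrt d) * (?m * (t * R\<^sup>2 + \<bar>R\<bar> + t * Q))
      \<le> (1 + 2 * sqrt d) * ((2 * ?D * (2 + d * 144 ^ 3) + 1 + d * 144\<^sup>2) / K * ?U)"
    using d by (intro mult_left_mono) auto
  then have E: "?m * ((1 + 2 * sqrt d) * (t * R\<^sup>2 + \<bar>R\<bar> + t * Q)) \<le> C / K * ?U"
    by (simp add: C_def mult_ac)
  have "?m * (sqrt (2 * d) * (sin \<theta>)\<^sup>2 - (1 + 2 * sqrt d) * (t * R\<^sup>2 + \<bar>R\<bar> + t * Q))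
      \<le> ?m * (\<omega> \<xi> * sin (t * \<omega> \<xi>) * sin \<theta>)"
    unfolding \<theta>_def R_def Q_def d_def using t n d2
    by (intro mult_left_mono wave_product_ge m) (auto simp: d_def)
  then show ?thesis using E by (simp add: right_diff_distrib mult.left_commute)
qed


section \<open>Duality and the size of the test integral\<close>

lemma wiener_bump: "wiener 1 (\<lambda>\<xi>. of_real (bump (c + phase y \<xi>)))"
proof -
  have "wiener (norm (1/2 :: complex) + norm (1/2 :: complex) * 1)
      (\<lambda>\<xi>. 1/2 + 1/2 * of_real (cos (c + phase y \<xi>)))"
    by (intro wiener_add wiener_mult wiener_const wiener_cos)
  then show ?thesis by (simp add: bump_def add_divide_distrib)
qed

lemma phase_of_nat: "phase (of_nat n) (\<xi> :: real ^ 'n) = real n * (\<Sum>j\<in>UNIV. \<xi> $ j)"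
  by (simp add: phase_def sum_distrib_left of_nat_index)

lemma shift_sum_phase:
  "real n * shift_sum (\<xi> :: real ^ 'n) = - real n * (pi / 2 * CARD('n)) + phase (of_nat n) \<xi>"
  by (simp add: shift_sum_def phase_of_nat sum_subtractf right_diff_distrib)

lemma wiener_\<Phi>: "wiener 1 (\<lambda>\<xi> :: real ^ 'n. of_real (\<Phi> p q \<xi>))"
proof -
  have "wiener ((\<Prod>j\<in>(UNIV :: 'n set). 1 ^ p) * 1 ^ q) (\<lambda>\<xi> :: real ^ 'n.
      (\<Prod>j\<in>UNIV. of_real (bump (- (pi / 2) + phase (axis j 1) \<xi>)) ^ p)
      * of_real (bump (- real 1 * (pi / 2 * CARD('n)) + phase (of_nat 1) \<xi>)) ^ q)"
    by (intro wiener_mult wiener_prod wiener_power wiener_bump) auto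
  then show ?thesis
    unfolding shift_sum_phase [symmetric] phase_axis by (simp add: \<Phi>_def)
qed

text \<open>The integral is the transform at 0 of a multiplier times the wave, so the multiplier
  bound applies. The factor \<omega>^2, of Wiener norm at most 4d, cancels the singular 1 / \<omega>
  and leaves \<open>\<omega> \<xi> * sin (t * \<omega> \<xi>)\<close>.\<close>

lemma wave_test:
  fixes D t c :: real and n p q :: nat
  assumes D: "\<And>x :: int ^ 'n. norm (FT (wave 0 t) x) \<le> D"
  shows "(\<integral>\<xi>. \<Phi> p q \<xi> * (\<omega> \<xi> * sin (t * \<omega> \<xi>) * sin (c + real n * shift_sum \<xi>)) \<partial>rst (torus :: (real ^ 'n) set))
    \<le> 4 * CARD('n) * D"
proof -
  let ?f = "\<lambda>\<xi> :: real ^ 'n. \<Phi> p q \<xi> * (\<omega> \<xi> * sin (t * \<omega> \<xi>) * sin (c + real n * shift_sum \<xi>))"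
  let ?m = "\<lambda>\<xi> :: real ^ 'n. of_real ((\<omega> \<xi>)\<^sup>2) * (of_real (\<Phi> p q \<xi>)
      * complex_of_real (sin ((c - real n * (pi / 2 * CARD('n))) + phase (of_nat n) \<xi>)))"
  have "wiener (real (4 * CARD('n)) * (1 * 1)) ?m"
    by (intro wiener_mult wiener_\<omega>_square wiener_\<Phi> wiener_sin)
  then have "norm (FT (\<lambda>\<xi>. ?m \<xi> * wave 0 t \<xi>) 0) \<le> real (4 * CARD('n)) * (1 * 1) * D"
    by (rule wienerD) (auto intro: integrable_wave D)
  also have "(\<lambda>\<xi>. ?m \<xi> * wave 0 t \<xi>) = (\<lambda>\<xi>. of_real (?f \<xi>))"
  proof
    fix \<xi> :: "real ^ 'n"
    have "(\<omega> \<xi>)\<^sup>2 * (sin (t * \<omega> \<xi>) / \<omega> \<xi>) = \<omega> \<xi> * sin (t * \<omega> \<xi>)"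
      by (cases "\<omega> \<xi> = 0") (simp_all add: power2_eq_square)
    then have "(\<omega> \<xi>)\<^sup>2 * (a * b) * (sin (t * \<omega> \<xi>) / \<omega> \<xi>) = a * (\<omega> \<xi> * sin (t * \<omega> \<xi>) * b)" for a b
      by (simp only: mult_ac)
    note eq = this
    have ph: "(c - real n * (pi / 2 * CARD('n))) + phase (of_nat n) \<xi> = c + real n * shift_sum \<xi>"
      by (simp only: shift_sum_phase)
    have "?m \<xi> * wave 0 t \<xi> = of_real ((\<omega> \<xi>)\<^sup>2 * (\<Phi> p q \<xi> * sin (c + real n * shift_sum \<xi>)) * (sin (t * \<omega> \<xi>) / \<omega> \<xi>))"
      unfolding wave_def ph by simp
    then show "?m \<xi> * wave 0 t \<xi> = of_real (?f \<xi>)" unfolding eq .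
  qed
  also have "FT (\<lambda>\<xi>. of_real (?f \<xi>)) 0 = of_real (integral\<^sup>L (rst torus) ?f)"
  proof -
    have "phase 0 \<xi> = 0" for \<xi> :: "real ^ 'n" by (simp add: phase_def)
    then show ?thesis
      unfolding FT_def by (simp only: of_real_0 mult_zero_right exp_zero mult_1 integral_complex_of_real)
  qed
  finally show ?thesis by simp
qed

text \<open>Up to a dimensional factor, \<open>W\<close> is the volume of the box. All integrals are
  compared with the same \<open>W\<close> by constants depending on the dimension alone, so
  \<open>K\<close> can later be chosen without circularity.\<close>

lemma bump_normalization:
  fixes r s :: nat
  assumes r: "1 \<le> r" and s: "1 \<le> s" and rs: "2 * r \<le> s"
  defines "W \<equiv> (2 * pi) ^ CARD('n) * (1 / sqrt s * (1 / sqrt r) ^ (CARD('n) - 1))"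
  shows "(\<integral>\<xi>. \<Phi> r s \<xi> \<partial>rst (torus :: (real ^ 'n) set)) \<le> W" (is ?upper)
    and "1/4 * (1/8) ^ CARD('n) * W \<le> (\<integral>\<xi>. \<Phi> (4 * r) (2 * s) \<xi> \<partial>rst (torus :: (real ^ 'n) set))" (is ?lower)
    and "1 \<le> n \<Longrightarrow> 4 * r \<le> n \<Longrightarrow> \<bar>\<integral>\<xi>. \<Phi> (4 * r) (2 * s) \<xi> * cos (c + 2 * real n * shift_sum \<xi>) \<partial>rst (torus :: (real ^ 'n) set)\<bar>
      \<le> W * (sqrt s / n)" (is "_ \<Longrightarrow> _ \<Longrightarrow> ?cos")
proof -
  let ?N = "CARD('n)"
  have pos: "0 < sqrt r" "0 < sqrt s" using r s by auto
  have A0: "A p 0 \<le> 1 / sqrt k" if "1 \<le> k" "k \<le> p" for p k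
  proof -
    have "A p 0 \<le> 1 / sqrt (2 * real p + 1)" by (rule A_0_upper)
    also have "\<dots> \<le> 1 / sqrt k" using that by (intro divide_left_mono real_sqrt_le_mono) auto
    finally show ?thesis .
  qed
  show ?upper
    unfolding W_def using r s
    by (intro order_trans [OF integral_\<Phi>_upper] mult_left_mono mult_mono power_mono A0) auto
  show ?cos if n: "1 \<le> n" "4 * r \<le> n"
  proof -
    have "\<bar>\<integral>\<xi>. \<Phi> (4 * r) (2 * s) \<xi> * cos (c + 2 * real n * shift_sum \<xi>) \<partial>rst (torus :: (real ^ 'n) set)\<bar>
        \<le> (2 * pi) ^ ?N * (1 / n * A (4 * r) 0 ^ (?N - 1))"
      by (rule integral_\<Phi>_cos [OF n])
    also have "\<dots> \<le> (2 * pi) ^ ?N * (1 / n * (1 / sqrt r) ^ (?N - 1))"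
      using r by (intro mult_left_mono power_mono A0) auto
    also have "\<dots> = W * (sqrt s / n)" unfolding W_def using pos by simp
    finally show ?thesis .
  qed
  have N: "?N = Suc (?N - 1)" by simp
  have a: "1 / (8 * sqrt r) \<le> A (4 * r) 0 / 2"
    using A_0_lower [of "4 * r"] r by (simp add: real_sqrt_mult mult_ac)
  have b: "1 / (4 * (sqrt 2 * sqrt s)) \<le> A (2 * s) 0 / 2"
    using A_0_lower [of "2 * s"] s by (simp add: real_sqrt_mult mult_ac)
  have "1/4 * (1/8) ^ ?N * W = (2 * pi) ^ ?N * ((sqrt 2 * sqrt r) * (1 / (4 * (sqrt 2 * sqrt s)) * (1 / (8 * sqrt r)) ^ ?N))"
  proof -
    have "(1 / (8 * sqrt r)) ^ ?N = (1/8) ^ ?N * (1 / sqrt r) ^ ?N"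
      by (simp flip: power_mult_distrib)
    also have "(1 / sqrt r) ^ ?N = 1 / sqrt r * (1 / sqrt r) ^ (?N - 1)" by (subst N) (rule power_Suc)
    finally have e: "(1 / (8 * sqrt r)) ^ ?N = (1/8) ^ ?N * (1 / sqrt r * (1 / sqrt r) ^ (?N - 1))" .
    show ?thesis unfolding e W_def using pos by simp
  qed
  also have "\<dots> \<le> (2 * pi) ^ ?N * ((sqrt 2 * sqrt r) * (A (2 * s) 0 / 2 * (A (4 * r) 0 / 2) ^ ?N))"
    using a b pos by (intro mult_left_mono mult_mono power_mono) auto
  also have "sqrt 2 * sqrt r = sqrt (real (4 * r) / 2)" by (simp flip: real_sqrt_mult)
  also have "(2 * pi) ^ ?N * (sqrt (real (4 * r) / 2) * (A (2 * s) 0 / 2 * (A (4 * r) 0 / 2) ^ ?N))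
      \<le> (\<integral>\<xi>. \<Phi> (4 * r) (2 * s) \<xi> \<partial>rst (torus :: (real ^ 'n) set))"
    using r rs by (intro integral_\<Phi>_lower) auto
  finally show ?lower .
qed

lemma FT_wave_lower:
  assumes d2: "2 \<le> CARD('n)"
  shows "\<exists>c>0. \<exists>T>0. \<forall>t\<ge>T. \<forall>D. (\<forall>x :: int ^ 'n. norm (FT (wave 0 t) x) \<le> D) \<longrightarrow> c * t powr (- \<sigma> CARD('n)) \<le> D"
proof -
  let ?N = "CARD('n)"
  define d where "d = real ?N"
  define H where "H = sqrt (2 * d)"
  define C where "C = (1 + 2 * sqrt d) * (2 * (d ^ 8 + 2 * d + 16) * (2 + d * 144 ^ 3) + 1 + d * 144\<^sup>2)"
  define c0 where "c0 = 1/4 * (1/8 :: real) ^ ?N"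
  \<comment> \<open>Chosen so that the errors are at most H c0 W / 8, half of the main term H c0 W /
    4.\<close>
  define K where "K = max 1 (8 * C / (H * c0))"
  have d: "2 \<le> d" using d2 by (simp add: d_def)
  have H: "0 < H" using d by (simp add: H_def)
  have c0: "0 < c0" by (simp add: c0_def)
  have K: "1 \<le> K" "0 < K" by (auto simp: K_def)
  have CK: "C / K \<le> H * c0 / 8"
  proof -
    have "8 * C / (H * c0) \<le> K" by (simp add: K_def)
    then have "8 * C \<le> K * (H * c0)" using H c0 by (simp add: pos_divide_le_eq)
    then show ?thesis using K by (simp add: field_simps)
  qed
  define c where "c = (2 * pi) ^ ?N * (1 / sqrt (2 * K)) ^ ?N * (H * c0 / 8) / (4 * d)"
  have c: "0 < c" using d H c0 K by (simp add: c_def)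
  \<comment> \<open>After rounding, the last three conditions give 2 r \<le> s, 4 r \<le> n and
    sqrt(s) / n \<le> c0 / 2. They hold for large t by the ordering of the powers t^(1/2), t^(2/3)
    and t.\<close>
  have "\<forall>\<^sub>F t :: real in at_top. K\<^sup>2 \<le> t" "\<forall>\<^sub>F t :: real in at_top. 1 \<le> t"
    by (rule eventually_ge_at_top)+
  moreover have "\<forall>\<^sub>F t :: real in at_top. 2 * (K * t powr (2/3) + 1) \<le> K * t"
    using K by real_asymp
  moreover have "\<forall>\<^sub>F t :: real in at_top. 4 * (K * t powr (2/3) + 1) \<le> t / H - 1"
    using K H by real_asymp
  moreover have "\<forall>\<^sub>F t :: real in at_top. sqrt (2 * K * t) \<le> c0 / 2 * (t / H - 1)"
    using K H c0 by real_asymp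
  ultimately have "\<forall>\<^sub>F t :: real in at_top. K\<^sup>2 \<le> t \<and> 1 \<le> t \<and> 2 * (K * t powr (2/3) + 1) \<le> K * t
      \<and> 4 * (K * t powr (2/3) + 1) \<le> t / H - 1 \<and> sqrt (2 * K * t) \<le> c0 / 2 * (t / H - 1)"
    by (intro eventually_conj)
  then obtain T where T: "\<And>t. T \<le> t \<Longrightarrow> K\<^sup>2 \<le> t \<and> 1 \<le> t \<and> 2 * (K * t powr (2/3) + 1) \<le> K * t
      \<and> 4 * (K * t powr (2/3) + 1) \<le> t / H - 1 \<and> sqrt (2 * K * t) \<le> c0 / 2 * (t / H - 1)"
    unfolding eventually_at_top_linorder by blast
  have "c * t powr (- \<sigma> ?N) \<le> D" if t: "max T 1 \<le> t" and D: "\<And>x :: int ^ 'n. norm (FT (wave 0 t) x) \<le> D" for t D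
  proof -
    have t1: "1 \<le> t" "K\<^sup>2 \<le> t" and cond: "2 * (K * t powr (2/3) + 1) \<le> K * t"
      "4 * (K * t powr (2/3) + 1) \<le> t / H - 1" "sqrt (2 * K * t) \<le> c0 / 2 * (t / H - 1)"
      using T [of t] t by auto
    define P where "P = K * t powr (2/3)"
    \<comment> \<open>Rounding \<open>r\<close> and \<open>s\<close> up keeps the concentration,
      rounding \<open>n\<close> down keeps it below t / H; the losses of at most 1 are covered by
      the slack in the conditions on t.\<close>
    define r where "r = nat \<lceil>P\<rceil>"
    define s where "s = nat \<lceil>K * t\<rceil>"
    define n where "n = nat \<lfloor>t / H\<rfloor>"
    have cond': "2 * P + 2 \<le> K * t" "4 * P + 4 \<le> t / H - 1"
      using cond(1,2) by (simp_all add: P_def distrib_left)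
    have P: "1 \<le> P"
    proof -
      have "1 * 1 \<le> K * t powr (2/3)" using K t1 by (intro mult_mono ge_one_powr_ge_zero) auto
      then show ?thesis by (simp add: P_def)
    qed
    have Kt: "1 \<le> K * t" using mult_mono [of 1 K 1 t] K t1 by simp
    have r: "P \<le> r" "r \<le> P + 1" using P unfolding r_def by linarith+
    have s: "K * t \<le> s" "s \<le> K * t + 1" using Kt unfolding s_def by linarith+
    have tH: "0 \<le> t / H" using t1 H by simp
    have n: "n \<le> t / H" "t / H - 1 \<le> n" using tH unfolding n_def by linarith+
    have r1: "1 \<le> r" and s1: "1 \<le> s" using r P s Kt by linarith+
    have "2 * real r \<le> s" using r s cond'(1) by linarith
    then have rs: "2 * r \<le> s" by linarith
    have "4 * real r \<le> n" using r n cond'(2) by linarith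
    then have rn: "4 * r \<le> n" by linarith
    then have n1: "1 \<le> n" using r1 by linarith
    have "sqrt s \<le> sqrt (2 * K * t)" using s Kt by (intro real_sqrt_le_mono) simp
    also have "\<dots> \<le> c0 / 2 * n" using cond(3) n c0 by (meson order_trans mult_left_mono half_gt_zero less_imp_le)
    finally have sn: "sqrt s / n \<le> c0 / 2" using n1 by (simp add: pos_divide_le_eq)
    define W where "W = (2 * pi) ^ ?N * (1 / sqrt s * (1 / sqrt r) ^ (?N - 1))"
    have W: "0 \<le> W" by (simp add: W_def)
    let ?m = "\<Phi> (4 * r) (2 * s) :: real ^ 'n \<Rightarrow> real" and ?U = "\<Phi> r s :: real ^ 'n \<Rightarrow> real"
    let ?I = "\<lambda>f. integral\<^sup>L (rst (torus :: (real ^ 'n) set)) f"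
    define \<theta> where "\<theta> = (\<lambda>\<xi> :: real ^ 'n. t * H + real n * shift_sum \<xi>)"
    have [measurable]: "\<theta> \<in> borel_measurable borel" unfolding \<theta>_def by measurable
    have U: "?I ?U \<le> W" and m: "c0 * W \<le> ?I ?m"
      using bump_normalization(1,2) [where 'n = 'n, OF r1 s1 rs] by (simp_all add: W_def c0_def)
    have mcos: "\<bar>?I (\<lambda>\<xi>. ?m \<xi> * cos (2 * \<theta> \<xi>))\<bar> \<le> W * (c0 / 2)"
    proof -
      have "2 * \<theta> \<xi> = 2 * t * H + 2 * real n * shift_sum \<xi>" for \<xi> by (simp add: \<theta>_def)
      then have "\<bar>?I (\<lambda>\<xi>. ?m \<xi> * cos (2 * \<theta> \<xi>))\<bar> \<le> W * (sqrt s / n)"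
        using bump_normalization(3) [where 'n = 'n, OF r1 s1 rs n1 rn, of "2 * t * H"] by (simp add: W_def)
      also have "\<dots> \<le> W * (c0 / 2)" using sn W by (intro mult_left_mono)
      finally show ?thesis .
    qed
    have mb: "\<bar>?m \<xi>\<bar> \<le> 1" for \<xi> using \<Phi>_range [of "4 * r" "2 * s" \<xi>] by simp
    have icos: "integrable (rst torus) (\<lambda>\<xi>. ?m \<xi> * cos (2 * \<theta> \<xi>))"
      using mb by (intro integrable_rst_bounded [where B = 1]) (auto simp: abs_mult intro!: mult_le_one)
    have im: "integrable (rst torus) ?m" by (rule integrable_\<Phi>)
    have sin2: "?I (\<lambda>\<xi>. ?m \<xi> * (sin (\<theta> \<xi>))\<^sup>2) = (?I ?m - ?I (\<lambda>\<xi>. ?m \<xi> * cos (2 * \<theta> \<xi>))) / 2"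
    proof -
      have eq: "?m \<xi> * (sin (\<theta> \<xi>))\<^sup>2 = (?m \<xi> - ?m \<xi> * cos (2 * \<theta> \<xi>)) / 2" for \<xi>
        unfolding cos_double_sin by (simp add: algebra_simps)
      show ?thesis
        unfolding eq Bochner_Integration.integral_diff [OF im icos, symmetric] by simp
    qed
    have isin2: "integrable (rst torus) (\<lambda>\<xi>. ?m \<xi> * (sin (\<theta> \<xi>))\<^sup>2)"
      using mb by (intro integrable_rst_bounded [where B = 1]) (auto simp: abs_mult abs_square_le_1 intro!: mult_le_one)
    have iprod: "integrable (rst torus) (\<lambda>\<xi>. ?m \<xi> * (\<omega> \<xi> * sin (t * \<omega> \<xi>) * sin (\<theta> \<xi>)))"
    proof (rule integrable_rst_bounded [where B = "1 * (sqrt (4 * ?N) * 1 * 1)"])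
      fix \<xi> :: "real ^ 'n"
      show "norm (?m \<xi> * (\<omega> \<xi> * sin (t * \<omega> \<xi>) * sin (\<theta> \<xi>))) \<le> 1 * (sqrt (4 * ?N) * 1 * 1)"
        unfolding real_norm_def abs_mult using mb \<omega>_le [of \<xi>] by (intro mult_mono) auto
    qed auto
    define X where "X = H * c0 * W"
    \<comment> \<open>Half of the difference between the mass c0 W and the oscillating part, at most
      c0 W / 2, leaves c0 W / 4.\<close>
    have "H * (c0 * W / 4) \<le> H * ?I (\<lambda>\<xi>. ?m \<xi> * (sin (\<theta> \<xi>))\<^sup>2)"
      using m mcos H unfolding sin2 by (intro mult_left_mono) (simp_all add: abs_le_iff algebra_simps)
    then have f1: "X / 4 \<le> H * ?I (\<lambda>\<xi>. ?m \<xi> * (sin (\<theta> \<xi>))\<^sup>2)" by (simp add: X_def)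
    have "C / K * ?I ?U \<le> H * c0 / 8 * W"
    proof -
      have "0 \<le> C" unfolding C_def using d by (intro mult_nonneg_nonneg add_nonneg_nonneg) auto
      then have "C / K * ?I ?U \<le> C / K * W" using U K by (intro mult_left_mono) auto
      also have "\<dots> \<le> H * c0 / 8 * W" using CK W by (intro mult_right_mono)
      finally show ?thesis .
    qed
    then have f2: "C / K * ?I ?U \<le> X / 8" by (simp add: X_def)
    have "H * ?I (\<lambda>\<xi>. ?m \<xi> * (sin (\<theta> \<xi>))\<^sup>2) - C / K * ?I ?U
        = ?I (\<lambda>\<xi>. H * (?m \<xi> * (sin (\<theta> \<xi>))\<^sup>2) - C / K * ?U \<xi>)"
      unfolding integral_mult_right_zero [symmetric]
      by (rule Bochner_Integration.integral_diff [symmetric]) (intro integrable_mult_right isin2 integrable_\<Phi>)+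
    also have "\<dots> \<le> ?I (\<lambda>\<xi>. ?m \<xi> * (\<omega> \<xi> * sin (t * \<omega> \<xi>) * sin (\<theta> \<xi>)))"
    proof (rule integral_rst_mono)
      fix \<xi> :: "real ^ 'n" assume "\<xi> \<in> torus"
      then show "H * (?m \<xi> * (sin (\<theta> \<xi>))\<^sup>2) - C / K * ?U \<xi> \<le> ?m \<xi> * (\<omega> \<xi> * sin (t * \<omega> \<xi>) * sin (\<theta> \<xi>))"
        unfolding H_def C_def \<theta>_def d_def using d2 n t1 K r s
        by (intro \<Phi>_wave_product_ge) (auto simp: H_def d_def P_def)
    next
      show "integrable (rst torus) (\<lambda>\<xi>. H * (?m \<xi> * (sin (\<theta> \<xi>))\<^sup>2) - C / K * ?U \<xi>)"
        by (intro Bochner_Integration.integrable_diff integrable_mult_right isin2 integrable_\<Phi>)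
    qed (use iprod in auto)
    also have "\<dots> \<le> 4 * d * D"
      unfolding \<theta>_def d_def using wave_test [OF D, of "4 * r" "2 * s" "t * H" n] by simp
    finally have "X / 8 \<le> 4 * d * D" using f1 f2 by linarith
    then have "W * (H * c0 / 8) \<le> 4 * d * D" by (simp add: X_def mult_ac)
    moreover have "(2 * pi) ^ ?N * (1 / sqrt (2 * K)) ^ ?N * t powr (- \<sigma> ?N) \<le> W"
    proof -
      have N: "?N = Suc (?N - 1)" by simp
      have "sqrt s \<le> sqrt (2 * K * t)" using s Kt by (intro real_sqrt_le_mono) simp
      then have 1: "1 / (sqrt (2 * K) * sqrt t) \<le> 1 / sqrt s"
        using s1 K t1 by (intro divide_left_mono) (auto simp: real_sqrt_mult)
      have "sqrt r \<le> sqrt (2 * P)" using r P by (intro real_sqrt_le_mono) simp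
      also have "\<dots> = sqrt (2 * K) * t powr (1/3)"
        using t1 by (simp add: P_def real_sqrt_mult powr_half_sqrt [symmetric] powr_powr)
      finally have 2: "1 / (sqrt (2 * K) * t powr (1/3)) \<le> 1 / sqrt r"
        using r1 K t1 by (intro divide_left_mono) auto
      have "(1 / sqrt (2 * K)) ^ ?N * t powr (- \<sigma> ?N)
          = 1 / (sqrt (2 * K) * sqrt t) * (1 / (sqrt (2 * K) * t powr (1/3))) ^ (?N - 1)"
      proof -
        have "1 / sqrt t = t powr (- 1/2)"
          using t1 powr_minus_divide [of t "1/2"] by (simp add: powr_half_sqrt)
        moreover have "(1 / t powr (1/3)) ^ (?N - 1) = t powr (- (d - 1) / 3)"
        proof -
          have "1 / t powr (1/3) = t powr (- (1/3))" by (simp add: powr_minus_divide)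
          then have "(1 / t powr (1/3)) ^ (?N - 1) = t powr (real (?N - 1) * (- (1/3)))"
            using t1 by (simp only: powr_power)
          also have "real (?N - 1) * (- (1/3)) = - (d - 1) / 3"
          proof -
            have "x * (- (1/3)) = - x / 3" for x :: real by simp
            moreover have "real (?N - 1) = d - 1" using d2 by (simp add: d_def of_nat_diff)
            ultimately show ?thesis by metis
          qed
          finally show ?thesis .
        qed
        moreover have "- \<sigma> ?N = - 1/2 + - (d - 1) / 3" by (simp add: \<sigma>_def d_def field_simps)
        ultimately have "t powr (- \<sigma> ?N) = 1 / sqrt t * (1 / t powr (1/3)) ^ (?N - 1)"
          by (simp only: powr_add)
        moreover have "(1 / sqrt (2 * K)) ^ ?N = 1 / sqrt (2 * K) * (1 / sqrt (2 * K)) ^ (?N - 1)"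
          by (subst N) (rule power_Suc)
        moreover have "(1 / (sqrt (2 * K) * t powr (1/3))) ^ (?N - 1)
            = (1 / sqrt (2 * K)) ^ (?N - 1) * (1 / t powr (1/3)) ^ (?N - 1)"
          by (simp flip: power_mult_distrib)
        ultimately show ?thesis by simp
      qed
      also have "\<dots> \<le> 1 / sqrt s * (1 / sqrt r) ^ (?N - 1)"
        using 1 2 K t1 by (intro mult_mono power_mono) auto
      finally show ?thesis unfolding W_def mult.assoc by (intro mult_left_mono) auto
    qed
    then have "(2 * pi) ^ ?N * (1 / sqrt (2 * K)) ^ ?N * t powr (- \<sigma> ?N) * (H * c0 / 8) \<le> W * (H * c0 / 8)"
      using H c0 by (intro mult_right_mono) auto
    ultimately have "(2 * pi) ^ ?N * (1 / sqrt (2 * K)) ^ ?N * t powr (- \<sigma> ?N) * (H * c0 / 8) \<le> 4 * d * D"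
      by linarith
    then have "(2 * pi) ^ ?N * (1 / sqrt (2 * K)) ^ ?N * t powr (- \<sigma> ?N) * (H * c0 / 8) / (4 * d) \<le> 4 * d * D / (4 * d)"
      using d by (intro divide_right_mono) auto
    then show ?thesis unfolding c_def using d by (simp add: mult_ac)
  qed
  moreover have "0 < max T 1" by simp
  ultimately show ?thesis using c by blast
qed

lemma G_minus: "G x (- t) = - G x t"
  by (simp add: G_eq_FT FT_wave_minus)

lemma G_lower_bound:
  assumes d: "5 \<le> CARD('n)"
  shows "\<exists>c>0. \<exists>T>0. \<forall>t. T \<le> \<bar>t\<bar> \<longrightarrow> c * (1 + \<bar>t\<bar>) powr (- \<sigma> CARD('n)) \<le> (SUP x :: int ^ 'n. cmod (G x t))"
proof -
  let ?N = "CARD('n)"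
  have d2: "2 \<le> ?N" using d by simp
  obtain c T where c: "0 < c" and T: "0 < T" and low: "\<And>t D. T \<le> t \<Longrightarrow>
      (\<And>x :: int ^ 'n. norm (FT (wave 0 t) x) \<le> D) \<Longrightarrow> c * t powr (- \<sigma> ?N) \<le> D"
    using FT_wave_lower [OF d2] by metis
  obtain C where up: "\<And>(x :: int ^ 'n) t. cmod (G x t) \<le> C * (1 + \<bar>t\<bar>) powr (- \<sigma> ?N)"
    using G_upper_bound [OF d] by blast
  have P: "0 < (2 * pi) ^ ?N" by simp
  have "c / (2 * pi) ^ ?N * (1 + \<bar>t\<bar>) powr (- \<sigma> ?N) \<le> (SUP x :: int ^ 'n. cmod (G x t))"
    if t: "T \<le> \<bar>t\<bar>" for t
  proof -
    let ?S = "SUP x :: int ^ 'n. cmod (G x t)"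
    \<comment> \<open>The upper bound enters here: it makes the family bounded above, without which
      the real supremum would carry no information.\<close>
    have S: "cmod (G x t) \<le> ?S" for x :: "int ^ 'n"
      by (rule cSUP_upper) (auto intro!: bdd_aboveI up)
    have "norm (FT (wave 0 \<bar>t\<bar>) x) \<le> (2 * pi) ^ ?N * ?S" for x :: "int ^ 'n"
    proof -
      have "cmod (G x \<bar>t\<bar>) = cmod (G x t)" by (cases "0 \<le> t") (simp_all add: G_minus)
      moreover have "cmod (G x \<bar>t\<bar>) = norm (FT (wave 0 \<bar>t\<bar>) x) / (2 * pi) ^ ?N"
        by (simp add: G_eq_FT norm_mult norm_divide norm_power)
      ultimately have "norm (FT (wave 0 \<bar>t\<bar>) x) / (2 * pi) ^ ?N \<le> ?S" using S [of x] by simp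
      then show ?thesis using P by (simp only: pos_divide_le_eq mult.commute)
    qed
    from low [OF t this] have "c * \<bar>t\<bar> powr (- \<sigma> ?N) \<le> (2 * pi) ^ ?N * ?S" .
    moreover have "c * (1 + \<bar>t\<bar>) powr (- \<sigma> ?N) \<le> c * \<bar>t\<bar> powr (- \<sigma> ?N)"
      using c t T \<sigma>_pos [of ?N] by (intro mult_left_mono powr_mono2') auto
    ultimately have "c * (1 + \<bar>t\<bar>) powr (- \<sigma> ?N) \<le> (2 * pi) ^ ?N * ?S" by linarith
    then have "c * (1 + \<bar>t\<bar>) powr (- \<sigma> ?N) / (2 * pi) ^ ?N \<le> ?S"
      using P by (simp only: pos_divide_le_eq mult.commute)
    then show ?thesis by simp
  qed
  moreover have "0 < c / (2 * pi) ^ ?N" using c P by simp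
  ultimately show ?thesis using T by blast
qed

theorem theorem1p1:
  assumes "CARD('n::finite) \<ge> 5"
  shows "\<exists>C c T. C > 0 \<and> c > 0 \<and> T > 0 \<and>
    (\<forall>(x :: int ^ 'n) t. cmod (G x t) \<le> C * (1 + \<bar>t\<bar>) powr (- \<sigma> CARD('n))) \<and>
    (\<forall>t. \<bar>t\<bar> \<ge> T \<longrightarrow> (SUP x :: int ^ 'n. cmod (G x t)) \<ge> c * (1 + \<bar>t\<bar>) powr (- \<sigma> CARD('n)))"
  using G_upper_bound [OF assms] G_lower_bound [OF assms] by blast

end
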